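(* For each integer $n\ge3$ there exist a field $k_n$ and a finite-dimensional commutative $k_n$-algebra $A_n$ with $\dim_{k_n}(J_n/J_n^2)\ge 2n$, where $J_n$ is the Jacobson radical of $A_n$, such that $G_{A_n}$ is not $R$-trivial as a $k_n$-group and the rank of $G_{A_n}$ is $n+1$.
   Context: Algebras are unital and associative. For a finite-dimensional $k$-algebra $A$, $\mathrm{Aut}_k(A)$ is regarded as the affine algebraic $k$-group $B\mapsto\mathrm{Aut}_B(A\otimes_kB)$, and $G_A$ is its identity component. The rank of an algebraic group is the dimension of a maximal torus. For a $k$-variety $X$, points $x,y\in X(k)$ are $R$-equivalent if there are points $x_0=x,\dots,x_r=y$ in $X(k)$ and rational maps $f_i:\mathbb{A}^1_k\dashrightarrow X$ over $k$, regular at $0$ and $1$, with $f_i(0)=x_{i-1}$ and $f_i(1)=x_i$. A connected algebraic $k$-group $G$ is $R$-trivial if for every field extension $L/k$ all points of $G(L)$ are $R$-equivalent over $L$. *)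

theory Defs
  imports
    "HOL-Algebra.Algebra"
    "HOL-Analysis.Abstract_Topology_2"
    "Jordan_Normal_Form.Missing_VectorSpace"
begin

section \<open>The Jacobson radical and quotients of modules\<close>

text \<open>For a commutative ring; the intersection with the carrier only matters for the zero ring.\<close>

definition jacobson_radical :: "('a, 'm) ring_scheme \<Rightarrow> 'a set"
  where "jacobson_radical A = carrier A \<inter> \<Inter> {I. maximalideal I A}"

text \<open>\<open>V / W\<close> for submodules \<open>W \<subseteq> V\<close> of \<open>M\<close>, as the module of additive cosets.  The multiplicative
  fields of the record play no role in the module structure.\<close>

definition quotient_module :: "('k, 'a, 'm) module_scheme \<Rightarrow> 'a set \<Rightarrow> 'a set \<Rightarrow> ('k, 'a set) module"
  where "quotient_module M V W =
    \<lparr>carrier = (\<lambda>v. W +>\<^bsub>M\<^esub> v) ` V,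
     monoid.mult = undefined, one = undefined,
     ring.zero = W,
     ring.add = (\<lambda>C D. C <+>\<^bsub>M\<^esub> D),
     smult = (\<lambda>c C. W <+>\<^bsub>M\<^esub> ((\<lambda>v. c \<odot>\<^bsub>M\<^esub> v) ` C))\<rparr>"


section \<open>Scalar extension and automorphisms of algebras\<close>

text \<open>Let \<open>A\<close> be a \<open>k\<close>-algebra with finite \<open>k\<close>-basis \<open>E\<close>, and let \<open>h: k \<rightarrow> B\<close> be a homomorphism of
  commutative rings.  Then \<open>A \<otimes>\<^sub>k B\<close> is a free \<open>B\<close>-module on the elements \<open>x \<otimes> 1\<close>, \<open>x \<in> E\<close>; it is
  realised on the set \<open>B\<^sup>E\<close> of coordinate families, with the structure constants of \<open>A\<close>.  Another
  basis gives an isomorphic \<open>B\<close>-algebra, so all notions below depend on \<open>E\<close> only up to linear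
  coordinate changes over \<open>k\<close>.\<close>

definition coords :: "('k, 'r) ring_scheme \<Rightarrow> ('k, 'a, 'm) module_scheme \<Rightarrow> 'a set \<Rightarrow> 'a \<Rightarrow> 'a \<Rightarrow> 'k"
  where "coords k A E v =
    (THE c. c \<in> E \<rightarrow>\<^sub>E carrier k \<and> v = (\<Oplus>\<^bsub>A\<^esub>x\<in>E. c x \<odot>\<^bsub>A\<^esub> x))"

definition scalar_ext ::
  "('k, 'r) ring_scheme \<Rightarrow> ('k, 'a, 'm) module_scheme \<Rightarrow> 'a set \<Rightarrow>
   ('b, 's) ring_scheme \<Rightarrow> ('k \<Rightarrow> 'b) \<Rightarrow> ('b, 'a \<Rightarrow> 'b) module"
  where "scalar_ext k A E B h =
    \<lparr>carrier = E \<rightarrow>\<^sub>E carrier B,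
     monoid.mult = (\<lambda>u v. \<lambda>z\<in>E. \<Oplus>\<^bsub>B\<^esub>x\<in>E. \<Oplus>\<^bsub>B\<^esub>y\<in>E. (u x \<otimes>\<^bsub>B\<^esub> v y) \<otimes>\<^bsub>B\<^esub> h (coords k A E (x \<otimes>\<^bsub>A\<^esub> y) z)),
     one = (\<lambda>z\<in>E. h (coords k A E \<one>\<^bsub>A\<^esub> z)),
     ring.zero = (\<lambda>z\<in>E. \<zero>\<^bsub>B\<^esub>),
     ring.add = (\<lambda>u v. \<lambda>z\<in>E. u z \<oplus>\<^bsub>B\<^esub> v z),
     smult = (\<lambda>b v. \<lambda>z\<in>E. b \<otimes>\<^bsub>B\<^esub> v z)\<rparr>"

definition alg_aut :: "('b, 's) ring_scheme \<Rightarrow> ('b, 'v, 'm) module_scheme \<Rightarrow> ('v \<Rightarrow> 'v) set"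
  where "alg_aut B M = {f \<in> Bij (carrier M). f \<in> ring_hom M M \<and>
    (\<forall>b\<in>carrier B. \<forall>v\<in>carrier M. f (b \<odot>\<^bsub>M\<^esub> v) = b \<odot>\<^bsub>M\<^esub> f v)}"

definition alg_aut_group :: "('b, 's) ring_scheme \<Rightarrow> ('b, 'v, 'm) module_scheme \<Rightarrow> ('v \<Rightarrow> 'v) monoid"
  where "alg_aut_group B M = (BijGroup (carrier M))\<lparr>carrier := alg_aut B M\<rparr>"

text \<open>The functor \<open>B \<mapsto> Aut\<^sub>B (A \<otimes>\<^sub>k B)\<close> on commutative \<open>k\<close>-algebras \<open>h: k \<rightarrow> B\<close>.\<close>

definition Aut_functor ::
  "('k, 'r) ring_scheme \<Rightarrow> ('k, 'a, 'm) module_scheme \<Rightarrow> 'a set \<Rightarrow>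
   ('b, 's) ring_scheme \<Rightarrow> ('k \<Rightarrow> 'b) \<Rightarrow> (('a \<Rightarrow> 'b) \<Rightarrow> ('a \<Rightarrow> 'b)) set"
  where "Aut_functor k A E B h = alg_aut B (scalar_ext k A E B h)"

text \<open>\<open>basis_vec B E x\<close> is \<open>x \<otimes> 1\<close>, and \<open>mat_entry B E x y f\<close> is the \<open>y\<close>-coordinate of \<open>f (x \<otimes> 1)\<close>.\<close>

definition basis_vec :: "('b, 's) ring_scheme \<Rightarrow> 'a set \<Rightarrow> 'a \<Rightarrow> 'a \<Rightarrow> 'b"
  where "basis_vec B E x = (\<lambda>z\<in>E. if z = x then \<one>\<^bsub>B\<^esub> else \<zero>\<^bsub>B\<^esub>)"

definition mat_entry ::
  "('b, 's) ring_scheme \<Rightarrow> 'a set \<Rightarrow> 'a \<Rightarrow> 'a \<Rightarrow> (('a \<Rightarrow> 'b) \<Rightarrow> ('a \<Rightarrow> 'b)) \<Rightarrow> 'b"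
  where "mat_entry B E x y f = f (basis_vec B E x) y"

text \<open>The map \<open>Aut\<^sub>B (A \<otimes> B) \<rightarrow> Aut\<^sub>C (A \<otimes> C)\<close> induced by \<open>i: B \<rightarrow> C\<close>: apply \<open>i\<close> to the matrix.\<close>

definition extend_map ::
  "'a set \<Rightarrow> ('b, 's) ring_scheme \<Rightarrow> ('c, 't) ring_scheme \<Rightarrow> ('b \<Rightarrow> 'c) \<Rightarrow>
   (('a \<Rightarrow> 'b) \<Rightarrow> ('a \<Rightarrow> 'b)) \<Rightarrow> (('a \<Rightarrow> 'c) \<Rightarrow> ('a \<Rightarrow> 'c))"
  where "extend_map E B C i f =
    (\<lambda>v \<in> E \<rightarrow>\<^sub>E carrier C. \<lambda>y\<in>E. \<Oplus>\<^bsub>C\<^esub>x\<in>E. v x \<otimes>\<^bsub>C\<^esub> i (mat_entry B E x y f))"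


section \<open>Polynomial functions and the Zariski topology\<close>

text \<open>The functions that are polynomials with coefficients in \<open>C\<close> in the coordinate functions
  from \<open>F\<close>.\<close>

inductive_set poly_funs :: "('c, 't) ring_scheme \<Rightarrow> 'c set \<Rightarrow> ('p \<Rightarrow> 'c) set \<Rightarrow> ('p \<Rightarrow> 'c) set"
  for K :: "('c, 't) ring_scheme" and C :: "'c set" and F :: "('p \<Rightarrow> 'c) set" where
  const: "c \<in> C \<Longrightarrow> (\<lambda>_. c) \<in> poly_funs K C F"
| coord: "f \<in> F \<Longrightarrow> f \<in> poly_funs K C F"
| add: "p \<in> poly_funs K C F \<Longrightarrow> q \<in> poly_funs K C F \<Longrightarrow> (\<lambda>s. p s \<oplus>\<^bsub>K\<^esub> q s) \<in> poly_funs K C F"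
| mult: "p \<in> poly_funs K C F \<Longrightarrow> q \<in> poly_funs K C F \<Longrightarrow> (\<lambda>s. p s \<otimes>\<^bsub>K\<^esub> q s) \<in> poly_funs K C F"

definition zariski :: "('c, 't) ring_scheme \<Rightarrow> ('p \<Rightarrow> 'c) set \<Rightarrow> 'p set \<Rightarrow> 'p topology"
  where "zariski K F S =
    topology_generated_by {{s \<in> S. p s \<noteq> \<zero>\<^bsub>K\<^esub>} | p. p \<in> poly_funs K (carrier K) F}"

definition entries :: "('c, 't) ring_scheme \<Rightarrow> 'a set \<Rightarrow> ((('a \<Rightarrow> 'c) \<Rightarrow> ('a \<Rightarrow> 'c)) \<Rightarrow> 'c) set"
  where "entries K E = {mat_entry K E x y | x y. x \<in> E \<and> y \<in> E}"

text \<open>Together with \<open>entries\<close> these generate the coordinate ring of \<open>GL (K\<^sup>E)\<close>.\<close>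

definition inv_entries :: "('c, 't) ring_scheme \<Rightarrow> 'a set \<Rightarrow> ((('a \<Rightarrow> 'c) \<Rightarrow> ('a \<Rightarrow> 'c)) \<Rightarrow> 'c) set"
  where "inv_entries K E =
    {\<lambda>f. mat_entry K E x y (inv_into (E \<rightarrow>\<^sub>E carrier K) f) | x y. x \<in> E \<and> y \<in> E}"


section \<open>The identity component of the automorphism group\<close>

text \<open>For a field \<open>L\<close>, \<open>closure_of_field L\<close> is the algebraic closure of the library and
  \<open>to_closure L\<close> the embedding of \<open>L\<close> into it.\<close>

type_synonym 'l clos = "('l list \<times> nat) multiset \<Rightarrow> 'l"

abbreviation closure_of_field :: "('l, 't) ring_scheme \<Rightarrow> 'l clos ring"
  where "closure_of_field L \<equiv> field.alg_closure L"

abbreviation to_closure :: "('l, 't) ring_scheme \<Rightarrow> 'l \<Rightarrow> 'l clos"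
  where "to_closure L \<equiv> ring.indexed_const L"

text \<open>Throughout, \<open>h: k \<rightarrow> L\<close> is a field extension and \<open>K\<close> is the algebraic closure of \<open>L\<close>.\<close>

definition geom_ext ::
  "('k, 'r) ring_scheme \<Rightarrow> ('k, 'a, 'm) module_scheme \<Rightarrow> 'a set \<Rightarrow> ('l, 't) ring_scheme \<Rightarrow> ('k \<Rightarrow> 'l) \<Rightarrow>
   ('l clos, 'a \<Rightarrow> 'l clos) module"
  where "geom_ext k A E L h = scalar_ext k A E (closure_of_field L) (to_closure L \<circ> h)"

definition geom_Aut ::
  "('k, 'r) ring_scheme \<Rightarrow> ('k, 'a, 'm) module_scheme \<Rightarrow> 'a set \<Rightarrow> ('l, 't) ring_scheme \<Rightarrow> ('k \<Rightarrow> 'l) \<Rightarrow>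
   (('a \<Rightarrow> 'l clos) \<Rightarrow> ('a \<Rightarrow> 'l clos)) set"
  where "geom_Aut k A E L h = Aut_functor k A E (closure_of_field L) (to_closure L \<circ> h)"

definition Aut_topology ::
  "('k, 'r) ring_scheme \<Rightarrow> ('k, 'a, 'm) module_scheme \<Rightarrow> 'a set \<Rightarrow> ('l, 't) ring_scheme \<Rightarrow> ('k \<Rightarrow> 'l) \<Rightarrow>
   (('a \<Rightarrow> 'l clos) \<Rightarrow> ('a \<Rightarrow> 'l clos)) topology"
  where "Aut_topology k A E L h =
    zariski (closure_of_field L) (entries (closure_of_field L) E) (geom_Aut k A E L h)"

text \<open>\<open>G\<^sub>A (K)\<close>: the connected component of the identity in \<open>Aut\<^sub>K (A \<otimes>\<^sub>k K)\<close>.\<close>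

definition geom_G ::
  "('k, 'r) ring_scheme \<Rightarrow> ('k, 'a, 'm) module_scheme \<Rightarrow> 'a set \<Rightarrow> ('l, 't) ring_scheme \<Rightarrow> ('k \<Rightarrow> 'l) \<Rightarrow>
   (('a \<Rightarrow> 'l clos) \<Rightarrow> ('a \<Rightarrow> 'l clos)) set"
  where "geom_G k A E L h =
    connected_component_of_set (Aut_topology k A E L h)
      (\<lambda>v \<in> E \<rightarrow>\<^sub>E carrier (closure_of_field L). v)"

text \<open>\<open>G\<^sub>A (L)\<close>.  The identity component is geometrically connected, so an \<open>L\<close>-point of \<open>Aut (A)\<close>
  lies in it iff the induced \<open>K\<close>-point does.\<close>

definition G_points ::
  "('k, 'r) ring_scheme \<Rightarrow> ('k, 'a, 'm) module_scheme \<Rightarrow> 'a set \<Rightarrow> ('l, 't) ring_scheme \<Rightarrow> ('k \<Rightarrow> 'l) \<Rightarrow>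
   (('a \<Rightarrow> 'l) \<Rightarrow> ('a \<Rightarrow> 'l)) set"
  where "G_points k A E L h =
    {f \<in> Aut_functor k A E L h.
       extend_map E L (closure_of_field L) (to_closure L) f \<in> geom_G k A E L h}"


section \<open>R-equivalence\<close>

text \<open>A rational map from the affine line to \<open>G\<^sub>A\<close> over \<open>L\<close> that is regular at 0 and 1 is a morphism
  \<open>D(q) \<rightarrow> G\<^sub>A\<close> for some polynomial \<open>q\<close> over \<open>L\<close> with \<open>q(0) \<noteq> 0 \<noteq> q(1)\<close>, since every open subset of
  the line is of this form.  After replacing \<open>q\<close> by a power, it is a matrix \<open>(P x y / q)\<close> with
  \<open>P x y\<close> polynomials over \<open>L\<close>; it has values in \<open>G\<^sub>A\<close> iff this holds at the geometric points of
  \<open>D(q)\<close>, because \<open>D(q)\<close> is reduced.\<close>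

definition R_link ::
  "('k, 'r) ring_scheme \<Rightarrow> ('k, 'a, 'm) module_scheme \<Rightarrow> 'a set \<Rightarrow> ('l, 't) ring_scheme \<Rightarrow> ('k \<Rightarrow> 'l) \<Rightarrow>
   (('a \<Rightarrow> 'l) \<Rightarrow> ('a \<Rightarrow> 'l)) \<Rightarrow> (('a \<Rightarrow> 'l) \<Rightarrow> ('a \<Rightarrow> 'l)) \<Rightarrow> bool"
  where "R_link k A E L h f\<^sub>0 f\<^sub>1 \<longleftrightarrow>
    f\<^sub>0 \<in> G_points k A E L h \<and> f\<^sub>1 \<in> G_points k A E L h \<and>
    (\<exists>q P.
      q \<in> carrier (poly_ring L) \<and>
      (\<forall>x\<in>E. \<forall>y\<in>E. P x y \<in> carrier (poly_ring L)) \<and>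
      ring.eval L q \<zero>\<^bsub>L\<^esub> \<noteq> \<zero>\<^bsub>L\<^esub> \<and>
      ring.eval L q \<one>\<^bsub>L\<^esub> \<noteq> \<zero>\<^bsub>L\<^esub> \<and>
      (let K = closure_of_field L;
           val = (\<lambda>p u. ring.eval K (map (to_closure L) p) u)
       in \<forall>u\<in>carrier K. val q u \<noteq> \<zero>\<^bsub>K\<^esub> \<longrightarrow>
            (\<exists>g\<in>geom_G k A E L h. \<forall>x\<in>E. \<forall>y\<in>E. mat_entry K E x y g \<otimes>\<^bsub>K\<^esub> val q u = val (P x y) u)) \<and>
      (\<forall>x\<in>E. \<forall>y\<in>E.
        mat_entry L E x y f\<^sub>0 \<otimes>\<^bsub>L\<^esub> ring.eval L q \<zero>\<^bsub>L\<^esub> = ring.eval L (P x y) \<zero>\<^bsub>L\<^esub> \<and>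
        mat_entry L E x y f\<^sub>1 \<otimes>\<^bsub>L\<^esub> ring.eval L q \<one>\<^bsub>L\<^esub> = ring.eval L (P x y) \<one>\<^bsub>L\<^esub>))"

definition R_equivalent ::
  "('k, 'r) ring_scheme \<Rightarrow> ('k, 'a, 'm) module_scheme \<Rightarrow> 'a set \<Rightarrow> ('l, 't) ring_scheme \<Rightarrow> ('k \<Rightarrow> 'l) \<Rightarrow>
   (('a \<Rightarrow> 'l) \<Rightarrow> ('a \<Rightarrow> 'l)) \<Rightarrow> (('a \<Rightarrow> 'l) \<Rightarrow> ('a \<Rightarrow> 'l)) \<Rightarrow> bool"
  where "R_equivalent k A E L h = (R_link k A E L h)\<^sup>*\<^sup>*"

text \<open>The extensions \<open>L\<close> range over all fields whose carrier lies in the type \<open>'k\<close> of \<open>k\<close>.  If \<open>'k\<close> is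
  infinite, this is no restriction: points of \<open>G\<^sub>A (L)\<close> that are not R-equivalent over \<open>L\<close> are
  defined, and still not R-equivalent, over a finitely generated subextension of \<open>L / k\<close>, and
  such an extension has an isomorphic copy in \<open>'k\<close>.\<close>

definition R_trivial :: "'k ring \<Rightarrow> ('k, 'a, 'm) module_scheme \<Rightarrow> 'a set \<Rightarrow> bool"
  where "R_trivial k A E \<longleftrightarrow>
    (\<forall>(L :: 'k ring) h. field L \<longrightarrow> h \<in> ring_hom k L \<longrightarrow>
       (\<forall>f\<in>G_points k A E L h. \<forall>g\<in>G_points k A E L h. R_equivalent k A E L h f g))"


section \<open>Tori and the rank\<close>

text \<open>\<open>(K\<^sup>*)\<^sup>r\<close> and the generators of its coordinate ring.\<close>

definition Gm_power :: "('c, 't) ring_scheme \<Rightarrow> nat \<Rightarrow> (nat \<Rightarrow> 'c) monoid"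
  where "Gm_power K r = product_group {..<r} (\<lambda>_. units_of K)"

definition Gm_coords :: "('c, 't) ring_scheme \<Rightarrow> nat \<Rightarrow> ((nat \<Rightarrow> 'c) \<Rightarrow> 'c) set"
  where "Gm_coords K r = {\<lambda>t. t l | l. l < r} \<union> {\<lambda>t. inv\<^bsub>K\<^esub> (t l) | l. l < r}"

text \<open>A set \<open>T\<close> of \<open>K\<close>-linear automorphisms of \<open>M = A \<otimes>\<^sub>k K\<close> is defined over \<open>k\<close> if the ideal of
  polynomials over \<open>K\<close> on \<open>End\<^sub>K (M)\<close> vanishing on \<open>T\<close> is spanned over \<open>K\<close> by polynomials over \<open>k\<close>.
  As \<open>K\<close> is infinite, polynomials are the same as polynomial functions on \<open>End\<^sub>K (M)\<close>.\<close>

definition defined_over_base ::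
  "('k, 'r) ring_scheme \<Rightarrow> ('k, 'a, 'm) module_scheme \<Rightarrow> 'a set \<Rightarrow>
   (('a \<Rightarrow> 'k clos) \<Rightarrow> ('a \<Rightarrow> 'k clos)) set \<Rightarrow> bool"
  where "defined_over_base k A E T \<longleftrightarrow>
    (let K = closure_of_field k; M = geom_ext k A E k (\<lambda>c. c)
     in \<forall>p\<in>poly_funs K (carrier K) (entries K E). (\<forall>f\<in>T. p f = \<zero>\<^bsub>K\<^esub>) \<longrightarrow>
          (\<exists>(m::nat) c q.
             (\<forall>l<m. c l \<in> carrier K \<and>
                q l \<in> poly_funs K (to_closure k ` carrier k) (entries K E) \<and>
                (\<forall>f\<in>T. q l f = \<zero>\<^bsub>K\<^esub>)) \<and>
             (\<forall>f\<in>module_hom K M M. p f = (\<Oplus>\<^bsub>K\<^esub>l\<in>{..<m}. c l \<otimes>\<^bsub>K\<^esub> q l f))))"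

text \<open>\<open>r\<close>-dimensional \<open>k\<close>-subtori of \<open>G\<^sub>A\<close>, given by their points over the algebraic closure \<open>K\<close>: closed
  subgroups defined over \<open>k\<close> that over \<open>K\<close> are isomorphic, as algebraic groups, to the \<open>r\<close>-th power
  of the multiplicative group.  The two last conditions say that \<open>\<phi>\<close> and its inverse are morphisms
  of varieties.\<close>

definition subtorus ::
  "('k, 'r) ring_scheme \<Rightarrow> ('k, 'a, 'm) module_scheme \<Rightarrow> 'a set \<Rightarrow> nat \<Rightarrow>
   (('a \<Rightarrow> 'k clos) \<Rightarrow> ('a \<Rightarrow> 'k clos)) set \<Rightarrow> bool"
  where "subtorus k A E r T \<longleftrightarrow>
    (let K = closure_of_field k; H = alg_aut_group K (geom_ext k A E k (\<lambda>c. c))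
     in subgroup T H \<and> T \<subseteq> geom_G k A E k (\<lambda>c. c) \<and>
        closedin (Aut_topology k A E k (\<lambda>c. c)) T \<and>
        defined_over_base k A E T \<and>
        (\<exists>\<phi> \<in> iso (Gm_power K r) (H\<lparr>carrier := T\<rparr>).
           (\<forall>x\<in>E. \<forall>y\<in>E. \<exists>p\<in>poly_funs K (carrier K) (Gm_coords K r).
              \<forall>t\<in>carrier (Gm_power K r). mat_entry K E x y (\<phi> t) = p t) \<and>
           (\<forall>l<r. \<exists>p\<in>poly_funs K (carrier K) (entries K E \<union> inv_entries K E).
              \<forall>t\<in>carrier (Gm_power K r). t l = p (\<phi> t))))"

definition maximal_torus ::
  "('k, 'r) ring_scheme \<Rightarrow> ('k, 'a, 'm) module_scheme \<Rightarrow> 'a set \<Rightarrow> nat \<Rightarrow>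
   (('a \<Rightarrow> 'k clos) \<Rightarrow> ('a \<Rightarrow> 'k clos)) set \<Rightarrow> bool"
  where "maximal_torus k A E r T \<longleftrightarrow>
    subtorus k A E r T \<and> (\<forall>r' T'. subtorus k A E r' T' \<longrightarrow> T \<subseteq> T' \<longrightarrow> T' = T)"

text \<open>All maximal tori of an algebraic group have the same dimension, so at most one \<open>r\<close> qualifies.\<close>

definition has_rank :: "('k, 'r) ring_scheme \<Rightarrow> ('k, 'a, 'm) module_scheme \<Rightarrow> 'a set \<Rightarrow> nat \<Rightarrow> bool"
  where "has_rank k A E r \<longleftrightarrow> (\<exists>T. maximal_torus k A E r T)"

end

theory Submission
  imports Defs "HOL-Computational_Algebra.Polynomial_Factorial" "HOL-Library.Function_Algebras"
begin

text \<open>Let \<open>L = \<rat>(i, \<surd>3)\<close>.  The algebra is a Galois descent of a split local algebra with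
  \<open>J\<^sup>3 = 0\<close>, whose radical is generated by four elements \<open>u\<close> permuted simply transitively by the
  Galois group, two elements \<open>y\<close>, a fixed element \<open>e\<close> and \<open>n - 3\<close> pairs of fixed elements.  Every
  generator except \<open>e\<close> has square zero, the products of distinct generators are independent apart from
  \<open>u u' = y e\<close>, \<open>y y' = e\<^sup>2 = p p'\<close>, and these relations make the diagonal automorphisms a torus of
  dimension \<open>n + 1\<close> on which the product of the four weights of the \<open>u\<close> is the fourth power of the
  weight of \<open>e\<close>.  The torus contains an element with distinct weights on the generators, so it is its
  own centralizer and hence maximal.

  An element of square zero has at most one nonzero coordinate modulo \<open>J\<^sup>2\<close>.  Hence an automorphism that
  lies on a rational curve through the torus keeps the line spanned by each \<open>u\<close>, and the coefficients
  \<open>X\<close> of \<open>u\<close> and \<open>S\<close> of \<open>e\<close> are polynomials along the curve with \<open>N(X) = S\<^sup>4 = N(S)\<close>.  Unique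
  factorization in \<open>L[t]\<close> shows that \<open>X / S\<close> changes between \<open>t = 0\<close> and \<open>t = 1\<close> only by a product of
  elements \<open>\<sigma>(v) / v\<close>.  The element \<open>\<xi> = (1 + i + \<surd>3 + i \<surd>3) / 2\<close> has norm \<open>1\<close> but is not such a
  product, because \<open>x\<^sup>2 - 2 y\<^sup>2 = 3 (z\<^sup>2 - 2 w\<^sup>2)\<close> has no nontrivial rational solution.\<close>

text \<open>Modulo the products of elements \<sigma>(v) / v, the elements of norm 1 form the Tate
  group of degree -1 of L^*. It vanishes for cyclic extensions by Hilbert 90, so a biquadratic field
  is the smallest choice. The relations are made for this group: they turn the quotient of the
  weights of u and e into an element of norm 1. The obstacle is that R-equivalence is taken in G_A,
  where a curve may leave the torus. The identity component is never computed; it is enough that it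
  contains the torus and consists of automorphisms. So the invariant has to be read off the matrix
  of an arbitrary automorphism. This is the purpose of the square-zero generators: the coordinate
  that they single out cannot jump along a curve, because L[t] is a domain. The quadratic form comes
  from the relative norm to \<rat>(i), which sends \<xi> to -i. If \<xi> were a product as above,
  some nonzero relative norm would be a rational multiple of 1 + i, and this condition is the
  equation of the form. The pairs p, p' serve the count: each adds one to the rank and two to dim J
  / J^2.\<close>

section \<open>A quaternary quadratic form without nontrivial rational zeros\<close>

text \<open>Descent at 3. As 2 is not a square modulo 3, the prime 3 divides x and y; one factor 3
  cancels, and the same argument applies to z and w. Dividing all four by 3 gives a smaller solution
  of the same equation.\<close>

lemma anisotropic_int:
  fixes x y z w :: int
  assumes "x^2 - 2*y^2 = 3*(z^2 - 2*w^2)"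
  shows "x = 0 \<and> y = 0 \<and> z = 0 \<and> w = 0"
  using assms
proof (induction "nat (abs (x)) + nat (abs (y)) + nat (abs (z)) + nat (abs (w))" arbitrary: x y z w rule: less_induct)
  case less
  have dvd3: "3 dvd a \<and> 3 dvd b" if "3 dvd a^2 - 2*b^2" for a b :: int
  proof -
    have sq: "c^2 mod 3 = 0 \<and> c mod 3 = 0 \<or> c^2 mod 3 = 1" for c :: int
    proof -
      have k: "r^2 mod 3 = 0 \<and> r = 0 \<or> r^2 mod 3 = 1" if "r = 0 \<or> r = 1 \<or> r = 2" for r :: int
        using that by auto
      have "c mod 3 = 0 \<or> c mod 3 = 1 \<or> c mod 3 = 2" by presburger
      from k[OF this] show ?thesis by (simp only: power_mod)
    qed
    \<comment> \<open>Modulo 3 the form is s + t, and squares are 0 or 1, so it vanishes only for s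
      = t = 0.\<close>
    have "s mod 3 \<noteq> 1 \<and> t mod 3 \<noteq> 1"
      if "s mod 3 = 0 \<or> s mod 3 = 1" "t mod 3 = 0 \<or> t mod 3 = 1" "3 dvd s - 2*t" for s t :: int
      using that by presburger
    from this[of "a^2" "b^2"] have "a mod 3 = 0 \<and> b mod 3 = 0" using sq[of a] sq[of b] \<open>3 dvd a^2 - 2*b^2\<close> by blast
    then show ?thesis by (simp add: dvd_eq_mod_eq_0)
  qed
  obtain x' y' where xy: "x = 3*x'" "y = 3*y'"
  proof -
    have "3 dvd x \<and> 3 dvd y" using dvd3[of x y] less.prems by simp
    then show thesis using that by (elim conjE dvdE)
  qed
  have e: "z^2 - 2*w^2 = 3*(x'^2 - 2*y'^2)"
    using less.prems by (simp add: xy power2_eq_square)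
  obtain z' w' where zw: "z = 3*z'" "w = 3*w'"
  proof -
    have "3 dvd z \<and> 3 dvd w" using dvd3[of z w] e by simp
    then show thesis using that by (elim conjE dvdE)
  qed
  have e': "x'^2 - 2*y'^2 = 3*(z'^2 - 2*w'^2)"
    using e by (simp add: zw power2_eq_square)
  show ?case
  proof (cases "x' = 0 \<and> y' = 0 \<and> z' = 0 \<and> w' = 0")
    case True
    then show ?thesis by (simp add: xy zw)
  next
    case False
    then have "nat (abs (x')) + nat (abs (y')) + nat (abs (z')) + nat (abs (w')) < nat (abs (x)) + nat (abs (y)) + nat (abs (z)) + nat (abs (w))"
    proof -
      have le: "nat (abs (t)) \<le> nat (abs (3 * t))" for t :: int by simp
      have lt: "nat (abs (t)) < nat (abs (3 * t))" if "t \<noteq> 0" for t :: int using that by simp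
      have gen: "a' + b' + c' + d' < a + b + c + d"
        if "a' \<le> a" "b' \<le> b" "c' \<le> c" "d' \<le> d" "a' < a \<or> b' < b \<or> c' < c \<or> d' < d"
        for a b c d a' b' c' d' :: nat using that by linarith
      show ?thesis unfolding xy zw
        by (rule gen; (rule le)?) (use False lt in blast)
    qed
    from less.hyps[OF this e'] False show ?thesis by simp
  qed
qed

text \<open>It is applied to relative norms from L to \<rat>(i), once for the existence of inverses
  in \<open>quad\<close> and once to keep \<open>xi\<close> out of \<open>cob\<close>.\<close>

lemma anisotropic_rat:
  fixes x y z w :: rat
  assumes "x^2 - 2*y^2 = 3*(z^2 - 2*w^2)"
  shows "x = 0 \<and> y = 0 \<and> z = 0 \<and> w = 0"
proof -
  have common: "\<exists>a b::int. b \<noteq> 0 \<and> q = of_int a / of_int b" for q :: rat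
    by (cases q) (metis Fract_of_int_quotient less_irrefl)
  obtain a b c d e f g h :: int where
    nz: "b \<noteq> 0" "d \<noteq> 0" "f \<noteq> 0" "h \<noteq> 0" and
    q: "x = of_int a / of_int b" "y = of_int c / of_int d" "z = of_int e / of_int f" "w = of_int g / of_int h"
    using common[of x] common[of y] common[of z] common[of w] by blast
  let ?D = "of_int (b*d*f*h) :: rat"
  have X: "x * ?D = of_int (a*d*f*h)" "y * ?D = of_int (c*b*f*h)" "z * ?D = of_int (e*b*d*h)" "w * ?D = of_int (g*b*d*f)"
    using nz by (simp_all add: q)
  have "(x * ?D)^2 - 2*(y * ?D)^2 = 3*((z * ?D)^2 - 2*(w * ?D)^2)"
    using arg_cong[OF assms, of "\<lambda>t. t * ?D^2"] by (simp add: power_mult_distrib algebra_simps)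
  then have "of_int ((a*d*f*h)^2 - 2*(c*b*f*h)^2) = (of_int (3*((e*b*d*h)^2 - 2*(g*b*d*f)^2)) :: rat)"
    unfolding X by simp
  then have "(a*d*f*h)^2 - 2*(c*b*f*h)^2 = 3*((e*b*d*h)^2 - 2*(g*b*d*f)^2)"
    by (simp only: of_int_eq_iff)
  from anisotropic_int[OF this] show ?thesis using nz by (simp add: q)
qed

section \<open>The field L = \<rat>(i, \<surd>3) and its Galois group\<close>

datatype quad = Quad (q0: rat) (q1: rat) (q2: rat) (q3: rat)

text \<open>\<open>Quad a b c d\<close> is \<open>a + b i + c s + d i s\<close> with \<open>i\<^sup>2 = -1\<close> and \<open>s\<^sup>2 = 3\<close>.\<close>

instantiation quad :: comm_ring_1
begin
definition zero_quad where "0 = Quad 0 0 0 0"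
definition one_quad where "1 = Quad 1 0 0 0"
definition plus_quad where "x + y = Quad (q0 x + q0 y) (q1 x + q1 y) (q2 x + q2 y) (q3 x + q3 y)"
definition uminus_quad where "- x = Quad (- q0 x) (- q1 x) (- q2 x) (- q3 x)"
definition minus_quad where "x - y = Quad (q0 x - q0 y) (q1 x - q1 y) (q2 x - q2 y) (q3 x - q3 y)"
definition times_quad where "x * y = Quad
  (q0 x * q0 y - q1 x * q1 y + 3 * q2 x * q2 y - 3 * q3 x * q3 y)
  (q0 x * q1 y + q1 x * q0 y + 3 * q2 x * q3 y + 3 * q3 x * q2 y)
  (q0 x * q2 y + q2 x * q0 y - q1 x * q3 y - q3 x * q1 y)
  (q0 x * q3 y + q3 x * q0 y + q1 x * q2 y + q2 x * q1 y)"
instance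
  by standard
    (simp_all add: zero_quad_def one_quad_def plus_quad_def uminus_quad_def minus_quad_def times_quad_def
      quad.expand algebra_simps)
end

lemma quad_sel [simp]:
  "q0 0 = 0" "q1 0 = 0" "q2 0 = 0" "q3 0 = 0" "q0 1 = 1" "q1 1 = 0" "q2 1 = 0" "q3 1 = 0"
  "q0 (x + y) = q0 x + q0 y" "q1 (x + y) = q1 x + q1 y" "q2 (x + y) = q2 x + q2 y" "q3 (x + y) = q3 x + q3 y"
  "q0 (- x) = - q0 x" "q1 (- x) = - q1 x" "q2 (- x) = - q2 x" "q3 (- x) = - q3 x"
  "q0 (x - y) = q0 x - q0 y" "q1 (x - y) = q1 x - q1 y" "q2 (x - y) = q2 x - q2 y" "q3 (x - y) = q3 x - q3 y"
  "q0 (x * y) = q0 x * q0 y - q1 x * q1 y + 3 * q2 x * q2 y - 3 * q3 x * q3 y"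
  "q1 (x * y) = q0 x * q1 y + q1 x * q0 y + 3 * q2 x * q3 y + 3 * q3 x * q2 y"
  "q2 (x * y) = q0 x * q2 y + q2 x * q0 y - q1 x * q3 y - q3 x * q1 y"
  "q3 (x * y) = q0 x * q3 y + q3 x * q0 y + q1 x * q2 y + q2 x * q1 y"
  by (simp_all add: zero_quad_def one_quad_def plus_quad_def uminus_quad_def minus_quad_def times_quad_def)

lemma quad_eqI: "q0 x = q0 y \<Longrightarrow> q1 x = q1 y \<Longrightarrow> q2 x = q2 y \<Longrightarrow> q3 x = q3 y \<Longrightarrow> x = y"
  by (simp add: quad.expand)

type_synonym gal = "bool \<times> bool"

definition cj :: "gal \<Rightarrow> quad \<Rightarrow> quad" where
  "cj g x = Quad (q0 x) (if fst g then - q1 x else q1 x) (if snd g then - q2 x else q2 x)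
     (if fst g = snd g then q3 x else - q3 x)"

lemma cj_sel [simp]: "q0 (cj g x) = q0 x" "q1 (cj g x) = (if fst g then - q1 x else q1 x)"
  "q2 (cj g x) = (if snd g then - q2 x else q2 x)" "q3 (cj g x) = (if fst g = snd g then q3 x else - q3 x)"
  by (simp_all add: cj_def)

definition gmul :: "gal \<Rightarrow> gal \<Rightarrow> gal" where "gmul g h = (fst g \<noteq> fst h, snd g \<noteq> snd h)"

lemma cj_hom [simp]: "cj g 0 = 0" "cj g 1 = 1" "cj g (x + y) = cj g x + cj g y" "cj g (- x) = - cj g x"
  "cj g (x - y) = cj g x - cj g y" "cj g (x * y) = cj g x * cj g y"
  by (auto intro!: quad_eqI simp: algebra_simps)

lemma cj_cj: "cj g (cj h x) = cj (gmul g h) x"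
  by (auto intro!: quad_eqI simp: gmul_def)

lemma cj_invol [simp]: "cj g (cj g x) = x"
  by (auto intro!: quad_eqI)

lemma cj_id [simp]: "cj (False, False) x = x"
  by (auto intro!: quad_eqI)

lemma cj_sum: "cj g (sum f A) = (\<Sum>x\<in>A. cj g (f x))"
  by (induction A rule: infinite_finite_induct) auto

lemma cj_inj: "cj g x = cj g y \<longleftrightarrow> x = y"
  by (metis cj_invol)

text \<open>With y the relative norm of x to \<rat>(i), the inverse of x is its conjugate over
  \<rat>(i) times the inverse of y; the latter is the complex conjugate of y divided by the norm m
  of y.\<close>

instantiation quad :: field
begin
definition inverse_quad where "inverse (x::quad) =
  (let y = x * cj (False, True) x; m = q0 y ^ 2 + q1 y ^ 2
   in cj (False, True) x * Quad (q0 y / m) (- q1 y / m) 0 0)"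
definition divide_quad where "x div y = x * inverse (y::quad)"
instance
proof
  fix x :: quad
  assume x: "x \<noteq> 0"
  let ?y = "x * cj (False, True) x" let ?m = "q0 ?y ^ 2 + q1 ?y ^ 2"
  have y23: "q2 ?y = 0" "q3 ?y = 0" by simp_all
  have "?m \<noteq> 0"
  proof
    assume "?m = 0"
    then have "q0 ?y = 0" "q1 ?y = 0"
      by (simp_all only: sum_power2_eq_zero_iff)
    \<comment> \<open>A relative norm with equal coordinates is a zero of the anisotropic form; the
      variables q0 - q1, q1, q2 - q3, q3 complete the squares.\<close>
    then have "q0 ?y = q1 ?y" by argo
    then have "(q0 x - q1 x)^2 - 2 * (q1 x)^2 = 3 * ((q2 x - q3 x)^2 - 2 * (q3 x)^2)"
      by (simp add: power2_eq_square algebra_simps)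
    from anisotropic_rat[OF this] have "q0 x = 0 \<and> q1 x = 0 \<and> q2 x = 0 \<and> q3 x = 0" by auto
    with x show False by (auto intro: quad_eqI)
  qed
  moreover have "Quad p q 0 0 * Quad (p / (p^2 + q^2)) (- q / (p^2 + q^2)) 0 0 = 1"
    if "p^2 + q^2 \<noteq> 0" for p q
    using that by (intro quad_eqI) (simp_all add: power2_eq_square flip: add_divide_distrib)
  moreover have "?y = Quad (q0 ?y) (q1 ?y) 0 0" by (intro quad_eqI) simp_all
  ultimately have "?y * Quad (q0 ?y / ?m) (- q1 ?y / ?m) 0 0 = 1" by metis
  then have "x * (cj (False, True) x * Quad (q0 ?y / ?m) (- q1 ?y / ?m) 0 0) = 1"
    by (simp only: mult.assoc)
  then show "inverse x * x = 1"
    by (simp only: inverse_quad_def Let_def mult.commute[of _ x])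
next
  show "inverse (0::quad) = 0" by (simp add: inverse_quad_def)
qed (simp add: divide_quad_def)
end

lemma of_nat_quad: "of_nat m = Quad (of_nat m) 0 0 0"
  by (induction m) (auto intro!: quad_eqI)

instance quad :: field_char_0
  by standard (auto simp: inj_on_def of_nat_quad)

lemma of_int_quad: "of_int m = Quad (of_int m) 0 0 0"
  by (cases m) (auto intro!: quad_eqI simp: of_nat_quad)

lemma of_rat_quad: "of_rat r = Quad r 0 0 0"
proof (cases r)
  case (Fract a b)
  have "Quad r 0 0 0 * of_int b = of_int a"
    using Fract by (intro quad_eqI) (auto simp: of_int_quad Fract_of_int_quotient)
  then show ?thesis using Fract by (simp add: of_rat_rat divide_eq_eq)
qed

lemma cj_of_rat [simp]: "cj g (of_rat r) = of_rat r"
  by (auto intro!: quad_eqI simp: of_rat_quad)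

lemma cj_inverse [simp]: "cj g (inverse x) = inverse (cj g x)"
proof (cases "x = 0")
  case False
  then have "cj g x * cj g (inverse x) = 1" by (metis cj_hom(2,6) right_inverse)
  then show ?thesis by (simp add: inverse_unique)
qed simp

lemma cj_divide [simp]: "cj g (x / y) = cj g x / cj g y"
  by (simp add: divide_inverse)

lemma cj_eq_0_iff [simp]: "cj g x = 0 \<longleftrightarrow> x = 0"
  using cj_inj[of g x 0] by simp

lemma cj_prod: "cj g (prod f A) = (\<Prod>x\<in>A. cj g (f x))"
  by (induction A rule: infinite_finite_induct) auto

lemma cj_fixed_iff: "(\<forall>g. cj g x = x) \<longleftrightarrow> (\<exists>r. x = of_rat r)"
proof
  assume a: "\<forall>g. cj g x = x"
  have "q1 x = 0 \<and> q2 x = 0 \<and> q3 x = 0"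
    using arg_cong[OF a[rule_format, of "(True,True)"], of q1] arg_cong[OF a[rule_format, of "(True,True)"], of q2]
      arg_cong[OF a[rule_format, of "(True,False)"], of q3] by simp
  then have "x = of_rat (q0 x)" by (auto intro!: quad_eqI simp: of_rat_quad)
  then show "\<exists>r. x = of_rat r" ..
qed auto

text \<open>The homomorphism from L to a field of characteristic 0 that is given by a square root I
  of -1 and a square root S of 3. It is used for the complex numbers and for the algebraic closure
  of \<rat>.\<close>

definition iota :: "'f::field_char_0 \<Rightarrow> 'f \<Rightarrow> quad \<Rightarrow> 'f" where
  "iota I S x = of_rat (q0 x) + of_rat (q1 x) * I + of_rat (q2 x) * S + of_rat (q3 x) * (I * S)"

lemma iota_hom:
  assumes "I * I = - 1" "S * S = 3"
  shows "iota I S 0 = 0" "iota I S 1 = 1" "iota I S (x + y) = iota I S x + iota I S y"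
    "iota I S (x * y) = iota I S x * iota I S y" "iota I S (of_rat r) = of_rat r"
proof -
  have "iota I S x * iota I S y =
     of_rat (q0 x * q0 y) + of_rat (q1 x * q1 y) * (I*I) + of_rat (q2 x * q2 y) * (S*S)
     + of_rat (q3 x * q3 y) * ((I*I)*(S*S))
     + of_rat (q0 x * q1 y + q1 x * q0 y) * I + of_rat (q2 x * q3 y + q3 x * q2 y) * I * (S*S)
     + of_rat (q0 x * q2 y + q2 x * q0 y) * S + of_rat (q1 x * q3 y + q3 x * q1 y) * (I*I) * S
     + of_rat (q0 x * q3 y + q3 x * q0 y + q1 x * q2 y + q2 x * q1 y) * (I*S)"
    by (simp add: iota_def of_rat_add of_rat_mult algebra_simps)
  also have "\<dots> = iota I S (x * y)"
    unfolding assms by (simp add: iota_def of_rat_add of_rat_mult of_rat_diff algebra_simps)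
  finally show "iota I S (x * y) = iota I S x * iota I S y" ..
qed (simp_all add: iota_def of_rat_quad of_rat_add algebra_simps)

lemma iota_inj:
  assumes "I * I = - 1" "S * S = 3"
  shows "inj (iota I S)"
proof (rule injI, rule ccontr)
  fix x y assume e: "iota I S x = iota I S y" and "x \<noteq> y"
  note hom = iota_hom[OF assms]
  have "iota I S (x - y) + iota I S y = iota I S x" by (simp flip: hom(3))
  with e have "iota I S (x - y) = 0" by simp
  then have "iota I S ((x - y) * inverse (x - y)) = 0" by (simp only: hom mult_zero_left)
  with \<open>x \<noteq> y\<close> show False by (simp add: hom)
qed

section \<open>Norms of polynomials\<close>

text \<open>The subgroup of L^* generated by all quotients \<sigma>(v) / v. Two generators of the
  Galois group are enough for this, as \<open>cob_quot\<close> shows; the norm-one elements modulo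
  \<open>cob\<close> are the Tate group of degree -1.\<close>

definition cob :: "quad set" where
  "cob = {cj (True, False) u / u * (cj (False, True) v / v) | u v. u \<noteq> 0 \<and> v \<noteq> 0}"

lemma cob_one: "1 \<in> cob"
  unfolding cob_def by (rule CollectI, rule exI[of _ 1], rule exI[of _ 1]) simp

lemma cob_mult: assumes "x \<in> cob" "y \<in> cob" shows "x * y \<in> cob"
proof -
  obtain u v u' v' where "u \<noteq> 0" "v \<noteq> 0" "u' \<noteq> 0" "v' \<noteq> 0"
    "x = cj (True, False) u / u * (cj (False, True) v / v)" "y = cj (True, False) u' / u' * (cj (False, True) v' / v')"
    using assms unfolding cob_def by blast
  then show ?thesis unfolding cob_def
    by (intro CollectI, rule_tac x = "u * u'" in exI, rule_tac x = "v * v'" in exI) (simp add: ac_simps)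
qed

text \<open>For the product of the two generating conjugations, w / cj g w telescopes through the
  conjugate of w under the first one.\<close>

lemma cob_quot: assumes "w \<noteq> 0" shows "w / cj g w \<in> cob"
proof -
  obtain s t where g: "g = (s, t)" by force
  consider "g = (False, False)" | "g = (True, False)" | "g = (False, True)" | "g = (True, True)"
    using g by (cases s; cases t) auto
  then show ?thesis
  proof cases
    case 1
    then show ?thesis using assms cob_one by simp
  next
    case 2
    then show ?thesis unfolding cob_def using assms
      by (intro CollectI, rule_tac x = "inverse w" in exI, rule_tac x = 1 in exI) (simp add: field_simps)
  next
    case 3
    then show ?thesis unfolding cob_def using assms
      by (intro CollectI, rule_tac x = 1 in exI, rule_tac x = "inverse w" in exI) (simp add: field_simps)
  next
    case 4
    then show ?thesis unfolding cob_def using assms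
      by (intro CollectI, rule_tac x = "inverse w" in exI, rule_tac x = "inverse (cj (True, False) w)" in exI)
        (simp add: field_simps cj_cj gmul_def)
  qed
qed

definition cjp :: "gal \<Rightarrow> quad poly \<Rightarrow> quad poly" where "cjp g = map_poly (cj g)"

lemma poly_cjp: "poly (cjp g p) (cj g x) = cj g (poly p x)"
  by (induction p) (auto simp: cjp_def map_poly_pCons)

text \<open>Rational arguments are infinitely many, and conjugation fixes them: at a rational number
  the value of \<open>cjp g p\<close> is the conjugate of the value of p. So identities between
  conjugated polynomials reduce to identities between values.\<close>

lemma poly_eqI_rat:
  fixes p q :: "'a::field_char_0 poly"
  assumes "\<And>r. poly p (of_rat r) = poly q (of_rat r)"
  shows "p = q"
proof (rule ccontr)
  assume "p \<noteq> q"
  then have "finite {x. poly (p - q) x = 0}" by (intro poly_roots_finite) simp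
  moreover have "range of_rat \<subseteq> {x. poly (p - q) x = 0}" using assms by auto
  ultimately have "finite (range (of_rat :: rat \<Rightarrow> 'a))" by (rule rev_finite_subset)
  then show False by (simp add: finite_image_iff inj_on_def infinite_UNIV_char_0)
qed

lemma poly_cjp_rat: "poly (cjp g p) (of_rat r) = cj g (poly p (of_rat r))"
  using poly_cjp[of g p "of_rat r"] by simp

lemma cjp_mult: "cjp g (p * q) = cjp g p * cjp g q"
  by (rule poly_eqI_rat) (simp add: poly_cjp_rat)

lemma cjp_cjp: "cjp g (cjp h p) = cjp (gmul g h) p"
  by (rule poly_eqI_rat) (simp add: poly_cjp_rat cj_cj)

lemma cjp_invol [simp]: "cjp g (cjp g p) = p"
  by (rule poly_eqI_rat) (simp add: poly_cjp_rat)

lemma cjp_id [simp]: "cjp (False, False) p = p"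
  by (rule poly_eqI_rat) (simp add: poly_cjp_rat)

lemma degree_cjp [simp]: "degree (cjp g p) = degree p"
  unfolding cjp_def by (cases "p = 0") (auto intro!: map_poly_degree_eq)

lemma cjp_eq_0_iff [simp]: "cjp g p = 0 \<longleftrightarrow> p = 0"
  by (metis cjp_invol cjp_def map_poly_0)

definition polynorm :: "quad poly \<Rightarrow> quad poly" where
  "polynorm p = p * cjp (True, False) p * (cjp (False, True) p * cjp (True, True) p)"

lemma polynorm_mult: "polynorm (p * q) = polynorm p * polynorm q"
  by (simp add: polynorm_def cjp_mult ac_simps)

lemma polynorm_cjp: "polynorm (cjp g p) = polynorm p"
proof -
  obtain s t where "g = (s, t)" by force
  then show ?thesis
    by (cases s; cases t) (simp_all add: polynorm_def cjp_cjp gmul_def ac_simps)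
qed

lemma polynorm_eq_0_iff [simp]: "polynorm p = 0 \<longleftrightarrow> p = 0"
  by (simp add: polynorm_def)

lemma degree_polynorm: "p \<noteq> 0 \<Longrightarrow> degree (polynorm p) = 4 * degree p"
  by (simp add: polynorm_def degree_mult_eq)

lemma exists_prime_factor:
  fixes p :: "'a::field poly"
  assumes "degree p > 0"
  shows "\<exists>q. prime_elem q \<and> q dvd p"
  using assms
proof (induction "degree p" arbitrary: p rule: less_induct)
  case less
  show ?case
  proof (cases "Factorial_Ring.irreducible p")
    case True
    then have "prime_elem p" by (rule field_poly_irreducible_imp_prime)
    then show ?thesis by (intro exI[of _ p]) simp
  next
    case False
    have p: "p \<noteq> 0" using less.prems by auto
    then have "\<not> is_unit p" using less.prems by (simp add: is_unit_iff_degree)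
    then obtain a b where ab: "p = a * b" "\<not> is_unit a" "\<not> is_unit b"
      using False p unfolding Factorial_Ring.irreducible_def by blast
    then have nz: "a \<noteq> 0" "b \<noteq> 0" using p by auto
    then have pos: "degree a > 0" "degree b > 0" using ab(2,3) by (simp_all add: is_unit_iff_degree)
    then have "degree a < degree p" using nz by (simp add: ab(1) degree_mult_eq)
    from less.hyps[OF this pos(1)] obtain q where "prime_elem q" "q dvd a" by blast
    then show ?thesis unfolding ab(1) by (intro exI[of _ q]) simp
  qed
qed

text \<open>A polynomial is determined by its norm up to replacing prime factors by conjugates, and this
  changes \<open>p(1) / p(0)\<close> by an element of \<open>cob\<close>.\<close>

lemma ratio_in_cob:
  assumes "polynorm F = polynorm H"
    and "poly F 0 \<noteq> 0" "poly F 1 \<noteq> 0" "poly H 0 \<noteq> 0" "poly H 1 \<noteq> 0"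
  shows "(poly F 1 / poly F 0) / (poly H 1 / poly H 0) \<in> cob"
  using assms
proof (induction "degree F" arbitrary: F H rule: less_induct)
  case less
  have nz: "F \<noteq> 0" "H \<noteq> 0" using less.prems by auto
  have deg: "degree F = degree H"
    using degree_polynorm[OF nz(1)] degree_polynorm[OF nz(2)] less.prems(1) by simp
  show ?case
  proof (cases "degree F = 0")
    case True
    with deg obtain a b where "F = [:a:]" "H = [:b:]" by (metis degree_eq_zeroE)
    with less.prems show ?thesis by (simp add: cob_one)
  next
    case False
    then obtain p where p: "prime_elem p" "p dvd F" using exists_prime_factor by blast
    \<comment> \<open>By the equality of norms the prime p divides some conjugate of H; conjugated
      back, a conjugate of p divides H. Cancelling both leaves polynomials of equal norm and smaller
      degree.\<close>
    then have "p dvd polynorm H" by (metis dvd_mult2 less.prems(1) polynorm_def)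
    then have "p dvd H \<or> p dvd cjp (True, False) H \<or> p dvd cjp (False, True) H \<or> p dvd cjp (True, True) H"
      unfolding polynorm_def prime_elem_dvd_mult_iff[OF p(1)] by blast
    then have "p dvd cjp (False, False) H \<or> p dvd cjp (True, False) H \<or> p dvd cjp (False, True) H \<or> p dvd cjp (True, True) H"
      by simp
    then obtain g where "p dvd cjp g H" by blast
    then obtain Z where "cjp g H = p * Z" by blast
    then have H: "H = cjp g p * cjp g Z" by (metis cjp_invol cjp_mult)
    obtain F' where F: "F = p * F'" using p(2) by blast
    let ?H' = "cjp g Z"
    have pnz: "p \<noteq> 0" using p(1) by auto
    have "\<not> is_unit p" using p(1) by (simp add: prime_elem_def)
    then have "degree p > 0" using pnz by (auto simp: is_unit_iff_degree)
    then have dl: "degree F' < degree F" using nz F by (simp add: degree_mult_eq)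
    have "polynorm p * polynorm F' = polynorm p * polynorm ?H'"
      using less.prems(1) unfolding F H by (simp only: polynorm_mult polynorm_cjp)
    then have n: "polynorm F' = polynorm ?H'" using pnz by simp
    \<comment> \<open>The end points 0 and 1 are rational, so conjugation passes to the values
      there.\<close>
    have v: "poly (cjp g p) 0 = cj g (poly p 0)" "poly (cjp g p) 1 = cj g (poly p 1)"
      using poly_cjp_rat[of g p 0] poly_cjp_rat[of g p 1] by simp_all
    have nzs: "poly F' 0 \<noteq> 0" "poly F' 1 \<noteq> 0" "poly ?H' 0 \<noteq> 0" "poly ?H' 1 \<noteq> 0" "poly p 0 \<noteq> 0" "poly p 1 \<noteq> 0"
      using less.prems unfolding F H by auto
    let ?w = "poly p 1 / poly p 0"
    have "(poly F' 1 / poly F' 0) / (poly ?H' 1 / poly ?H' 0) * (?w / cj g ?w) \<in> cob"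
      using nzs by (intro cob_mult cob_quot less.hyps[OF dl n]) auto
    also have "(poly F' 1 / poly F' 0) / (poly ?H' 1 / poly ?H' 0) * (?w / cj g ?w) =
      (poly F 1 / poly F 0) / (poly H 1 / poly H 0)"
      unfolding F H by (simp add: v ac_simps)
    finally show ?thesis .
  qed
qed

section \<open>An element of norm 1 with nontrivial class\<close>

text \<open>This is (1 + i) (1 + s) / 2. Its relative norm to \<rat>(i) is 2i (1 - 3) / 4 = -i,
  which has norm 1.\<close>

definition xi :: quad where "xi = Quad (1/2) (1/2) (1/2) (1/2)"

lemma xi_norm: "xi * cj (False, True) xi = Quad 0 (-1) 0 0"
  by (intro quad_eqI) (simp_all add: xi_def)

lemma xi_notin_cob: "xi \<notin> cob"
proof
  assume "xi \<in> cob"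
  then obtain u v where uv: "u \<noteq> 0" "v \<noteq> 0" "xi = cj (True, False) u / u * (cj (False, True) v / v)"
    unfolding cob_def by blast
  let ?y = "u * cj (False, True) u"
  \<comment> \<open>The relative norm to \<rat>(i) turns the factor of v into 1. What remains is -i
    = cj y / y for the relative norm y of u, and this forces y to have equal coordinates.\<close>
  have "Quad 0 (-1) 0 0 * ?y = cj (True, False) ?y"
    using uv(1,2) by (simp add: uv(3) cj_cj gmul_def field_simps flip: xi_norm)
  then have "q0 (Quad 0 (-1) 0 0 * ?y) = q0 (cj (True, False) ?y)" by simp
  then have "q0 ?y = q1 ?y" by simp
  then have "(q0 u - q1 u)^2 - 2 * (q1 u)^2 = 3 * ((q2 u - q3 u)^2 - 2 * (q3 u)^2)"
    by (simp add: power2_eq_square algebra_simps)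
  from anisotropic_rat[OF this] have "q0 u = 0 \<and> q1 u = 0 \<and> q2 u = 0 \<and> q3 u = 0" by auto
  with uv show False by (auto intro: quad_eqI)
qed

section \<open>The combinatorial algebra\<close>

datatype gen = GU bool bool | GY bool | GE | GP bool nat

datatype idx = One | Gen gen | Prd "gen set"

text \<open>\<open>GU\<close>, \<open>GY\<close>, \<open>GE\<close>, \<open>GP\<close> are the generators \<open>u\<close>, \<open>y\<close>, \<open>e\<close>, \<open>p\<close>; their boolean arguments are the
  components of the Galois group that act on them.  \<open>Prd (pc a b)\<close> is the product of the generators \<open>a\<close> and \<open>b\<close>; the code \<open>{}\<close> stands for the
  product \<open>0\<close>.\<close>

fun pc :: "gen \<Rightarrow> gen \<Rightarrow> gen set" where
  "pc (GU a b) (GU c d) = (if a = c then (if b = d then {} else {GY a, GE}) else {GU a b, GU c d})"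
| "pc (GY a) (GY c) = (if a = c then {} else {GE})"
| "pc GE GE = {GE}"
| "pc (GP a i) (GP c j) = (if i = j then (if a = c then {} else {GE}) else {GP a i, GP c j})"
| "pc x y = {x, y}"

definition gens :: "nat \<Rightarrow> gen set" where
  "gens n = {a. case a of GP b i \<Rightarrow> i < n - 3 | _ \<Rightarrow> True}"

definition idxs :: "nat \<Rightarrow> idx set" where
  "idxs n = {One} \<union> Gen ` gens n \<union> {Prd (pc a b) | a b. a \<in> gens n \<and> b \<in> gens n \<and> pc a b \<noteq> {}}"

text \<open>Pairs are ordered, so in a square every product of two distinct generators is counted
  twice.\<close>

definition prs :: "nat \<Rightarrow> gen set \<Rightarrow> (gen \<times> gen) set" where
  "prs n S = {(a, b). a \<in> gens n \<and> b \<in> gens n \<and> pc a b = S \<and> S \<noteq> {}}"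

text \<open>\<open>One\<close>, \<open>Gen\<close> and \<open>Prd\<close> span the degrees 0, 1 and
  2 of a graded algebra in which everything of degree 3 is zero.\<close>

definition mul :: "nat \<Rightarrow> (idx \<Rightarrow> 'f::comm_ring_1) \<Rightarrow> (idx \<Rightarrow> 'f) \<Rightarrow> idx \<Rightarrow> 'f" where
  "mul n u v d = (case d of One \<Rightarrow> u One * v One
     | Gen a \<Rightarrow> u One * v (Gen a) + u (Gen a) * v One
     | Prd S \<Rightarrow> u One * v (Prd S) + u (Prd S) * v One + (\<Sum>(a, b)\<in>prs n S. u (Gen a) * v (Gen b)))"

definition supp :: "nat \<Rightarrow> (idx \<Rightarrow> 'f::zero) \<Rightarrow> bool" where
  "supp n u \<longleftrightarrow> (\<forall>d. d \<notin> idxs n \<longrightarrow> u d = 0)"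

definition dl :: "idx \<Rightarrow> idx \<Rightarrow> 'f::zero_neq_one" where
  "dl a = (\<lambda>d. if d = a then 1 else 0)"

lemma mul_simps [simp]:
  "mul n u v One = u One * v One"
  "mul n u v (Gen a) = u One * v (Gen a) + u (Gen a) * v One"
  by (simp_all add: mul_def)

lemma mul_Prd: "mul n u v (Prd S) =
    u One * v (Prd S) + u (Prd S) * v One + (\<Sum>(a, b)\<in>prs n S. u (Gen a) * v (Gen b))"
  by (simp add: mul_def)

lemma pc_comm: "pc a b = pc b a"
  by (cases a; cases b) auto

lemma gens_simps [simp]: "GU a b \<in> gens n" "GY a \<in> gens n" "GE \<in> gens n" "GP a i \<in> gens n \<longleftrightarrow> i < n - 3"
  by (auto simp: gens_def)

lemma gens_eq: "gens n = (\<lambda>(a, b). GU a b) ` UNIV \<union> GY ` UNIV \<union> {GE} \<union> (\<lambda>(a, i). GP a i) ` (UNIV \<times> {..<n - 3})"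
proof (rule Set.set_eqI)
  fix x show "x \<in> gens n \<longleftrightarrow> x \<in> (\<lambda>(a, b). GU a b) ` UNIV \<union> GY ` UNIV \<union> {GE} \<union> (\<lambda>(a, i). GP a i) ` (UNIV \<times> {..<n - 3})"
    by (cases x) (auto simp: image_iff)
qed

lemma finite_gens [simp]: "finite (gens n)"
  by (simp add: gens_eq)

lemma card_gens: assumes "n \<ge> 3" shows "card (gens n) = 2 * n + 1"
proof -
  let ?A = "(\<lambda>(a, b). GU a b) ` UNIV" and ?B = "GY ` UNIV" and ?C = "(\<lambda>(a, i). GP a i) ` (UNIV \<times> {..<n - 3})"
  have "card ?A = 4" by (subst card_image) (auto simp: inj_on_def card_UNIV_bool card_cartesian_product simp flip: UNIV_Times_UNIV)
  moreover have "card ?B = 2" by (subst card_image) (auto simp: inj_on_def card_UNIV_bool)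
  moreover have "card ?C = 2 * (n - 3)" by (subst card_image) (auto simp: inj_on_def card_UNIV_bool card_cartesian_product)
  moreover have "card (gens n) = card ?A + card ?B + 1 + card ?C"
  proof -
    have "card (?A \<union> ?B) = card ?A + card ?B" by (rule card_Un_disjoint) auto
    moreover have "card (?A \<union> ?B \<union> {GE}) = card (?A \<union> ?B) + card {GE}" by (rule card_Un_disjoint) auto
    moreover have "card (?A \<union> ?B \<union> {GE} \<union> ?C) = card (?A \<union> ?B \<union> {GE}) + card ?C" by (rule card_Un_disjoint) auto
    ultimately show ?thesis unfolding gens_eq by simp
  qed
  ultimately show ?thesis using assms by simp
qed

lemma finite_prs [simp]: "finite (prs n S)"
  by (rule finite_subset[of _ "gens n \<times> gens n"]) (auto simp: prs_def)

lemma finite_idxs [simp]: "finite (idxs n)"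
proof -
  have "{Prd (pc a b) | a b. a \<in> gens n \<and> b \<in> gens n \<and> pc a b \<noteq> {}} \<subseteq> (\<lambda>(a, b). Prd (pc a b)) ` (gens n \<times> gens n)"
    by auto
  then have "finite {Prd (pc a b) | a b. a \<in> gens n \<and> b \<in> gens n \<and> pc a b \<noteq> {}}"
    by (rule finite_subset) simp
  then show ?thesis unfolding idxs_def by simp
qed

lemma idxs_simps [simp]: "One \<in> idxs n" "Gen a \<in> idxs n \<longleftrightarrow> a \<in> gens n"
  by (auto simp: idxs_def)

lemma Prd_idxs_iff: "Prd S \<in> idxs n \<longleftrightarrow> prs n S \<noteq> {}"
  by (auto simp: idxs_def prs_def)

lemma Prd_in_idxs: "a \<in> gens n \<Longrightarrow> b \<in> gens n \<Longrightarrow> pc a b \<noteq> {} \<Longrightarrow> Prd (pc a b) \<in> idxs n"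
  by (auto simp: idxs_def)

lemma idxs_cases:
  assumes "d \<in> idxs n"
  obtains "d = One" | a where "a \<in> gens n" "d = Gen a"
    | a b where "a \<in> gens n" "b \<in> gens n" "pc a b \<noteq> {}" "d = Prd (pc a b)"
  using assms by (auto simp: idxs_def)

lemma supp_mul: assumes "supp n u" "supp n v" shows "supp n (mul n u v)"
  unfolding supp_def
proof (intro allI impI)
  fix d assume d: "d \<notin> idxs n"
  then have z: "u d = 0" "v d = 0" using assms by (auto simp: supp_def)
  show "mul n u v d = 0"
  proof (cases d)
    case (Prd S)
    then have "prs n S = {}" using d by (auto simp: Prd_idxs_iff)
    then show ?thesis using z by (simp add: Prd mul_Prd)
  qed (use z d in auto)
qed

lemma mul_comm: "mul n u v = mul n v u"
proof
  fix d show "mul n u v d = mul n v u d"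
  proof (cases d)
    case (Prd S)
    have "(\<Sum>(a, b)\<in>prs n S. u (Gen a) * v (Gen b)) = (\<Sum>(a, b)\<in>prs n S. v (Gen a) * u (Gen b))"
      by (rule sum.reindex_bij_witness[where i = prod.swap and j = prod.swap])
        (auto simp: prs_def pc_comm mult.commute)
    then show ?thesis by (simp add: Prd mul_Prd ac_simps)
  qed (simp_all add: ac_simps)
qed

text \<open>No property of the table \<open>pc\<close> enters: terms with three generators are zero,
  and in every other term one of the three factors is a scalar.\<close>

lemma mul_assoc: "mul n (mul n u v) w = mul n u (mul n v w)"
proof
  fix d show "mul n (mul n u v) w d = mul n u (mul n v w) d"
    by (cases d) (simp_all add: mul_Prd algebra_simps sum.distrib sum_distrib_left case_prod_unfold)
qed

lemma mul_one: "supp n u \<Longrightarrow> mul n (dl One) u = u"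
proof
  fix d show "mul n (dl One) u d = u d"
    by (cases d) (simp_all add: mul_Prd dl_def)
qed

lemma mul_add: "mul n u (\<lambda>d. v d + w d) = (\<lambda>d. mul n u v d + mul n u w d)"
proof
  fix d show "mul n u (\<lambda>d. v d + w d) d = mul n u v d + mul n u w d"
    by (cases d) (simp_all add: mul_Prd algebra_simps sum.distrib case_prod_unfold)
qed

lemma mul_smult: "mul n u (\<lambda>d. r * v d) = (\<lambda>d. r * mul n u v d)"
proof
  fix d show "mul n u (\<lambda>d. r * v d) d = r * mul n u v d"
    by (cases d) (simp_all add: mul_Prd algebra_simps sum_distrib_left case_prod_unfold)
qed

lemma mul_add_left: "mul n (\<lambda>d. v d + w d) u = (\<lambda>d. mul n v u d + mul n w u d)"
  using mul_add[of n u v w] by (simp add: mul_comm[of n u])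

lemma mul_smult_left: "mul n (\<lambda>d. r * v d) u = (\<lambda>d. r * mul n v u d)"
  using mul_smult[of n u r v] by (simp add: mul_comm[of n u])

lemma mul_zero: "mul n u (\<lambda>d. 0) = (\<lambda>d. 0)"
  using mul_smult[of n u 0 "\<lambda>d. 0"] by simp

lemma mul_sum: "mul n u (\<lambda>d. \<Sum>x\<in>T. v x d) = (\<lambda>d. \<Sum>x\<in>T. mul n u (v x) d)"
  by (induction T rule: infinite_finite_induct) (simp_all add: mul_add mul_zero)

lemma mul_sum_left: "mul n (\<lambda>d. \<Sum>x\<in>T. v x d) u = (\<lambda>d. \<Sum>x\<in>T. mul n (v x) u d)"
  using mul_sum[of n u v T] by (simp add: mul_comm[of n u])

lemma mul_hom:
  assumes "\<And>x y. h (x + y) = h x + h y" "\<And>x y. h (x * y) = h x * h y" "h 0 = 0"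
  shows "mul n (\<lambda>d. h (u d)) (\<lambda>d. h (v d)) = (\<lambda>d. h (mul n u v d))"
proof
  have hsum: "h (sum f T) = (\<Sum>x\<in>T. h (f x))" for f :: "gen \<times> gen \<Rightarrow> 'a" and T
    by (induction T rule: infinite_finite_induct) (simp_all add: assms)
  fix d show "mul n (\<lambda>d. h (u d)) (\<lambda>d. h (v d)) d = h (mul n u v d)"
    by (cases d) (simp_all add: mul_Prd assms hsum case_prod_unfold)
qed

lemma mul_dl_Gen:
  assumes "a \<in> gens n" "b \<in> gens n"
  shows "mul n (dl (Gen a)) (dl (Gen b)) = ((if pc a b = {} then (\<lambda>_. 0) else dl (Prd (pc a b))) :: idx \<Rightarrow> 'a::comm_ring_1)"
proof
  fix d show "mul n (dl (Gen a)) (dl (Gen b)) d = ((if pc a b = {} then (\<lambda>_. 0) else dl (Prd (pc a b))) :: idx \<Rightarrow> 'a) d"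
  proof (cases d)
    case (Prd S)
    have "(\<Sum>(x, y)\<in>prs n S. dl (Gen a) (Gen x) * dl (Gen b) (Gen y)) =
       (\<Sum>p\<in>prs n S. if p = (a, b) then 1 else (0::'a))"
      by (rule sum.cong) (auto simp: dl_def split: if_split_asm)
    also have "\<dots> = (if (a, b) \<in> prs n S then 1 else 0)" by (simp add: sum.delta)
    finally have eq: "(\<Sum>(x, y)\<in>prs n S. dl (Gen a) (Gen x) * dl (Gen b) (Gen y)) =
       (if (a, b) \<in> prs n S then 1 else (0::'a))" .
    show ?thesis unfolding Prd mul_Prd eq using assms by (auto simp: dl_def prs_def)
  qed (auto simp: dl_def)
qed

lemma mul_no_gens:
  assumes "u One = 0" "\<And>a. u (Gen a) = 0" "v One = 0"
  shows "mul n u v = (\<lambda>d. 0)"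
proof
  fix d show "mul n u v d = 0" by (cases d) (simp_all add: assms mul_Prd)
qed

text \<open>Cancellation: a nonzero product with i determines the other factor. Thus multiplying by
  an element whose only generator is i does not mix the coordinates of the other factor, which is
  the content of \<open>mul_single\<close>.\<close>

lemma pc_inj: "pc i b = pc i b' \<Longrightarrow> pc i b \<noteq> {} \<Longrightarrow> b = b'"
  by (cases i; cases b; cases b'; auto split: if_splits simp: doubleton_eq_iff)

lemma mul_single:
  assumes "\<And>a. a \<noteq> i \<Longrightarrow> u (Gen a) = 0" "u One = 0" "v One = 0"
    and "i \<in> gens n" "b \<in> gens n" "pc i b \<noteq> {}"
  shows "mul n u v (Prd (pc i b)) = u (Gen i) * v (Gen b)"
proof -
  have "(\<Sum>(x, y)\<in>prs n (pc i b). u (Gen x) * v (Gen y)) = (\<Sum>(x, y)\<in>{(i, b)}. u (Gen x) * v (Gen y))"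
  proof (rule sum.mono_neutral_right)
    show "\<forall>p\<in>prs n (pc i b) - {(i, b)}. (case p of (x, y) \<Rightarrow> u (Gen x) * v (Gen y)) = 0"
    proof (clarify)
      fix x y assume xy: "(x, y) \<in> prs n (pc i b)" and ne: "u (Gen x) * v (Gen y) \<noteq> 0"
      then have "x = i" using assms(1)[of x] by (metis mult_zero_left)
      moreover have "pc x y = pc i b" using xy by (auto simp: prs_def)
      ultimately show "x = i \<and> y = b" using pc_inj[of i b y] assms(6) by metis
    qed
    show "{(i, b)} \<subseteq> prs n (pc i b)" using assms(4-6) by (simp add: prs_def)
  qed simp
  then show ?thesis using assms by (simp add: mul_Prd)
qed

subsection \<open>Weights\<close>

text \<open>The character by which the diagonal map with entries c acts on a basis vector. The code
  {GE} stands for the square of e, hence the special case.\<close>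

definition wt :: "(gen \<Rightarrow> 'f::field) \<Rightarrow> idx \<Rightarrow> 'f" where
  "wt c d = (case d of One \<Rightarrow> 1 | Gen a \<Rightarrow> c a | Prd S \<Rightarrow> if S = {GE} then c GE ^ 2 else (\<Prod>x\<in>S. c x))"

lemma wt_simps [simp]: "wt c One = 1" "wt c (Gen a) = c a"
  by (simp_all add: wt_def)

text \<open>The points of the diagonal torus: scaling the generators by c respects the
  multiplication table.\<close>

definition rel :: "nat \<Rightarrow> (gen \<Rightarrow> 'f::field) \<Rightarrow> bool" where
  "rel n c \<longleftrightarrow> (\<forall>a\<in>gens n. c a \<noteq> 0) \<and>
    (\<forall>a\<in>gens n. \<forall>b\<in>gens n. pc a b \<noteq> {} \<longrightarrow> wt c (Prd (pc a b)) = c a * c b)"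

lemma relI:
  assumes "\<And>a. a \<in> gens n \<Longrightarrow> c a \<noteq> 0"
    and "\<And>x. c (GU x False) * c (GU x True) = c (GY x) * c GE"
    and "c (GY False) * c (GY True) = c GE ^ 2"
    and "\<And>i. i < n - 3 \<Longrightarrow> c (GP False i) * c (GP True i) = c GE ^ 2"
  shows "rel n c"
  unfolding rel_def
proof (intro conjI ballI impI)
  fix a b assume ab: "a \<in> gens n" "b \<in> gens n" "pc a b \<noteq> {}"
  have u: "c (GU x y) * c (GU x z) = c (GY x) * c GE" if "y \<noteq> z" for x y z
    using assms(2)[of x] that by (cases y; cases z) (auto simp: mult.commute)
  have y: "c (GY x) * c (GY z) = c GE ^ 2" if "x \<noteq> z" for x z
    using assms(3) that by (cases x; cases z) (auto simp: mult.commute)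
  have p: "c (GP x i) * c (GP z i) = c GE ^ 2" if "x \<noteq> z" "i < n - 3" for x z i
    using assms(4)[of i] that by (cases x; cases z) (auto simp: mult.commute)
  show "wt c (Prd (pc a b)) = c a * c b"
    using ab by (cases a; cases b) (auto simp: wt_def u y p power2_eq_square split: if_splits)
qed (use assms in auto)

lemma rel_nz: "rel n c \<Longrightarrow> a \<in> gens n \<Longrightarrow> c a \<noteq> 0"
  by (auto simp: rel_def)

lemma rel_wt: "rel n c \<Longrightarrow> a \<in> gens n \<Longrightarrow> b \<in> gens n \<Longrightarrow> pc a b \<noteq> {} \<Longrightarrow> wt c (Prd (pc a b)) = c a * c b"
  by (auto simp: rel_def)

lemma rel_eqs:
  assumes "rel n c"
  shows "c (GU x False) * c (GU x True) = c (GY x) * c GE" "c (GY False) * c (GY True) = c GE ^ 2"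
    "i < n - 3 \<Longrightarrow> c (GP False i) * c (GP True i) = c GE ^ 2"
  using rel_wt[OF assms, of "GU x False" "GU x True"] rel_wt[OF assms, of "GY False" "GY True"]
    rel_wt[OF assms, of "GP False i" "GP True i"] by (auto simp: wt_def)

lemma wt_mult: "wt (\<lambda>a. c a * c' a) d = wt c d * wt c' d"
  by (cases d) (simp_all add: wt_def prod.distrib power_mult_distrib)

lemma wt_one: "wt (\<lambda>a. 1) d = 1"
  by (cases d) (simp_all add: wt_def)

lemma wt_inverse: "wt (\<lambda>a. inverse (c a)) d = inverse (wt c d)"
  by (cases d) (simp_all add: wt_def prod_inversef power_inverse flip: prod_inversef)

lemma rel_mult: "rel n c \<Longrightarrow> rel n c' \<Longrightarrow> rel n (\<lambda>a. c a * c' a)"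
  by (simp add: rel_def wt_mult)

lemma rel_one: "rel n (\<lambda>a. 1)"
  by (simp add: rel_def wt_one)

lemma rel_inverse: "rel n c \<Longrightarrow> rel n (\<lambda>a. inverse (c a))"
  by (simp add: rel_def wt_inverse)

lemma gens_of_code: "a \<in> gens n \<Longrightarrow> b \<in> gens n \<Longrightarrow> x \<in> pc a b \<Longrightarrow> x \<in> gens n"
  by (cases a; cases b) (auto split: if_splits)

lemma wt_cong: assumes "\<And>a. a \<in> gens n \<Longrightarrow> c a = c' a" "d \<in> idxs n" shows "wt c d = wt c' d"
  using assms(2)
  by (cases rule: idxs_cases) (auto simp: wt_def assms(1) intro!: prod.cong dest: gens_of_code)

lemma wt_hom: fixes h :: "'f::field \<Rightarrow> 'h::field" assumes "h 1 = 1" "\<And>x y. h (x * y) = h x * h y"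
  shows "wt (\<lambda>a. h (c a)) d = h (wt c d)"
proof -
  have "h (prod f T) = (\<Prod>x\<in>T. h (f x))" for f :: "gen \<Rightarrow> 'f" and T
    by (induction T rule: infinite_finite_induct) (simp_all add: assms)
  then show ?thesis by (cases d) (simp_all add: wt_def assms power2_eq_square)
qed

lemma rel_hom: fixes h :: "'f::field \<Rightarrow> 'h::field" assumes "h 1 = 1" "h 0 = 0" "\<And>x y. h (x * y) = h x * h y" "inj h" "rel n c"
  shows "rel n (\<lambda>a. h (c a))"
proof -
  have "h x = 0 \<longleftrightarrow> x = 0" for x using injD[OF assms(4), of x 0] assms(2) by auto
  then show ?thesis using assms(5) unfolding rel_def wt_hom[where h=h, OF assms(1,3)] by (simp add: assms(3))
qed

lemma mul_wt:
  assumes "rel n c"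
  shows "mul n (\<lambda>d. wt c d * u d) (\<lambda>d. wt c d * v d) = (\<lambda>d. wt c d * mul n u v d)"
proof
  fix d show "mul n (\<lambda>d. wt c d * u d) (\<lambda>d. wt c d * v d) d = wt c d * mul n u v d"
  proof (cases d)
    case (Prd S)
    have "(\<Sum>(a, b)\<in>prs n S. wt c (Gen a) * u (Gen a) * (wt c (Gen b) * v (Gen b))) =
      (\<Sum>(a, b)\<in>prs n S. wt c d * (u (Gen a) * v (Gen b)))"
    proof (rule sum.cong)
      fix p assume p: "p \<in> prs n S"
      obtain a b where ab: "p = (a, b)" by force
      have "wt c d = c a * c b" using p rel_wt[OF assms, of a b] unfolding prs_def Prd ab by blast
      then show "(case p of (a, b) \<Rightarrow> wt c (Gen a) * u (Gen a) * (wt c (Gen b) * v (Gen b))) =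
        (case p of (a, b) \<Rightarrow> wt c d * (u (Gen a) * v (Gen b)))" by (simp add: ab)
    qed simp
    then show ?thesis by (simp add: Prd mul_Prd algebra_simps sum_distrib_left case_prod_unfold)
  qed (simp_all add: algebra_simps)
qed

subsection \<open>Elements of square zero\<close>

lemma prs_single:
  assumes "pc a b = {a, b}" "a \<noteq> b" "\<not> (\<exists>x. {a, b} = {GY x, GE})" "a \<in> gens n" "b \<in> gens n"
  shows "prs n {a, b} = {(a, b), (b, a)}"
proof -
  have "(c, d) = (a, b) \<or> (c, d) = (b, a)" if "pc c d = {a, b}" for c d
  proof -
    have "{c, d} = {a, b}"
      using that assms(2,3)
      by (cases c; cases d) (auto split: if_splits simp: doubleton_eq_iff)
    then show ?thesis using assms(2) by (auto simp: doubleton_eq_iff)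
  qed
  moreover have "pc b a = {a, b}" using assms(1) pc_comm by metis
  ultimately show ?thesis using assms by (auto simp: prs_def)
qed

lemma prs_Y: "prs n {GY x, GE} = {(GY x, GE), (GE, GY x), (GU x False, GU x True), (GU x True, GU x False)}"
proof -
  have "(c, d) \<in> {(GY x, GE), (GE, GY x), (GU x False, GU x True), (GU x True, GU x False)}"
    if "pc c d = {GY x, GE}" for c d
    using that by (cases c; cases d) (auto split: if_splits simp: doubleton_eq_iff)
  then show ?thesis by (auto simp: prs_def insert_commute)
qed

text \<open>When a product of distinct generators has a code of its own, the coordinate of the
  square there is twice the product of the two coefficients. The shared codes {GY x, GE} and {GE}
  are then settled one after the other, with these products already known to vanish.\<close>

lemma square_zero:
  fixes v :: "idx \<Rightarrow> 'f::field_char_0"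
  assumes sq: "mul n v v = (\<lambda>d. 0)"
  shows "v One = 0" "v (Gen GE) = 0"
    "\<And>a b. a \<in> gens n \<Longrightarrow> b \<in> gens n \<Longrightarrow> a \<noteq> b \<Longrightarrow> v (Gen a) * v (Gen b) = 0"
proof -
  let ?v = "\<lambda>a. v (Gen a)"
  show one: "v One = 0" using fun_cong[OF sq, of One] by simp
  have S: "(\<Sum>(a, b)\<in>prs n S. ?v a * ?v b) = 0" for S
    using fun_cong[OF sq, of "Prd S"] one by (simp add: mul_Prd)
  have single: "?v a * ?v b = 0"
    if "pc a b = {a, b}" "a \<noteq> b" "\<not> (\<exists>x. {a, b} = {GY x, GE})" "a \<in> gens n" "b \<in> gens n" for a b
  proof -
    have "?v a * ?v b + ?v b * ?v a = 0"
      using S[of "{a, b}"] that(2) unfolding prs_single[OF that] by simp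
    then show ?thesis by (simp add: mult.commute)
  qed
  have UE: "?v (GU x y) * ?v GE = 0" for x y by (rule single) (auto simp: doubleton_eq_iff)
  have PE: "?v (GP x i) * ?v GE = 0" if "i < n - 3" for x i by (rule single) (use that in \<open>auto simp: doubleton_eq_iff\<close>)
  \<comment> \<open>The two products y e and u u' share a code; the factor 2 comes from the two
    orders.\<close>
  have Yeq: "?v (GY x) * ?v GE + ?v (GU x False) * ?v (GU x True) = 0" for x
  proof -
    have "2 * (?v (GY x) * ?v GE + ?v (GU x False) * ?v (GU x True)) = 0"
      using S[of "{GY x, GE}"] unfolding prs_Y by (simp add: algebra_simps)
    then show ?thesis by (simp only: mult_eq_0_iff) simp
  qed
  \<comment> \<open>If the coefficient of e is not zero, \<open>UE\<close> makes those of the u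
    vanish, and \<open>Yeq\<close> leaves y e alone.\<close>
  have YE: "?v (GY x) * ?v GE = 0" for x
    using Yeq[of x] UE[of x False] by auto
  have UU: "?v (GU x False) * ?v (GU x True) = 0" for x
    using Yeq[of x] YE[of x] by simp
  have otherE: "?v b * ?v GE = 0" if "b \<in> gens n" "b \<noteq> GE" for b
    using that by (cases b) (auto simp del: mult_eq_0_iff simp: UE PE YE)
  \<comment> \<open>With a nonzero coefficient at e all other coefficients would vanish, and the
    coordinate at e^2 would be the square of this coefficient.\<close>
  show E0: "?v GE = 0"
  proof (rule ccontr)
    assume nz: "?v GE \<noteq> 0"
    then have "?v b = 0" if "b \<in> gens n" "b \<noteq> GE" for b using otherE[OF that] by simp
    then have "(\<Sum>(a, b)\<in>prs n {GE}. ?v a * ?v b) = (\<Sum>(a, b)\<in>{(GE, GE)}. ?v a * ?v b)"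
      by (intro sum.mono_neutral_right finite_prs) (auto simp: prs_def)
    with S[of "{GE}"] nz show False by simp
  qed
  \<comment> \<open>Suppose that one pair with product e^2 has nonzero coefficients. Every member c
    of another such pair forms with a product code of its own with a, so its coefficient vanishes;
    the coordinate at e^2 then consists of this pair alone, counted twice.\<close>
  have pairE: "?v a * ?v b = 0" if ab: "(a, b) \<in> prs n {GE}" "a \<noteq> b" for a b
  proof (rule ccontr)
    assume nz: "?v a * ?v b \<noteq> 0"
    have mem: "a \<in> gens n" "b \<in> gens n" "pc a b = {GE}" using ab by (auto simp: prs_def)
    have "a \<noteq> GE" "b \<noteq> GE" using nz E0 by auto
    have zero: "?v c = 0" if c: "(c, d) \<in> prs n {GE}" "(c, d) \<noteq> (a, b)" "(c, d) \<noteq> (b, a)" "c \<noteq> GE" for c d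
    proof -
      have "c \<in> gens n" "pc c d = {GE}" using c by (auto simp: prs_def)
      have ne: "c \<noteq> a" "c \<noteq> b"
        using c(2,3) pc_inj[of c d b] pc_inj[of c d a] \<open>pc c d = {GE}\<close> mem(3) pc_comm[of a b] by auto
      have "pc a c = {a, c} \<and> \<not> (\<exists>x. {a, c} = {GY x, GE})"
        using mem(3) ne \<open>pc c d = {GE}\<close> \<open>a \<noteq> GE\<close> c(4)
        by (cases a; cases b; cases c; cases d) (auto split: if_splits simp: doubleton_eq_iff)
      then have "?v a * ?v c = 0"
        using single[of a c] ne mem \<open>c \<in> gens n\<close> by auto
      then show ?thesis using nz by auto
    qed
    have "(\<Sum>(c, d)\<in>prs n {GE}. ?v c * ?v d) = (\<Sum>(c, d)\<in>{(a, b), (b, a)}. ?v c * ?v d)"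
    proof (rule sum.mono_neutral_right)
      show "{(a, b), (b, a)} \<subseteq> prs n {GE}" using ab by (auto simp: prs_def pc_comm)
      show "\<forall>p\<in>prs n {GE} - {(a, b), (b, a)}. (case p of (c, d) \<Rightarrow> ?v c * ?v d) = 0"
        using zero E0 by fastforce
    qed simp
    then have "?v a * ?v b + ?v b * ?v a = 0" using S[of "{GE}"] ab(2) by simp
    with nz show False by (simp add: mult.commute)
  qed
  show "?v a * ?v b = 0" if ab: "a \<in> gens n" "b \<in> gens n" "a \<noteq> b" for a b
  proof (cases "a = GE \<or> b = GE")
    case True
    then show ?thesis using E0 by auto
  next
    case False
    consider "pc a b = {GE}" | x where "pc a b = {GY x, GE}" | "pc a b = {a, b}"
    proof -
      have "pc a b = {GE} \<or> (\<exists>x. pc a b = {GY x, GE}) \<or> pc a b = {a, b}"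
        using ab False by (cases a; cases b) auto
      then show thesis using that by blast
    qed
    then show ?thesis
    proof cases
      case 1
      then show ?thesis using pairE[of a b] ab by (auto simp: prs_def)
    next
      case 2
      then have "(a, b) \<in> prs n {GY x, GE}" using ab by (auto simp: prs_def)
      then show ?thesis using False UU[of x] unfolding prs_Y by auto
    next
      case 3
      then show ?thesis using single[of a b] ab False by (auto simp: doubleton_eq_iff)
    qed
  qed
qed

subsection \<open>Automorphisms\<close>

text \<open>\<open>g a\<close> is the image of the basis vector \<open>a\<close> under an algebra automorphism.\<close>

definition autsys :: "nat \<Rightarrow> (idx \<Rightarrow> idx \<Rightarrow> 'f::field) \<Rightarrow> bool" where
  "autsys n g \<longleftrightarrow> (\<forall>a\<in>idxs n. supp n (g a)) \<and> g One = dl One \<and>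
    (\<forall>a\<in>gens n. \<forall>b\<in>gens n. mul n (g (Gen a)) (g (Gen b)) = (if pc a b = {} then (\<lambda>_. 0) else g (Prd (pc a b)))) \<and>
    (\<forall>a\<in>gens n. \<forall>b\<in>gens n. \<forall>c\<in>gens n. mul n (mul n (g (Gen a)) (g (Gen b))) (g (Gen c)) = (\<lambda>_. 0)) \<and>
    (\<forall>z. (\<forall>d. (\<Sum>a\<in>idxs n. z a * g a d) = 0) \<longrightarrow> (\<forall>a\<in>idxs n. z a = 0))"

context
  fixes n :: nat and g :: "idx \<Rightarrow> idx \<Rightarrow> 'f::field_char_0"
  assumes aut: "autsys n g"
begin

lemma autsys_mul: "a \<in> gens n \<Longrightarrow> b \<in> gens n \<Longrightarrow>
    mul n (g (Gen a)) (g (Gen b)) = (if pc a b = {} then (\<lambda>_. 0) else g (Prd (pc a b)))"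
  using aut by (simp add: autsys_def)

lemma autsys_indep: "(\<And>d. (\<Sum>a\<in>idxs n. z a * g a d) = 0) \<Longrightarrow> a \<in> idxs n \<Longrightarrow> z a = 0"
  using aut by (auto simp: autsys_def)

lemma autsys_nz: assumes "a \<in> idxs n" shows "g a \<noteq> (\<lambda>_. 0)"
proof
  assume e: "g a = (\<lambda>_. 0)"
  have "(\<Sum>b\<in>idxs n. (if b = a then 1 else 0) * g b d) = 0" for d
    by (rule sum.neutral) (auto simp: e)
  from autsys_indep[OF this assms] show False by simp
qed

lemma autsys_not_prop:
  assumes "a \<in> idxs n" "b \<in> idxs n" "a \<noteq> b" shows "g a \<noteq> (\<lambda>d. r * g b d)"
proof
  assume e: "g a = (\<lambda>d. r * g b d)"
  let ?z = "\<lambda>c. if c = a then 1 else if c = b then - r else 0"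
  have "(\<Sum>c\<in>idxs n. ?z c * g c d) = 0" for d
  proof -
    have "(\<Sum>c\<in>idxs n. ?z c * g c d) = (\<Sum>c\<in>{a, b}. ?z c * g c d)"
      by (rule sum.mono_neutral_right) (use assms in auto)
    then show ?thesis using assms(3) fun_cong[OF e, of d] by simp
  qed
  from autsys_indep[OF this assms(1)] show False by simp
qed

text \<open>The constant coefficient of the image is nilpotent, since the image has cube
  zero.\<close>

lemma autsys_One: assumes "a \<in> gens n" shows "g (Gen a) One = 0"
proof -
  have "mul n (mul n (g (Gen a)) (g (Gen a))) (g (Gen a)) = (\<lambda>_. 0)"
    using aut assms unfolding autsys_def by blast
  from fun_cong[OF this, of One] show ?thesis by simp
qed

lemma pc_GE: "pc a GE \<noteq> {}" "pc a GE = pc b GE \<longleftrightarrow> a = b" "pc GE a \<noteq> {}"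
  by (cases a; cases b; auto simp: doubleton_eq_iff)+

text \<open>For a other than e the square of a is zero, so \<open>square_zero\<close> applies to its
  image. The image cannot lie in degree 2: it would then be killed by the image of e, but the
  product of a and e is a basis vector.\<close>

lemma autsys_column:
  assumes "a \<in> gens n" "a \<noteq> GE"
  shows "\<exists>j\<in>gens n. g (Gen a) (Gen j) \<noteq> 0" "g (Gen a) (Gen GE) = 0"
    "\<And>i j. i \<in> gens n \<Longrightarrow> j \<in> gens n \<Longrightarrow> i \<noteq> j \<Longrightarrow> g (Gen a) (Gen i) * g (Gen a) (Gen j) = 0"
proof -
  have "pc a a = {}" using assms(2) by (cases a) auto
  then have sq: "mul n (g (Gen a)) (g (Gen a)) = (\<lambda>_. 0)" using autsys_mul assms by simp
  show "g (Gen a) (Gen GE) = 0"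
    "\<And>i j. i \<in> gens n \<Longrightarrow> j \<in> gens n \<Longrightarrow> i \<noteq> j \<Longrightarrow> g (Gen a) (Gen i) * g (Gen a) (Gen j) = 0"
    using square_zero[OF sq] by auto
  show "\<exists>j\<in>gens n. g (Gen a) (Gen j) \<noteq> 0"
  proof (rule ccontr)
    assume "\<not> ?thesis"
    moreover have "supp n (g (Gen a))" using aut assms unfolding autsys_def by simp
    ultimately have "g (Gen a) (Gen j) = 0" for j unfolding supp_def by (cases "j \<in> gens n") auto
    then have "mul n (g (Gen a)) (g (Gen GE)) = (\<lambda>_. 0)"
      by (intro mul_no_gens) (use autsys_One assms in auto)
    then have "g (Prd (pc a GE)) = (\<lambda>_. 0)" using autsys_mul[of a GE] assms pc_GE by simp
    moreover have "Prd (pc a GE) \<in> idxs n" using assms pc_GE by (intro Prd_in_idxs) auto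
    ultimately show False using autsys_nz by blast
  qed
qed

lemma autsys_supp: "a \<in> gens n \<Longrightarrow> j \<notin> gens n \<Longrightarrow> g (Gen a) (Gen j) = 0"
  using aut unfolding autsys_def supp_def by simp

text \<open>The identity is the norm relation N(u) = y y' e^2 = e^4, read on diagonal coefficients.
  It needs control of the images of y and e, about which nothing is assumed. The relation u u' = y e
  gives it: it shows that the image of y has a coordinate only at y modulo J^2, and after that the
  image of e only at e.\<close>

lemma autsys_norm:
  assumes diag: "\<And>x y j. j \<noteq> GU x y \<Longrightarrow> g (Gen (GU x y)) (Gen j) = 0"
  shows "(\<And>x y. g (Gen (GU x y)) (Gen (GU x y)) \<noteq> 0)"
    "g (Gen (GU False False)) (Gen (GU False False)) * g (Gen (GU True False)) (Gen (GU True False)) *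
     (g (Gen (GU False True)) (Gen (GU False True)) * g (Gen (GU True True)) (Gen (GU True True)))
     = g (Gen GE) (Gen GE) ^ 4"
proof -
  let ?u = "\<lambda>x y. g (Gen (GU x y)) (Gen (GU x y))"
  let ?e = "\<lambda>a. g (Gen GE) (Gen a)"
  show unz: "?u x y \<noteq> 0" for x y
    using autsys_column(1)[of "GU x y"] diag[of _ x y] by (metis gen.distinct(3) gens_simps(1))
  let ?y = "\<lambda>x a. g (Gen (GY x)) (Gen a)"
  have prod: "mul n (g (Gen (GY x))) (g (Gen GE)) = mul n (g (Gen (GU x False))) (g (Gen (GU x True)))" for x
    using autsys_mul[of "GU x False" "GU x True"] autsys_mul[of "GY x" GE] by simp
  have rhs: "mul n (g (Gen (GU x False))) (g (Gen (GU x True))) (Prd {GY x, GE}) = ?u x False * ?u x True" for x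
    using mul_single[of "GU x False" "g (Gen (GU x False))" "g (Gen (GU x True))" n "GU x True"] diag[of _ x False]
    by (simp add: autsys_One)
  have rhs0: "mul n (g (Gen (GU x False))) (g (Gen (GU x True))) (Prd S) = 0" if "S \<noteq> {GY x, GE}" for S x
  proof -
    have "(\<Sum>(a, b)\<in>prs n S. g (Gen (GU x False)) (Gen a) * g (Gen (GU x True)) (Gen b)) = 0"
    proof (rule sum.neutral, clarify)
      fix a b assume "(a, b) \<in> prs n S"
      then have "a \<noteq> GU x False \<or> b \<noteq> GU x True" using that by (auto simp: prs_def)
      then show "g (Gen (GU x False)) (Gen a) * g (Gen (GU x True)) (Gen b) = 0" using diag by auto
    qed
    then show ?thesis by (simp add: mul_Prd autsys_One)
  qed
  have yE: "?y x GE = 0" for x using autsys_column(2)[of "GY x"] by simp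
  \<comment> \<open>If the image of y had a coordinate at u, it would be proportional to the image
    of u modulo J^2. The images of y e and u e would then be proportional too, against linear
    independence.\<close>
  have yU: "?y x (GU x b) = 0" for x b
  proof (rule ccontr)
    assume nz: "?y x (GU x b) \<noteq> 0"
    let ?r = "?y x (GU x b) / ?u x b"
    have other: "?y x j = 0" if "j \<noteq> GU x b" for j
    proof (cases "j \<in> gens n")
      case True
      then show ?thesis using autsys_column(3)[of "GY x" j "GU x b"] nz that by auto
    qed (simp add: autsys_supp)
    let ?w = "\<lambda>d. g (Gen (GY x)) d + - ?r * g (Gen (GU x b)) d"
    have "mul n ?w (g (Gen GE)) = (\<lambda>_. 0)"
    proof (rule mul_no_gens)
      show "?w One = 0" "g (Gen GE) One = 0" by (simp_all add: autsys_One)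
      show "?w (Gen a) = 0" for a
        using other[of a] diag[of a x b] unz[of x b] by (cases "a = GU x b") auto
    qed
    then have "(\<lambda>d. mul n (g (Gen (GY x))) (g (Gen GE)) d + - ?r * mul n (g (Gen (GU x b))) (g (Gen GE)) d) = (\<lambda>_. 0)"
      by (simp only: mul_add_left mul_smult_left)
    then have "g (Prd (pc (GY x) GE)) = (\<lambda>d. ?r * g (Prd (pc (GU x b) GE)) d)"
      unfolding autsys_mul[of "GY x" GE, simplified] autsys_mul[of "GU x b" GE, simplified]
      by (auto simp: fun_eq_iff)
    moreover have "Prd (pc (GY x) GE) \<in> idxs n" "Prd (pc (GU x b) GE) \<in> idxs n"
      by (intro Prd_in_idxs; simp)+
    ultimately show False using autsys_not_prop[of "Prd (pc (GY x) GE)" "Prd (pc (GU x b) GE)" ?r]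
      by (auto simp: doubleton_eq_iff)
  qed
  \<comment> \<open>Four ordered pairs have the code {GY x, GE}. The image of y has no coordinate at
    e or at the u with the same x, so a single one of them contributes.\<close>
  have ye: "?y x (GY x) * ?e GE = ?u x False * ?u x True" for x
  proof -
    have "mul n (g (Gen (GY x))) (g (Gen GE)) (Prd {GY x, GE}) = ?u x False * ?u x True"
      using prod rhs by simp
    then show ?thesis by (simp add: mul_Prd prs_Y autsys_One yE yU)
  qed
  have ynz: "?y x (GY x) \<noteq> 0" for x using ye[of x] unz by auto
  have yother: "?y x j = 0" if "j \<noteq> GY x" for x j
  proof (cases "j \<in> gens n")
    case True
    then show ?thesis using autsys_column(3)[of "GY x" j "GY x"] ynz[of x] that by auto
  qed (simp add: autsys_supp)
  \<comment> \<open>The coordinate of y e at the product of \<open>GY x\<close> and k is the one of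
    u u' there, which is zero as long as k is neither e nor \<open>GY x\<close>; a remaining summand
    would contain the nonzero coefficient of y.\<close>
  have e0': "?e k = 0" if "k \<in> gens n" "k \<noteq> GE" "k \<noteq> GY x" for k x
  proof -
    have "pc (GY x) k \<noteq> {}" "pc (GY x) k \<noteq> {GY x, GE}"
      using that by (cases k; auto simp: doubleton_eq_iff)+
    then have "?y x (GY x) * ?e k = 0"
      using mul_single[of "GY x" "g (Gen (GY x))" "g (Gen GE)" n k] yother[of _ x] that prod[of x] rhs0[of _ x]
      by (simp add: autsys_One)
    then show ?thesis using ynz[of x] by simp
  qed
  \<comment> \<open>The index excluded for one value of x is reached with the other one.\<close>
  have e0: "?e k = 0" if "k \<noteq> GE" for k
  proof (cases "k \<in> gens n")
    case True
    then show ?thesis using e0'[of k False] e0'[of k True] that by (cases "k = GY False") auto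
  qed (simp add: autsys_supp)
  have "mul n (g (Gen (GY False))) (g (Gen (GY True))) = mul n (g (Gen GE)) (g (Gen GE))"
    using autsys_mul[of "GY False" "GY True"] autsys_mul[of GE GE] by simp
  moreover have "mul n (g (Gen (GY False))) (g (Gen (GY True))) (Prd {GE}) = ?y False (GY False) * ?y True (GY True)"
    using mul_single[of "GY False" "g (Gen (GY False))" "g (Gen (GY True))" n "GY True"] yother[of _ False]
    by (simp add: autsys_One)
  moreover have "mul n (g (Gen GE)) (g (Gen GE)) (Prd {GE}) = ?e GE * ?e GE"
    using mul_single[of GE "g (Gen GE)" "g (Gen GE)" n GE] e0 by (simp add: autsys_One)
  ultimately have yy: "?y False (GY False) * ?y True (GY True) = ?e GE * ?e GE" by simp
  have "?u False False * ?u True False * (?u False True * ?u True True) =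
      (?u False False * ?u False True) * (?u True False * ?u True True)" by simp
  also have "\<dots> = (?y False (GY False) * ?y True (GY True)) * (?e GE * ?e GE)"
    by (simp only: flip: ye) simp
  finally show "?u False False * ?u True False * (?u False True * ?u True True) = ?e GE ^ 4"
    unfolding yy by (simp add: power4_eq_xxxx)
qed

text \<open>The first hypothesis is commutation with the diagonal map of t, entry by entry. The
  weight of each generator differs from all other weights, so every generator is an eigenvector of
  g. Products follow, and two generator pairs with the same code give the relations between the
  eigenvalues.\<close>

lemma autsys_diagonal:
  assumes "\<And>a d. a \<in> idxs n \<Longrightarrow> d \<in> idxs n \<Longrightarrow> wt t a * g a d = wt t d * g a d"
    and "\<And>a d. a \<in> gens n \<Longrightarrow> d \<in> idxs n \<Longrightarrow> d \<noteq> Gen a \<Longrightarrow> wt t d \<noteq> wt t (Gen a)"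
  shows "\<exists>c. rel n c \<and> (\<forall>a\<in>idxs n. g a = (\<lambda>d. wt c a * dl a d))"
proof -
  define c where "c a = g (Gen a) (Gen a)" for a
  have gen: "g (Gen a) = (\<lambda>d. c a * dl (Gen a) d)" if "a \<in> gens n" for a
  proof
    fix d show "g (Gen a) d = c a * dl (Gen a) d"
    proof (cases "d \<in> idxs n")
      case True
      then show ?thesis using assms(1)[of "Gen a" d] assms(2)[of a d] that
        by (auto simp: dl_def c_def)
    next
      case False
      then show ?thesis using that aut by (auto simp: autsys_def supp_def dl_def)
    qed
  qed
  have prd: "g (Prd (pc a b)) = (\<lambda>d. c a * c b * dl (Prd (pc a b)) d)"
    if "a \<in> gens n" "b \<in> gens n" "pc a b \<noteq> {}" for a b
    using autsys_mul[OF that(1,2)] that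
    by (simp add: gen mul_smult mul_smult_left mul_dl_Gen mult.assoc mult.left_commute)
  have nz: "c a \<noteq> 0" if "a \<in> gens n" for a
    using autsys_nz[of "Gen a"] gen[OF that] that by auto
  have eq: "c a * c b = c a' * c b'"
    if "pc a b = pc a' b'" "a \<in> gens n" "b \<in> gens n" "a' \<in> gens n" "b' \<in> gens n" "pc a b \<noteq> {}" for a b a' b'
    using fun_cong[OF prd[of a b], of "Prd (pc a b)"] fun_cong[OF prd[of a' b'], of "Prd (pc a b)"] that
    by (simp add: dl_def)
  have rel: "rel n c"
    by (rule relI) (use nz eq[of "GU x False" "GU x True" "GY x" GE for x] eq[of "GY False" "GY True" GE GE]
        eq[of "GP False i" "GP True i" GE GE for i] in \<open>auto simp: power2_eq_square\<close>)
  have "g a = (\<lambda>d. wt c a * dl a d)" if "a \<in> idxs n" for a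
    using that
  proof (cases rule: idxs_cases)
    case 1
    then show ?thesis using aut by (simp add: autsys_def)
  next
    case (3 a' b')
    then show ?thesis using prd[of a' b'] rel_wt[OF rel, of a' b'] by simp
  qed (simp add: gen)
  with rel show ?thesis by blast
qed

end

subsection \<open>The Galois action\<close>

fun act :: "gal \<Rightarrow> gen \<Rightarrow> gen" where
  "act g (GU a b) = GU (a \<noteq> fst g) (b \<noteq> snd g)"
| "act g (GY a) = GY (a \<noteq> fst g)"
| "act g GE = GE"
| "act g (GP a i) = GP a i"

definition actD :: "gal \<Rightarrow> idx \<Rightarrow> idx" where
  "actD g d = (case d of One \<Rightarrow> One | Gen a \<Rightarrow> Gen (act g a) | Prd S \<Rightarrow> Prd (act g ` S))"

lemma actD_simps [simp]: "actD g One = One" "actD g (Gen a) = Gen (act g a)" "actD g (Prd S) = Prd (act g ` S)"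
  by (simp_all add: actD_def)

lemma act_invol [simp]: "act g (act g a) = a"
  by (cases a) auto

lemma act_act: "act g (act h a) = act (gmul g h) a"
  by (cases a) (auto simp: gmul_def)

lemma act_id [simp]: "act (False, False) a = a"
  by (cases a) auto

lemma actD_invol [simp]: "actD g (actD g d) = d"
  by (cases d) (auto simp: image_image)

lemma actD_act: "actD g (actD h d) = actD (gmul g h) d"
  by (cases d) (auto simp: image_image act_act)

lemma actD_id [simp]: "actD (False, False) d = d"
  by (cases d) auto

lemma act_inj: "act g a = act g b \<longleftrightarrow> a = b" 
  by (metis act_invol)

lemma act_gens [simp]: "act g a \<in> gens n \<longleftrightarrow> a \<in> gens n"
  by (cases a) auto

lemma act_pc: "pc (act g a) (act g b) = act g ` pc a b"
  by (cases a; cases b) auto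

lemma actD_idxs_aux: assumes "d \<in> idxs n" shows "actD g d \<in> idxs n"
  using assms
proof (cases rule: idxs_cases)
  case (3 a b)
  then have "Prd (pc (act g a) (act g b)) \<in> idxs n" by (intro Prd_in_idxs) (auto simp: act_pc)
  then show ?thesis by (simp add: 3 act_pc)
qed auto

lemma actD_idxs [simp]: "actD g d \<in> idxs n \<longleftrightarrow> d \<in> idxs n"
  using actD_idxs_aux by (metis actD_invol)

text \<open>The fixed vectors of the semilinear Galois action on the split algebra over L, which
  permutes the basis by \<open>actD\<close> and conjugates the coefficients. By Galois descent they
  form a \<rat>-algebra that becomes split over L.\<close>

definition equiv :: "(idx \<Rightarrow> quad) \<Rightarrow> bool" where
  "equiv F \<longleftrightarrow> (\<forall>g d. F (actD g d) = cj g (F d))"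

lemma equiv_mul: assumes "equiv F" "equiv H" shows "equiv (mul n F H)"
  unfolding equiv_def
proof (intro allI)
  fix g d
  have e: "F (actD g d) = cj g (F d)" "H (actD g d) = cj g (H d)" for d
    using assms unfolding equiv_def by blast+
  have e2: "F (Gen (act g a)) = cj g (F (Gen a))" "H (Gen (act g a)) = cj g (H (Gen a))"
     "F (Prd (act g ` S)) = cj g (F (Prd S))" "H (Prd (act g ` S)) = cj g (H (Prd S))"
     "F One = cj g (F One)" "H One = cj g (H One)" for a S
    using e[of "Gen a"] e[of "Prd S"] e[of One] by simp_all
  show "mul n F H (actD g d) = cj g (mul n F H d)"
  proof (cases d)
    case (Prd S)
    have "(\<Sum>(a, b)\<in>prs n (act g ` S). F (Gen a) * H (Gen b)) =
      (\<Sum>(a, b)\<in>prs n S. F (Gen (act g a)) * H (Gen (act g b)))"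
      by (rule sum.reindex_bij_witness[where i = "map_prod (act g) (act g)" and j = "map_prod (act g) (act g)"])
        (auto simp: prs_def act_pc image_image)
    then show ?thesis using e2(5,6) by (simp add: Prd mul_Prd cj_sum case_prod_unfold e2(1-4))
  qed (use e2 in simp_all)
qed

lemma equiv_wt: assumes "\<And>g a. c (act g a) = cj g (c a)" shows "equiv (wt c)"
  unfolding equiv_def
proof (intro allI)
  fix g d
  show "wt c (actD g d) = cj g (wt c d)"
  proof (cases d)
    case (Prd S)
    have "act g ` S = {GE} \<longleftrightarrow> S = {GE}"
    proof
      assume "act g ` S = {GE}"
      then have "act g ` (act g ` S) = {GE}" by simp
      then show "S = {GE}" by (simp add: image_image)
    qed simp
    moreover have "prod c (act g ` S) = (\<Prod>x\<in>S. c (act g x))"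
      by (subst prod.reindex) (auto simp: inj_on_def act_inj)
    moreover have "c GE = cj g (c GE)" using assms[of g GE] by simp
    ultimately show ?thesis by (simp add: Prd wt_def cj_prod assms power2_eq_square)
  qed (simp_all add: assms)
qed

section \<open>The algebra over the rationals\<close>

text \<open>The rational numbers as a subring of the complex numbers, so that
  \<open>R_trivial\<close> draws its extension fields from the type \<open>complex\<close>.\<close>

definition kQ :: "complex ring" where
  "kQ = \<lparr>carrier = \<rat>, monoid.mult = (*), one = 1, ring.zero = 0, ring.add = (+)\<rparr>"

lemma kQ_simps [simp]: "carrier kQ = \<rat>" "x \<otimes>\<^bsub>kQ\<^esub> y = x * y" "\<one>\<^bsub>kQ\<^esub> = 1" "\<zero>\<^bsub>kQ\<^esub> = 0" "x \<oplus>\<^bsub>kQ\<^esub> y = x + y"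
  by (simp_all add: kQ_def)

lemma cring_kQ: "cring kQ"
proof (intro cringI abelian_groupI comm_monoidI)
  fix x assume "x \<in> carrier kQ"
  then show "\<exists>y\<in>carrier kQ. y \<oplus>\<^bsub>kQ\<^esub> x = \<zero>\<^bsub>kQ\<^esub>" by (intro bexI[of _ "- x"]) auto
qed (auto simp: algebra_simps)

lemma field_kQ: "field kQ"
proof (rule cring.cring_fieldI2[OF cring_kQ])
  fix a assume "a \<in> carrier kQ" "a \<noteq> \<zero>\<^bsub>kQ\<^esub>"
  then show "\<exists>b\<in>carrier kQ. a \<otimes>\<^bsub>kQ\<^esub> b = \<one>\<^bsub>kQ\<^esub>" by (intro bexI[of _ "inverse a"]) auto
qed simp

definition ratq :: "complex \<Rightarrow> rat" where "ratq z = (THE r. z = of_rat r)"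

lemma ratq_of_rat [simp]: "ratq (of_rat r) = r"
  by (simp add: ratq_def)

lemma of_rat_ratq: "z \<in> \<rat> \<Longrightarrow> of_rat (ratq z) = z"
  by (metis Rats_cases ratq_of_rat)

definition emb :: "quad \<Rightarrow> complex" where "emb = iota \<i> (complex_of_real (sqrt 3))"

lemma inj_emb: "inj emb"
proof -
  have "complex_of_real (sqrt 3) * complex_of_real (sqrt 3) = 3"
    by (simp flip: of_real_mult)
  then show ?thesis unfolding emb_def by (intro iota_inj) simp_all
qed

lemma emb_eq_iff [simp]: "emb x = emb y \<longleftrightarrow> x = y"
  using inj_emb by (auto dest: injD)

definition enc :: "nat \<Rightarrow> idx \<Rightarrow> nat" where "enc n = (SOME f. inj_on f (idxs n))"

lemma inj_enc: "inj_on (enc n) (idxs n)"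
proof -
  obtain f :: "idx \<Rightarrow> nat" and m where "f ` idxs n = {i. i < m}" "inj_on f (idxs n)"
    using finite_imp_inj_to_nat_seg[OF finite_idxs[of n]] by blast
  then show ?thesis unfolding enc_def by (metis someI_ex)
qed

text \<open>An encoding of equivariant functions in the element type of the algebra, through an
  arbitrary numbering of the basis and the embedding \<open>emb\<close>. Its injectivity lets all
  operations be transported along it.\<close>

definition eF :: "nat \<Rightarrow> (idx \<Rightarrow> quad) \<Rightarrow> nat \<Rightarrow> complex" where
  "eF n F = (\<lambda>m. if m \<in> enc n ` idxs n then emb (F (inv_into (idxs n) (enc n) m)) else 0)"

definition formQ :: "nat \<Rightarrow> (idx \<Rightarrow> quad) set" where "formQ n = {F. supp n F \<and> equiv F}"

lemma inj_eF: "inj_on (eF n) (formQ n)"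
proof (rule inj_onI, rule ext)
  fix F H d assume F: "F \<in> formQ n" "H \<in> formQ n" and e: "eF n F = eF n H"
  show "F d = H d"
  proof (cases "d \<in> idxs n")
    case True
    then show ?thesis using fun_cong[OF e, of "enc n d"] inj_enc[of n] by (simp add: eF_def)
  next
    case False
    then show ?thesis using F by (simp add: formQ_def supp_def)
  qed
qed

definition dF :: "nat \<Rightarrow> (nat \<Rightarrow> complex) \<Rightarrow> idx \<Rightarrow> quad" where "dF n = inv_into (formQ n) (eF n)"

lemma dF_eF [simp]: "F \<in> formQ n \<Longrightarrow> dF n (eF n F) = F"
  by (simp add: dF_def inj_eF)

lemma eF_eq_iff: "F \<in> formQ n \<Longrightarrow> H \<in> formQ n \<Longrightarrow> eF n F = eF n H \<longleftrightarrow> F = H"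
  by (metis dF_eF)

text \<open>The algebra of equivariant functions, copied into the type \<open>nat \<Rightarrow> complex\<close> along \<open>eF\<close>.\<close>

definition Aalg :: "nat \<Rightarrow> (complex, nat \<Rightarrow> complex) module" where
  "Aalg n = \<lparr>carrier = eF n ` formQ n,
     monoid.mult = (\<lambda>f g. eF n (mul n (dF n f) (dF n g))),
     one = eF n (dl One),
     ring.zero = eF n (\<lambda>_. 0),
     ring.add = (\<lambda>f g. eF n (\<lambda>d. dF n f d + dF n g d)),
     module.smult = (\<lambda>r f. eF n (\<lambda>d. of_rat (ratq r) * dF n f d))\<rparr>"

lemma carrier_Aalg: "carrier (Aalg n) = eF n ` formQ n"
  by (simp add: Aalg_def)

lemma one_zero_Aalg: "\<one>\<^bsub>Aalg n\<^esub> = eF n (dl One)" "\<zero>\<^bsub>Aalg n\<^esub> = eF n (\<lambda>_. 0)"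
  by (simp_all add: Aalg_def)

lemma ops_Aalg:
  assumes "F \<in> formQ n" "H \<in> formQ n"
  shows "eF n F \<otimes>\<^bsub>Aalg n\<^esub> eF n H = eF n (mul n F H)" "eF n F \<oplus>\<^bsub>Aalg n\<^esub> eF n H = eF n (\<lambda>d. F d + H d)"
  using assms by (simp_all add: Aalg_def)

lemma smult_Aalg: "F \<in> formQ n \<Longrightarrow> of_rat r \<odot>\<^bsub>Aalg n\<^esub> eF n F = eF n (\<lambda>d. of_rat r * F d)"
  by (simp add: Aalg_def)

lemma formQ_equiv: "F \<in> formQ n \<Longrightarrow> F (actD g d) = cj g (F d)"
  unfolding formQ_def equiv_def by blast

lemma formQ_supp: "F \<in> formQ n \<Longrightarrow> d \<notin> idxs n \<Longrightarrow> F d = 0"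
  by (simp add: formQ_def supp_def)

lemma formQ_mul: "F \<in> formQ n \<Longrightarrow> H \<in> formQ n \<Longrightarrow> mul n F H \<in> formQ n"
  by (simp add: formQ_def supp_mul equiv_mul)

lemma formQ_one: "dl One \<in> formQ n"
proof -
  have "actD g d = One \<longleftrightarrow> d = One" for g d by (metis actD_simps(1) actD_invol)
  then show ?thesis by (auto simp: formQ_def supp_def equiv_def dl_def)
qed

lemma formQ_zero: "(\<lambda>_. 0) \<in> formQ n"
  by (auto simp: formQ_def supp_def equiv_def)

lemma formQ_add: "F \<in> formQ n \<Longrightarrow> H \<in> formQ n \<Longrightarrow> (\<lambda>d. F d + H d) \<in> formQ n"
  by (auto simp: formQ_def supp_def equiv_def)

lemma formQ_smult: "F \<in> formQ n \<Longrightarrow> (\<lambda>d. of_rat r * F d) \<in> formQ n"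
  by (auto simp: formQ_def supp_def equiv_def)

lemma formQ_minus: "F \<in> formQ n \<Longrightarrow> (\<lambda>d. - F d) \<in> formQ n"
  by (auto simp: formQ_def supp_def equiv_def)

lemma formQ_sum: "(\<And>x. x \<in> T \<Longrightarrow> F x \<in> formQ n) \<Longrightarrow> (\<lambda>d. \<Sum>x\<in>T. F x d) \<in> formQ n"
  by (induction T rule: infinite_finite_induct) (auto intro: formQ_zero formQ_add)

lemma formQ_wt:
  assumes "\<And>g a. c (act g a) = cj g (c a)" "F \<in> formQ n"
  shows "(\<lambda>d. wt c d * F d) \<in> formQ n"
  using equiv_wt[OF assms(1)] assms(2) by (auto simp: formQ_def supp_def equiv_def)

lemmas formQ_intros = formQ_mul formQ_one formQ_zero formQ_add formQ_smult formQ_minus formQ_sum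

lemma supp_formQ: "F \<in> formQ n \<Longrightarrow> supp n F"
  by (simp add: formQ_def)

lemma cring_Aalg: "cring (Aalg n)"
proof (intro cringI abelian_groupI comm_monoidI)
  fix x assume "x \<in> carrier (Aalg n)"
  then obtain F where F: "F \<in> formQ n" "x = eF n F" by (auto simp: carrier_Aalg)
  then have "eF n (\<lambda>d. - F d) \<oplus>\<^bsub>Aalg n\<^esub> x = \<zero>\<^bsub>Aalg n\<^esub>"
    by (simp add: ops_Aalg formQ_minus one_zero_Aalg)
  then show "\<exists>y\<in>carrier (Aalg n). y \<oplus>\<^bsub>Aalg n\<^esub> x = \<zero>\<^bsub>Aalg n\<^esub>"
    using F by (auto simp: carrier_Aalg formQ_minus)
next
  fix x y assume "x \<in> carrier (Aalg n)" "y \<in> carrier (Aalg n)"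
  then show "x \<otimes>\<^bsub>Aalg n\<^esub> y = y \<otimes>\<^bsub>Aalg n\<^esub> x"
    by (auto simp: carrier_Aalg ops_Aalg) (metis mul_comm)
qed (auto simp: carrier_Aalg ops_Aalg one_zero_Aalg formQ_intros mul_add_left mul_one supp_formQ
    mul_assoc ac_simps)

lemma Rats_of_rat: "z \<in> \<rat> \<Longrightarrow> \<exists>r. z = of_rat r"
  by (auto elim: Rats_cases)

lemma algebra_Aalg: "algebra kQ (Aalg n)"
proof (rule algebraI[OF cring_kQ cring_Aalg])
  fix a x y assume a: "a \<in> carrier kQ" and xy: "x \<in> carrier (Aalg n)" "y \<in> carrier (Aalg n)"
  obtain r where r: "a = of_rat r" using a Rats_of_rat by auto
  obtain F H where F: "F \<in> formQ n" "H \<in> formQ n" "x = eF n F" "y = eF n H"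
    using xy by (auto simp: carrier_Aalg)
  show "a \<odot>\<^bsub>Aalg n\<^esub> (x \<oplus>\<^bsub>Aalg n\<^esub> y) = a \<odot>\<^bsub>Aalg n\<^esub> x \<oplus>\<^bsub>Aalg n\<^esub> a \<odot>\<^bsub>Aalg n\<^esub> y"
    using F by (simp add: r smult_Aalg ops_Aalg formQ_intros distrib_left)
  show "a \<odot>\<^bsub>Aalg n\<^esub> x \<otimes>\<^bsub>Aalg n\<^esub> y = a \<odot>\<^bsub>Aalg n\<^esub> (x \<otimes>\<^bsub>Aalg n\<^esub> y)"
    using F by (simp add: r smult_Aalg ops_Aalg formQ_intros mul_smult_left)
next
  fix a b x assume a: "a \<in> carrier kQ" "b \<in> carrier kQ" and x: "x \<in> carrier (Aalg n)"
  obtain r s where r: "a = of_rat r" "b = of_rat s" using a Rats_of_rat by (metis kQ_simps(1))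
  obtain F where F: "F \<in> formQ n" "x = eF n F" using x by (auto simp: carrier_Aalg)
  have e: "of_rat r \<oplus>\<^bsub>kQ\<^esub> of_rat s = of_rat (r + s)" "of_rat r \<otimes>\<^bsub>kQ\<^esub> of_rat s = of_rat (r * s)"
    by (simp_all add: of_rat_add of_rat_mult)
  have f: "(\<lambda>d. of_rat r * F d) \<in> formQ n" "(\<lambda>d. of_rat s * F d) \<in> formQ n" using F by (simp_all add: formQ_smult)
  show "(a \<oplus>\<^bsub>kQ\<^esub> b) \<odot>\<^bsub>Aalg n\<^esub> x = a \<odot>\<^bsub>Aalg n\<^esub> x \<oplus>\<^bsub>Aalg n\<^esub> b \<odot>\<^bsub>Aalg n\<^esub> x"
    unfolding F(2) r unfolding e smult_Aalg[OF F(1)] ops_Aalg(2)[OF f] by (simp only: of_rat_add distrib_right)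
  show "(a \<otimes>\<^bsub>kQ\<^esub> b) \<odot>\<^bsub>Aalg n\<^esub> x = a \<odot>\<^bsub>Aalg n\<^esub> (b \<odot>\<^bsub>Aalg n\<^esub> x)"
    unfolding F(2) r unfolding e smult_Aalg[OF F(1)] smult_Aalg[OF f(2)] by (simp only: of_rat_mult mult.assoc)
next
  fix a x assume a: "a \<in> carrier kQ" and x: "x \<in> carrier (Aalg n)"
  obtain r where r: "a = of_rat r" using a Rats_of_rat by auto
  obtain F where F: "F \<in> formQ n" "x = eF n F" using x by (auto simp: carrier_Aalg)
  show "a \<odot>\<^bsub>Aalg n\<^esub> x \<in> carrier (Aalg n)" using F by (simp add: r smult_Aalg carrier_Aalg formQ_smult)
next
  fix x assume "x \<in> carrier (Aalg n)"
  then obtain F where F: "F \<in> formQ n" "x = eF n F" by (auto simp: carrier_Aalg)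
  show "\<one>\<^bsub>kQ\<^esub> \<odot>\<^bsub>Aalg n\<^esub> x = x" using F smult_Aalg[OF F(1), of 1] by simp
qed

lemma vectorspace_Aalg: "vectorspace kQ (Aalg n)"
  by (intro vectorspace.intro algebra.module[OF algebra_Aalg] field_kQ)

lemma finsum_Aalg:
  assumes "finite T" "\<And>x. x \<in> T \<Longrightarrow> F x \<in> formQ n"
  shows "finsum (Aalg n) (\<lambda>x. eF n (F x)) T = eF n (\<lambda>d. \<Sum>x\<in>T. F x d)"
proof -
  interpret cring "Aalg n" by (rule cring_Aalg)
  show ?thesis using assms
    by (induction T) (auto simp: one_zero_Aalg carrier_Aalg ops_Aalg formQ_sum)
qed

subsection \<open>Galois descent\<close>

definition q_unit :: "nat \<Rightarrow> quad" where
  "q_unit i = (if i = 0 then 1 else if i = 1 then Quad 0 1 0 0 else if i = 2 then Quad 0 0 1 0 else Quad 0 0 0 1)"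

definition q_coord :: "nat \<Rightarrow> quad \<Rightarrow> rat" where
  "q_coord i x = (if i = 0 then q0 x else if i = 1 then q1 x else if i = 2 then q2 x else q3 x)"

lemma sum4: "(\<Sum>i<4. f i) = f 0 + f 1 + f 2 + f (3::nat)"
  by (simp add: eval_nat_numeral)

lemma q_expand: "(\<Sum>i<4. of_rat (q_coord i x) * q_unit i) = x"
  by (intro quad_eqI) (simp_all add: sum4 q_coord_def q_unit_def of_rat_quad)

lemma UNIV_gal: "(UNIV :: gal set) = {(False, False), (False, True), (True, False), (True, True)}"
  by (auto simp: UNIV_bool)

text \<open>The basis of L dual to \<open>q_unit\<close> for the trace form. The units are
  orthogonal for this form, so each dual vector is the inverse of the unit divided by 4.\<close>

definition q_dual :: "nat \<Rightarrow> quad" where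
  "q_dual i = (if i = 0 then Quad (1/4) 0 0 0 else if i = 1 then Quad 0 (-1/4) 0 0
     else if i = 2 then Quad 0 0 (1/12) 0 else Quad 0 0 0 (-1/12))"

lemma q_dual: "(\<Sum>i<4. q_dual i * cj g (q_unit i)) = (if g = (False, False) then 1 else 0)"
  by (cases g; cases "fst g"; cases "snd g"; intro quad_eqI)
    (auto simp: sum4 q_dual_def q_unit_def)

text \<open>The conjugates of a basis of L form an invertible matrix. Up to a scaling of the columns
  it is the character table of the Klein four-group, and signed sums of the four equations isolate
  four times each unknown.\<close>

lemma q_system:
  assumes "\<And>g. (\<Sum>i<4. cj g (q_unit i) * w i) = 0" "i < 4"
  shows "w i = 0"
proof -
  have e: "w 0 + Quad 0 (if s then -1 else 1) 0 0 * w 1 + Quad 0 0 (if t then -1 else 1) 0 * w 2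
     + Quad 0 0 0 (if s = t then 1 else -1) * w 3 = 0" for s t
  proof -
    have "cj (s, t) (q_unit 1) = Quad 0 (if s then -1 else 1) 0 0"
      "cj (s, t) (q_unit 2) = Quad 0 0 (if t then -1 else 1) 0"
      "cj (s, t) (q_unit 3) = Quad 0 0 0 (if s = t then 1 else -1)" "cj (s, t) (q_unit 0) = 1"
      by (auto intro!: quad_eqI simp: q_unit_def)
    then show ?thesis using assms(1)[of "(s, t)"] by (simp add: sum4)
  qed
  let ?i = "Quad 0 1 0 0" and ?s = "Quad 0 0 1 0" and ?k = "Quad 0 0 0 1"
  have m: "Quad 0 (-1) 0 0 = - ?i" "Quad 0 0 (-1) 0 = - ?s" "Quad 0 0 0 (-1) = - ?k"
    by (auto intro!: quad_eqI)
  have nz: "?i \<noteq> 0" "?s \<noteq> 0" "?k \<noteq> 0" by (auto simp: zero_quad_def)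
  have e1: "w 0 + ?i * w 1 + ?s * w 2 + ?k * w 3 = 0" using e[of False False] by simp
  have e2: "w 0 + ?i * w 1 - ?s * w 2 - ?k * w 3 = 0" using e[of False True] by (simp add: m)
  have e3: "w 0 - ?i * w 1 + ?s * w 2 - ?k * w 3 = 0" using e[of True False] by (simp add: m)
  have e4: "w 0 - ?i * w 1 - ?s * w 2 + ?k * w 3 = 0" using e[of True True] by (simp add: m)
  have gen: "a = 0 \<and> b = 0 \<and> c = 0 \<and> k = 0"
    if "a + b + c + k = 0" "a + b - c - k = 0" "a - b + c - k = 0" "a - b - c + k = 0" for a b c k :: quad
  proof -
    have "4 * a = (a + b + c + k) + (a + b - c - k) + (a - b + c - k) + (a - b - c + k)"
      "4 * b = (a + b + c + k) + (a + b - c - k) - (a - b + c - k) - (a - b - c + k)"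
      "4 * c = (a + b + c + k) - (a + b - c - k) + (a - b + c - k) - (a - b - c + k)"
      "4 * k = (a + b + c + k) - (a + b - c - k) - (a - b + c - k) + (a - b - c + k)"
      by (simp_all add: algebra_simps)
    then have "4 * a = 0" "4 * b = 0" "4 * c = 0" "4 * k = 0" by (simp_all only: that) simp_all
    then show ?thesis by simp
  qed
  have "w 0 = 0" "w 1 = 0" "w 2 = 0" "w 3 = 0" using gen[OF e1 e2 e3 e4] nz by simp_all
  moreover have "i = 0 \<or> i = 1 \<or> i = 2 \<or> i = 3" using assms(2) by auto
  ultimately show ?thesis by auto
qed

lemma gmul_invol [simp]: "gmul g (gmul g h) = h"
  by (cases g; cases h) (auto simp: gmul_def)

text \<open>The trace over the Galois group of \<open>q_unit i\<close> times the basis vector d, for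
  the semilinear action.\<close>

definition orb :: "idx \<Rightarrow> nat \<Rightarrow> idx \<Rightarrow> quad" where
  "orb d i = (\<lambda>e. \<Sum>g\<in>UNIV. if e = actD g d then cj g (q_unit i) else 0)"

lemma orb_formQ: assumes "d \<in> idxs n" shows "orb d i \<in> formQ n"
  unfolding formQ_def
proof (intro CollectI conjI)
  show "supp n (orb d i)"
    unfolding supp_def orb_def using assms by (auto intro!: sum.neutral)
  show "equiv (orb d i)"
    unfolding equiv_def
  proof (intro allI)
    fix h e
    have "orb d i (actD h e) = (\<Sum>g\<in>UNIV. if actD h e = actD (gmul h g) d then cj (gmul h g) (q_unit i) else 0)"
      unfolding orb_def
      by (rule sum.reindex_bij_witness[where i = "gmul h" and j = "gmul h"]) auto
    also have "\<dots> = (\<Sum>g\<in>UNIV. cj h (if e = actD g d then cj g (q_unit i) else 0))"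
    proof (rule sum.cong)
      fix g :: gal
      have "actD h e = actD (gmul h g) d \<longleftrightarrow> e = actD g d"
        by (simp flip: actD_act) (metis actD_invol)
      then show "(if actD h e = actD (gmul h g) d then cj (gmul h g) (q_unit i) else 0) =
        cj h (if e = actD g d then cj g (q_unit i) else 0)" by (simp add: cj_cj)
    qed simp
    finally show "orb d i (actD h e) = cj h (orb d i e)" by (simp add: orb_def cj_sum)
  qed
qed

text \<open>Orthogonality of the dual bases removes every conjugate but the identity from the
  traces. Hence the equivariant functions span the split algebra over L.\<close>

lemma dl_orb: "dl d = (\<lambda>e. \<Sum>i<4. q_dual i * orb d i e)"
proof
  fix e
  have "(\<Sum>i<4. q_dual i * orb d i e) =
    (\<Sum>g\<in>UNIV. \<Sum>i<4. if e = actD g d then q_dual i * cj g (q_unit i) else 0)"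
    unfolding orb_def by (subst sum.swap) (simp add: sum_distrib_left if_distrib cong: if_cong)
  also have "\<dots> = (\<Sum>g\<in>UNIV. if e = actD g d then (\<Sum>i<4. q_dual i * cj g (q_unit i)) else 0)"
    by (rule sum.cong) auto
  also have "\<dots> = (\<Sum>g\<in>UNIV. if g = (False, False) then (if e = d then 1 else 0) else 0)"
    unfolding q_dual by (rule sum.cong) auto
  also have "\<dots> = dl d e" by (simp add: dl_def)
  finally show "dl d e = (\<Sum>i<4. q_dual i * orb d i e)" ..
qed

text \<open>An equivariant function is a quarter of its own trace, the group having order 4.
  Expanding its coefficients in \<open>q_unit\<close> gives a rational combination of the elements
  \<open>orb d i\<close>.\<close>

lemma formQ_orb:
  assumes "F \<in> formQ n"
  shows "F = (\<lambda>e. \<Sum>p\<in>idxs n \<times> {..<4}. of_rat (q_coord (snd p) (F (fst p)) / 4) * orb (fst p) (snd p) e)"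
proof
  fix e
  have "(\<Sum>p\<in>idxs n \<times> {..<4}. of_rat (q_coord (snd p) (F (fst p)) / 4) * orb (fst p) (snd p) e) =
    (\<Sum>d\<in>idxs n. \<Sum>i<4. of_rat (q_coord i (F d) / 4) * orb d i e)"
    by (simp add: sum.cartesian_product case_prod_unfold)
  also have "\<dots> = (\<Sum>d\<in>idxs n. \<Sum>i<4. \<Sum>g\<in>UNIV. if e = actD g d then of_rat (q_coord i (F d) / 4) * cj g (q_unit i) else 0)"
    by (simp add: orb_def sum_distrib_left if_distrib cong: if_cong)
  also have "\<dots> = (\<Sum>d\<in>idxs n. \<Sum>g\<in>UNIV. \<Sum>i<4. if e = actD g d then of_rat (q_coord i (F d) / 4) * cj g (q_unit i) else 0)"
    by (intro sum.cong refl sum.swap)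
  also have "\<dots> = (\<Sum>d\<in>idxs n. \<Sum>g\<in>UNIV. if e = actD g d then F e / 4 else 0)"
  proof (intro sum.cong refl)
    fix d and g :: gal
    have "(\<Sum>i<4. of_rat (q_coord i (F d) / 4) * cj g (q_unit i)) = cj g (\<Sum>i<4. of_rat (q_coord i (F d)) * q_unit i) / 4"
      by (simp add: cj_sum of_rat_divide sum_divide_distrib)
    also have "\<dots> = F (actD g d) / 4" by (simp add: q_expand formQ_equiv[OF assms])
    finally show "(\<Sum>i<4. if e = actD g d then of_rat (q_coord i (F d) / 4) * cj g (q_unit i) else 0) =
       (if e = actD g d then F e / 4 else 0)" by auto
  qed
  also have "\<dots> = (\<Sum>g\<in>UNIV. \<Sum>d\<in>idxs n. if d = actD g e then F e / 4 else 0)"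
  proof -
    have "e = actD g d \<longleftrightarrow> d = actD g e" for g d by auto
    then show ?thesis by (subst sum.swap) (simp only:)
  qed
  also have "\<dots> = (\<Sum>g\<in>(UNIV::gal set). if e \<in> idxs n then F e / 4 else 0)"
    by (simp add: sum.delta)
  also have "\<dots> = F e"
  proof -
    have "card (UNIV :: gal set) = 4" by (simp add: UNIV_gal)
    then show ?thesis using formQ_supp[OF assms, of e] by simp
  qed
  finally show "F e = (\<Sum>p\<in>idxs n \<times> {..<4}. of_rat (q_coord (snd p) (F (fst p)) / 4) * orb (fst p) (snd p) e)" ..
qed

lemma fin_dim_Aalg: "vectorspace.fin_dim kQ (Aalg n)"
proof -
  interpret V: vectorspace kQ "Aalg n" by (rule vectorspace_Aalg)
  let ?S = "(\<lambda>p. eF n (orb (fst p) (snd p))) ` (idxs n \<times> {..<4})"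
  have S: "?S \<subseteq> carrier (Aalg n)" by (auto simp: carrier_Aalg orb_formQ)
  have sub: "submodule kQ (V.span ?S) (Aalg n)" by (rule V.span_is_submodule[OF S])
  have summand: "(\<lambda>e. of_rat r * orb d i e) \<in> formQ n" if "d \<in> idxs n" for r d i
    by (intro formQ_smult orb_formQ that)
  have "eF n (\<lambda>e. \<Sum>p\<in>T. of_rat (r p) * orb (fst p) (snd p) e) \<in> V.span ?S"
    if "finite T" "T \<subseteq> idxs n \<times> {..<4}" for T and r :: "idx \<times> nat \<Rightarrow> rat"
    using that
  proof (induction T)
    case empty
    have "V.lincomb (\<lambda>_. 0) {} \<in> V.span ?S" unfolding V.span_def by blast
    then have "\<zero>\<^bsub>Aalg n\<^esub> \<in> V.span ?S" by (simp add: V.lincomb_def)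
    then show ?case by (simp add: one_zero_Aalg)
  next
    case (insert p T)
    obtain d i where p: "p = (d, i)" "d \<in> idxs n" "i < 4" using insert.prems by auto
    have "eF n (orb d i) \<in> V.span ?S"
      by (rule subsetD[OF V.in_own_span[OF S]]) (use p in force)
    then have "of_rat (r p) \<odot>\<^bsub>Aalg n\<^esub> eF n (orb d i) \<in> V.span ?S"
      by (intro submodule.smult_closed[OF sub]) auto
    then have "eF n (\<lambda>e. of_rat (r p) * orb d i e) \<oplus>\<^bsub>Aalg n\<^esub> eF n (\<lambda>e. \<Sum>p\<in>T. of_rat (r p) * orb (fst p) (snd p) e) \<in> V.span ?S"
      using insert.IH insert.prems p by (intro submodule.m_closed[OF sub]) (auto simp: smult_Aalg orb_formQ)
    also have "eF n (\<lambda>e. of_rat (r p) * orb d i e) \<oplus>\<^bsub>Aalg n\<^esub> eF n (\<lambda>e. \<Sum>p\<in>T. of_rat (r p) * orb (fst p) (snd p) e) =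
      eF n (\<lambda>e. \<Sum>p\<in>insert p T. of_rat (r p) * orb (fst p) (snd p) e)"
      using insert p by (subst ops_Aalg) (auto intro!: formQ_sum summand)
    finally show ?case .
  qed
  then have "eF n F \<in> V.span ?S" if "F \<in> formQ n" for F
    by (subst formQ_orb[OF that]) (simp only: finite_idxs finite_lessThan finite_cartesian_product subset_refl)
  then have "carrier (Aalg n) \<subseteq> V.span ?S" by (auto simp: carrier_Aalg)
  moreover have "V.span ?S \<subseteq> carrier (Aalg n)" using V.span_is_subset2[OF S] .
  ultimately show ?thesis unfolding V.fin_dim_def
    by (intro exI[of _ ?S]) (use S in auto)
qed

lemma exists_basis: "\<exists>B. finite B \<and> vectorspace.basis kQ (Aalg n) B"
  by (rule vectorspace.finite_basis_exists[OF vectorspace_Aalg fin_dim_Aalg])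

locale rat_form =
  fixes n :: nat and B :: "(nat \<Rightarrow> complex) set"
  assumes n3: "n \<ge> 3" and finB [simp]: "finite B" and basis: "vectorspace.basis kQ (Aalg n) B"
begin

definition xF :: "(nat \<Rightarrow> complex) \<Rightarrow> idx \<Rightarrow> quad" where "xF x = dF n x"

lemma B_carrier: "B \<subseteq> carrier (Aalg n)"
  using basis unfolding vectorspace.basis_def[OF vectorspace_Aalg] by (elim conjE)

lemma assumes "x \<in> B" shows xF_formQ: "xF x \<in> formQ n" and eF_xF: "eF n (xF x) = x"
proof -
  have "x \<in> eF n ` formQ n" using subsetD[OF B_carrier assms] by (simp only: carrier_Aalg)
  then obtain F where "F \<in> formQ n" "x = eF n F" by (elim imageE)
  then show "xF x \<in> formQ n" "eF n (xF x) = x" by (simp_all add: xF_def)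
qed

lemma lin_B:
  assumes "c \<in> B \<rightarrow> \<rat>"
  shows "(\<Oplus>\<^bsub>Aalg n\<^esub>x\<in>B. c x \<odot>\<^bsub>Aalg n\<^esub> x) = eF n (\<lambda>d. \<Sum>x\<in>B. of_rat (ratq (c x)) * xF x d)"
proof -
  interpret cring "Aalg n" by (rule cring_Aalg)
  have e: "c x \<odot>\<^bsub>Aalg n\<^esub> x = eF n (\<lambda>d. of_rat (ratq (c x)) * xF x d)" if "x \<in> B" for x
  proof -
    have "c x \<in> \<rat>" using assms that by blast
    then show ?thesis
      using smult_Aalg[OF xF_formQ[OF that], of "ratq (c x)"] by (simp only: eF_xF[OF that] of_rat_ratq)
  qed
  have "(\<Oplus>\<^bsub>Aalg n\<^esub>x\<in>B. c x \<odot>\<^bsub>Aalg n\<^esub> x) = (\<Oplus>\<^bsub>Aalg n\<^esub>x\<in>B. eF n (\<lambda>d. of_rat (ratq (c x)) * xF x d))"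
    by (rule finsum_cong') (auto simp: e carrier_Aalg formQ_smult xF_formQ)
  also have "\<dots> = eF n (\<lambda>d. \<Sum>x\<in>B. of_rat (ratq (c x)) * xF x d)"
    by (rule finsum_Aalg) (auto simp: formQ_smult xF_formQ)
  finally show ?thesis .
qed

lemma ex1_coords:
  assumes v: "v \<in> carrier (Aalg n)"
  shows "\<exists>!c. c \<in> B \<rightarrow>\<^sub>E \<rat> \<and> v = (\<Oplus>\<^bsub>Aalg n\<^esub>x\<in>B. c x \<odot>\<^bsub>Aalg n\<^esub> x)"
proof -
  have "\<exists>!a. a \<in> B \<rightarrow>\<^sub>E carrier kQ \<and> module.lincomb (Aalg n) a B = v"
    by (rule mp[OF spec[OF iffD1[OF vectorspace.basis_criterion[OF vectorspace_Aalg finB B_carrier] basis]] v])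
  then have "\<exists>!a. a \<in> B \<rightarrow>\<^sub>E \<rat> \<and> (\<Oplus>\<^bsub>Aalg n\<^esub>x\<in>B. a x \<odot>\<^bsub>Aalg n\<^esub> x) = v"
    unfolding module.lincomb_def[OF algebra.module[OF algebra_Aalg]] kQ_simps(1) .
  moreover have "(\<lambda>a. a \<in> B \<rightarrow>\<^sub>E \<rat> \<and> (\<Oplus>\<^bsub>Aalg n\<^esub>x\<in>B. a x \<odot>\<^bsub>Aalg n\<^esub> x) = v) =
    (\<lambda>a. a \<in> B \<rightarrow>\<^sub>E \<rat> \<and> v = (\<Oplus>\<^bsub>Aalg n\<^esub>x\<in>B. a x \<odot>\<^bsub>Aalg n\<^esub> x))"
    by (rule ext) (rule conj_cong[OF refl eq_commute])
  ultimately show ?thesis by (simp only:)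
qed

definition rc :: "(idx \<Rightarrow> quad) \<Rightarrow> (nat \<Rightarrow> complex) \<Rightarrow> rat" where
  "rc F x = ratq (coords kQ (Aalg n) B (eF n F) x)"

lemma coords_mem:
  assumes "F \<in> formQ n"
  shows "coords kQ (Aalg n) B (eF n F) \<in> B \<rightarrow>\<^sub>E \<rat>"
    "eF n F = (\<Oplus>\<^bsub>Aalg n\<^esub>x\<in>B. coords kQ (Aalg n) B (eF n F) x \<odot>\<^bsub>Aalg n\<^esub> x)"
proof -
  have "eF n F \<in> carrier (Aalg n)" using assms by (simp add: carrier_Aalg)
  from theI'[OF ex1_coords[OF this]]
  show "coords kQ (Aalg n) B (eF n F) \<in> B \<rightarrow>\<^sub>E \<rat>"
    "eF n F = (\<Oplus>\<^bsub>Aalg n\<^esub>x\<in>B. coords kQ (Aalg n) B (eF n F) x \<odot>\<^bsub>Aalg n\<^esub> x)"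
    by (simp_all add: coords_def)
qed

lemma coords_rc: "F \<in> formQ n \<Longrightarrow> x \<in> B \<Longrightarrow> coords kQ (Aalg n) B (eF n F) x = of_rat (rc F x)"
  using coords_mem(1)[of F] by (auto simp: rc_def of_rat_ratq PiE_iff)

lemma rc_expand: assumes "F \<in> formQ n" shows "F = (\<lambda>d. \<Sum>x\<in>B. of_rat (rc F x) * xF x d)"
proof -
  have "eF n F = eF n (\<lambda>d. \<Sum>x\<in>B. of_rat (rc F x) * xF x d)"
  proof -
    have "coords kQ (Aalg n) B (eF n F) \<in> B \<rightarrow> \<rat>" using coords_mem(1)[OF assms] by (simp add: PiE_iff)
    from lin_B[OF this] show ?thesis unfolding rc_def using coords_mem(2)[OF assms] by simp
  qed
  then show ?thesis using assms by (subst (asm) eF_eq_iff) (auto intro!: formQ_sum formQ_smult xF_formQ)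
qed

lemma rat_indep:
  assumes "\<And>d. (\<Sum>x\<in>B. of_rat (r x) * xF x d) = 0" "x \<in> B" shows "r x = 0"
proof -
  have "\<zero>\<^bsub>Aalg n\<^esub> \<in> carrier (Aalg n)" by (simp add: one_zero_Aalg carrier_Aalg formQ_zero)
  note ex1 = ex1_coords[OF this]
  let ?c = "\<lambda>x\<in>B. of_rat (r x) :: complex" let ?z = "\<lambda>x\<in>B. 0 :: complex"
  have "?c \<in> B \<rightarrow>\<^sub>E \<rat> \<and> \<zero>\<^bsub>Aalg n\<^esub> = (\<Oplus>\<^bsub>Aalg n\<^esub>x\<in>B. ?c x \<odot>\<^bsub>Aalg n\<^esub> x)"
    using assms(1) by (subst lin_B) (auto simp: one_zero_Aalg)
  moreover have "?z \<in> B \<rightarrow>\<^sub>E \<rat> \<and> \<zero>\<^bsub>Aalg n\<^esub> = (\<Oplus>\<^bsub>Aalg n\<^esub>x\<in>B. ?z x \<odot>\<^bsub>Aalg n\<^esub> x)"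
    using ratq_of_rat[of 0] by (subst lin_B) (auto simp: one_zero_Aalg)
  ultimately have "?c = ?z" using ex1 by blast
  from fun_cong[OF this, of x] assms(2) show ?thesis by simp
qed

text \<open>Rational independence implies independence over L. The coordinates of the coefficients
  give four equivariant functions w; conjugating the relation between them gives the system of
  \<open>q_system\<close>, so each w is zero and rational independence applies to it.\<close>

lemma quad_indep:
  assumes "\<And>d. (\<Sum>x\<in>B. l x * xF x d) = 0" "x \<in> B" shows "l x = 0"
proof -
  define w where "w i d = (\<Sum>x\<in>B. of_rat (q_coord i (l x)) * xF x d)" for i d
  have w: "w i \<in> formQ n" for i
    unfolding w_def by (intro formQ_sum formQ_smult xF_formQ)
  have e: "(\<Sum>i<4. q_unit i * w i d) = 0" for d
  proof -
    have "(\<Sum>i<4. q_unit i * w i d) = (\<Sum>x\<in>B. (\<Sum>i<4. of_rat (q_coord i (l x)) * q_unit i) * xF x d)"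
      unfolding w_def sum_distrib_left sum_distrib_right by (subst sum.swap) (simp add: ac_simps)
    then show ?thesis by (simp add: q_expand assms(1))
  qed
  have "w i d = 0" if "i < 4" for i d
  proof (rule q_system[OF _ that])
    fix g
    have "cj g (\<Sum>i<4. q_unit i * w i (actD g d)) = 0" by (simp only: e cj_hom)
    then show "(\<Sum>i<4. cj g (q_unit i) * w i d) = 0"
      by (simp add: cj_sum formQ_equiv[OF w])
  qed
  then have "q_coord i (l x) = 0" if "i < 4" for i
    using rat_indep[of "\<lambda>x. q_coord i (l x)" x] assms(2) that by (simp add: w_def)
  then have "q_coord 0 (l x) = 0" "q_coord 1 (l x) = 0" "q_coord 2 (l x) = 0" "q_coord 3 (l x) = 0" by auto
  then show ?thesis by (intro quad_eqI) (simp_all add: q_coord_def)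
qed

text \<open>The coordinates over L of the split basis vector d in the rational basis B, taken from
  \<open>dl_orb\<close>. As a matrix it is the inverse of \<open>xF\<close>.\<close>

definition cf :: "idx \<Rightarrow> (nat \<Rightarrow> complex) \<Rightarrow> quad" where
  "cf d x = (\<Sum>i<4. q_dual i * of_rat (rc (orb d i) x))"

lemma dl_cf: assumes "d \<in> idxs n" shows "dl d e = (\<Sum>x\<in>B. cf d x * xF x e)"
proof -
  have "dl d e = (\<Sum>i<4. q_dual i * (\<Sum>x\<in>B. of_rat (rc (orb d i) x) * xF x e))"
  proof -
    have "orb d i e = (\<Sum>x\<in>B. of_rat (rc (orb d i) x) * xF x e)" for i
      by (rule fun_cong[OF rc_expand[OF orb_formQ[OF assms]]])
    then show ?thesis unfolding dl_orb by simp
  qed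
  also have "\<dots> = (\<Sum>x\<in>B. cf d x * xF x e)"
    unfolding cf_def sum_distrib_left sum_distrib_right by (subst sum.swap) (simp add: ac_simps)
  finally show ?thesis .
qed

lemma xF_cf: assumes "x \<in> B" "y \<in> B" shows "(\<Sum>d\<in>idxs n. xF x d * cf d y) = (if x = y then 1 else 0)"
proof -
  let ?l = "\<lambda>y. (\<Sum>d\<in>idxs n. xF x d * cf d y) - (if x = y then 1 else 0)"
  have "(\<Sum>y\<in>B. ?l y * xF y e) = 0" for e
  proof -
    have "(\<Sum>y\<in>B. (\<Sum>d\<in>idxs n. xF x d * cf d y) * xF y e) = (\<Sum>d\<in>idxs n. xF x d * (\<Sum>y\<in>B. cf d y * xF y e))"
      unfolding sum_distrib_left sum_distrib_right by (subst sum.swap) (simp add: ac_simps)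
    also have "\<dots> = (\<Sum>d\<in>idxs n. xF x d * dl d e)" by (simp add: dl_cf)
    also have "\<dots> = xF x e"
      using formQ_supp[OF xF_formQ[OF assms(1)], of e] by (simp add: dl_def if_distrib cong: if_cong)
    finally show ?thesis using assms(1)
      by (simp add: left_diff_distrib sum_subtractf if_distrib[of "\<lambda>t. t * _"] cong: if_cong)
  qed
  from quad_indep[OF this assms(2)] show ?thesis by simp
qed

lemma cf_act: assumes "d \<in> idxs n" "x \<in> B" shows "cf (actD g d) x = cj g (cf d x)"
proof -
  have "(\<Sum>x\<in>B. (cf (actD g d) x - cj g (cf d x)) * xF x e) = 0" for e
  proof -
    have "cj g (\<Sum>x\<in>B. cf d x * xF x (actD g e)) = cj g (dl d (actD g e))" by (simp add: dl_cf[OF assms(1)])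
    then have "(\<Sum>x\<in>B. cj g (cf d x) * xF x e) = cj g (dl d (actD g e))"
      by (simp add: cj_sum formQ_equiv[OF xF_formQ])
    moreover have "cj g (dl d (actD g e)) = dl (actD g d) e"
      by (auto simp: dl_def)
    moreover have "(\<Sum>x\<in>B. cf (actD g d) x * xF x e) = dl (actD g d) e"
      by (rule dl_cf[symmetric]) (simp add: assms)
    ultimately show ?thesis by (simp add: left_diff_distrib sum_subtractf)
  qed
  from quad_indep[OF this assms(2)] show ?thesis by simp
qed

end

section \<open>The Jacobson radical\<close>

text \<open>The ideal P is stable under scalars, since c p is the product of p with the multiple c
  of 1. Adding P matters for c = 0, where the scaled coset would be the single point 0.\<close>

lemma quotient_smult:
  assumes "algebra k A" "ideal P A" "c \<in> carrier k" "v \<in> carrier A"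
  shows "P <+>\<^bsub>A\<^esub> ((\<lambda>v. c \<odot>\<^bsub>A\<^esub> v) ` (P +>\<^bsub>A\<^esub> v)) = P +>\<^bsub>A\<^esub> (c \<odot>\<^bsub>A\<^esub> v)"
proof -
  interpret algebra k A by fact
  interpret P: ideal P A by fact
  have Psmult: "c \<odot>\<^bsub>A\<^esub> p \<in> P" if "p \<in> P" for p
  proof -
    have "(c \<odot>\<^bsub>A\<^esub> \<one>\<^bsub>A\<^esub>) \<otimes>\<^bsub>A\<^esub> p \<in> P" using that assms(3) by (intro P.I_l_closed) auto
    then show ?thesis using that assms(3) by (simp add: smult_assoc2)
  qed
  show ?thesis
  proof (intro equalityI subsetI)
    fix x assume "x \<in> P <+>\<^bsub>A\<^esub> ((\<lambda>v. c \<odot>\<^bsub>A\<^esub> v) ` (P +>\<^bsub>A\<^esub> v))"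
    then obtain p p' where p: "p \<in> P" "p' \<in> P" "x = p \<oplus>\<^bsub>A\<^esub> c \<odot>\<^bsub>A\<^esub> (p' \<oplus>\<^bsub>A\<^esub> v)"
      by (auto simp: set_add_def' a_r_coset_def')
    then have "x = (p \<oplus>\<^bsub>A\<^esub> c \<odot>\<^bsub>A\<^esub> p') \<oplus>\<^bsub>A\<^esub> c \<odot>\<^bsub>A\<^esub> v"
      using assms(3,4) by (simp add: smult_r_distr M.a_assoc)
    moreover have "p \<oplus>\<^bsub>A\<^esub> c \<odot>\<^bsub>A\<^esub> p' \<in> P" using p Psmult by (intro P.a_closed)
    ultimately show "x \<in> P +>\<^bsub>A\<^esub> (c \<odot>\<^bsub>A\<^esub> v)" by (auto simp: a_r_coset_def')
  next
    fix x assume "x \<in> P +>\<^bsub>A\<^esub> (c \<odot>\<^bsub>A\<^esub> v)"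
    then obtain p where p: "p \<in> P" "x = p \<oplus>\<^bsub>A\<^esub> c \<odot>\<^bsub>A\<^esub> (\<zero>\<^bsub>A\<^esub> \<oplus>\<^bsub>A\<^esub> v)"
      using assms(4) by (auto simp: a_r_coset_def')
    moreover have "\<zero>\<^bsub>A\<^esub> \<in> P" by (rule P.zero_closed)
    ultimately show "x \<in> P <+>\<^bsub>A\<^esub> ((\<lambda>v. c \<odot>\<^bsub>A\<^esub> v) ` (P +>\<^bsub>A\<^esub> v))"
      unfolding set_add_def' a_r_coset_def' by blast
  qed
qed

lemma quotient_module_simps:
  "carrier (quotient_module A J P) = (\<lambda>v. P +>\<^bsub>A\<^esub> v) ` J"
  "\<zero>\<^bsub>quotient_module A J P\<^esub> = P"
  "C \<oplus>\<^bsub>quotient_module A J P\<^esub> D = C <+>\<^bsub>A\<^esub> D"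
  "c \<odot>\<^bsub>quotient_module A J P\<^esub> C = P <+>\<^bsub>A\<^esub> ((\<lambda>v. c \<odot>\<^bsub>A\<^esub> v) ` C)"
  by (simp_all add: quotient_module_def)

lemma vectorspace_quotient_module:
  assumes "algebra k A" "field k" "ideal J A" "ideal P A"
  shows "vectorspace k (quotient_module A J P)"
proof -
  interpret algebra k A by fact
  interpret P: ideal P A by fact
  interpret J: ideal J A by fact
  let ?Q = "quotient_module A J P"
  have J: "v \<in> carrier A" if "v \<in> J" for v using that by (rule J.Icarr)
  have Jsmult: "c \<odot>\<^bsub>A\<^esub> v \<in> J" if "c \<in> carrier k" "v \<in> J" for c v
  proof -
    have "(c \<odot>\<^bsub>A\<^esub> \<one>\<^bsub>A\<^esub>) \<otimes>\<^bsub>A\<^esub> v \<in> J" using that by (intro J.I_l_closed) auto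
    then show ?thesis using that J by (simp add: smult_assoc2)
  qed
  have zero: "P = P +>\<^bsub>A\<^esub> \<zero>\<^bsub>A\<^esub>" using M.a_coset_add_zero[of P] P.a_subset by simp
  have ab: "abelian_group ?Q"
  proof (rule abelian_groupI)
    show "\<zero>\<^bsub>?Q\<^esub> \<in> carrier ?Q"
      unfolding quotient_module_simps using zero J.zero_closed by (rule image_eqI)
    fix x y z assume "x \<in> carrier ?Q" "y \<in> carrier ?Q" "z \<in> carrier ?Q"
    then obtain a b c where abc: "x = P +>\<^bsub>A\<^esub> a" "y = P +>\<^bsub>A\<^esub> b" "z = P +>\<^bsub>A\<^esub> c" "a \<in> J" "b \<in> J" "c \<in> J"
      unfolding quotient_module_simps by blast
    show "x \<oplus>\<^bsub>?Q\<^esub> y \<in> carrier ?Q"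
      unfolding quotient_module_simps abc using abc J by (auto simp: P.a_rcos_sum)
    show "x \<oplus>\<^bsub>?Q\<^esub> y \<oplus>\<^bsub>?Q\<^esub> z = x \<oplus>\<^bsub>?Q\<^esub> (y \<oplus>\<^bsub>?Q\<^esub> z)"
      unfolding quotient_module_simps abc using abc J by (simp add: P.a_rcos_sum M.a_assoc)
    show "x \<oplus>\<^bsub>?Q\<^esub> y = y \<oplus>\<^bsub>?Q\<^esub> x"
      unfolding quotient_module_simps abc using abc J by (simp add: P.a_rcos_sum M.a_comm)
    have "\<zero>\<^bsub>?Q\<^esub> \<oplus>\<^bsub>?Q\<^esub> x = (P +>\<^bsub>A\<^esub> \<zero>\<^bsub>A\<^esub>) <+>\<^bsub>A\<^esub> x"
      unfolding quotient_module_simps using zero by simp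
    also have "\<dots> = x" using abc J by (simp add: P.a_rcos_sum)
    finally show "\<zero>\<^bsub>?Q\<^esub> \<oplus>\<^bsub>?Q\<^esub> x = x" .
    have "(P +>\<^bsub>A\<^esub> (\<ominus>\<^bsub>A\<^esub> a)) \<oplus>\<^bsub>?Q\<^esub> x = P +>\<^bsub>A\<^esub> \<zero>\<^bsub>A\<^esub>"
      unfolding quotient_module_simps abc using abc J by (simp add: P.a_rcos_sum M.l_neg)
    then have "(P +>\<^bsub>A\<^esub> (\<ominus>\<^bsub>A\<^esub> a)) \<oplus>\<^bsub>?Q\<^esub> x = \<zero>\<^bsub>?Q\<^esub>"
      unfolding quotient_module_simps using zero by simp
    moreover have "P +>\<^bsub>A\<^esub> (\<ominus>\<^bsub>A\<^esub> a) \<in> carrier ?Q"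
      unfolding quotient_module_simps using abc J.a_inv_closed by blast
    ultimately show "\<exists>y\<in>carrier ?Q. y \<oplus>\<^bsub>?Q\<^esub> x = \<zero>\<^bsub>?Q\<^esub>" by blast
  qed
  have sm: "c \<odot>\<^bsub>?Q\<^esub> (P +>\<^bsub>A\<^esub> v) = P +>\<^bsub>A\<^esub> (c \<odot>\<^bsub>A\<^esub> v)" if "c \<in> carrier k" "v \<in> carrier A" for c v
    unfolding quotient_module_simps using quotient_smult[OF assms(1,4) that] .
  have ad: "(P +>\<^bsub>A\<^esub> v) \<oplus>\<^bsub>?Q\<^esub> (P +>\<^bsub>A\<^esub> w) = P +>\<^bsub>A\<^esub> (v \<oplus>\<^bsub>A\<^esub> w)" if "v \<in> carrier A" "w \<in> carrier A" for v w
    unfolding quotient_module_simps using P.a_rcos_sum that .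
  have "module k ?Q"
  proof (rule moduleI[OF R_cring ab])
    fix c d x y assume cd: "c \<in> carrier k" "d \<in> carrier k" and xy: "x \<in> carrier ?Q" "y \<in> carrier ?Q"
    obtain a b where abc: "x = P +>\<^bsub>A\<^esub> a" "y = P +>\<^bsub>A\<^esub> b" "a \<in> J" "b \<in> J"
      using xy unfolding quotient_module_simps by blast
    show "c \<odot>\<^bsub>?Q\<^esub> (x \<oplus>\<^bsub>?Q\<^esub> y) = c \<odot>\<^bsub>?Q\<^esub> x \<oplus>\<^bsub>?Q\<^esub> c \<odot>\<^bsub>?Q\<^esub> y"
      using cd J abc(3,4) by (simp add: abc(1,2) ad sm smult_r_distr)
  next
    fix c d x assume cd: "c \<in> carrier k" "d \<in> carrier k" and x: "x \<in> carrier ?Q"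
    obtain a where abc: "x = P +>\<^bsub>A\<^esub> a" "a \<in> J" using x unfolding quotient_module_simps by blast
    show "(c \<oplus>\<^bsub>k\<^esub> d) \<odot>\<^bsub>?Q\<^esub> x = c \<odot>\<^bsub>?Q\<^esub> x \<oplus>\<^bsub>?Q\<^esub> d \<odot>\<^bsub>?Q\<^esub> x"
      using cd J abc(2) by (simp add: abc(1) ad sm smult_l_distr)
    show "(c \<otimes>\<^bsub>k\<^esub> d) \<odot>\<^bsub>?Q\<^esub> x = c \<odot>\<^bsub>?Q\<^esub> (d \<odot>\<^bsub>?Q\<^esub> x)"
      using cd J abc(2) by (simp add: abc(1) sm smult_assoc1)
  next
    fix c x assume cd: "c \<in> carrier k" and x: "x \<in> carrier ?Q"
    obtain a where abc: "x = P +>\<^bsub>A\<^esub> a" "a \<in> J" using x unfolding quotient_module_simps by blast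
    have "c \<odot>\<^bsub>?Q\<^esub> x = P +>\<^bsub>A\<^esub> (c \<odot>\<^bsub>A\<^esub> a)" using cd J abc(2) by (simp add: abc(1) sm)
    then show "c \<odot>\<^bsub>?Q\<^esub> x \<in> carrier ?Q" unfolding quotient_module_simps(1) using Jsmult[OF cd abc(2)] by (rule image_eqI)
  next
    fix x assume x: "x \<in> carrier ?Q"
    obtain a where abc: "x = P +>\<^bsub>A\<^esub> a" "a \<in> J" using x unfolding quotient_module_simps by blast
    show "\<one>\<^bsub>k\<^esub> \<odot>\<^bsub>?Q\<^esub> x = x" using J abc(2) by (simp add: abc(1) sm)
  qed
  then show ?thesis using assms(2) by (intro vectorspace.intro)
qed

definition Jset :: "nat \<Rightarrow> (nat \<Rightarrow> complex) set" where
  "Jset n = eF n ` {F \<in> formQ n. F One = 0}"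

lemma formQ_One_rat: assumes "F \<in> formQ n" shows "\<exists>r. F One = of_rat r"
proof -
  have "\<forall>g. cj g (F One) = F One" using formQ_equiv[OF assms, of _ One] by simp
  then show ?thesis by (rule iffD1[OF cj_fixed_iff])
qed

text \<open>With F = r + m the constant r is rational, being fixed by all conjugations, and m^3 = 0.
  The inverse is the truncated geometric series 1/r - m/r^2 + m^2/r^3.\<close>

lemma unit_formQ:
  assumes F: "F \<in> formQ n" "F One \<noteq> 0"
  shows "\<exists>H\<in>formQ n. mul n F H = dl One"
proof -
  obtain r where r: "F One = of_rat r" using formQ_One_rat[OF F(1)] by blast
  then have rnz: "r \<noteq> 0" using F(2) by auto
  define m where "m = (\<lambda>d. F d + of_rat (- r) * dl One d)"
  define s where "s = inverse r"
  define H where "H = (\<lambda>d. of_rat s * dl One d + (of_rat (- (s * s)) * m d + of_rat (s * s * s) * mul n m m d))"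
  have m: "m \<in> formQ n" unfolding m_def by (intro formQ_add F formQ_smult formQ_one)
  have H: "H \<in> formQ n" unfolding H_def by (intro formQ_add formQ_smult formQ_one formQ_mul m)
  let ?s = "inverse (of_rat r) :: quad"
  have s: "of_rat r * ?s = 1" using rnz by simp
  have mv: "m One = 0" "m (Gen a) = F (Gen a)" "m (Prd S) = F (Prd S)" for a S
    by (simp_all add: m_def dl_def r of_rat_minus)
  have Hv: "H One = ?s" "H (Gen a) = - (?s^2) * F (Gen a)"
    "H (Prd S) = - (?s^2) * F (Prd S) + ?s^3 * (\<Sum>(a, b)\<in>prs n S. F (Gen a) * F (Gen b))" for a S
    by (simp_all add: H_def dl_def mv mul_Prd of_rat_minus of_rat_inverse of_rat_mult s_def power2_eq_square power3_eq_cube)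
  have "mul n F H = dl One"
  proof
    fix d show "mul n F H d = dl One d"
    proof (cases d)
      case One
      then show ?thesis using s by (simp add: r Hv dl_def)
    next
      case (Gen a)
      have "of_rat r * (- (?s^2) * F (Gen a)) + F (Gen a) * ?s = (1 - of_rat r * ?s) * (?s * F (Gen a))"
        by (simp add: algebra_simps power2_eq_square)
      then show ?thesis using s by (simp add: Gen r Hv dl_def)
    next
      case (Prd S)
      let ?T = "\<Sum>(a, b)\<in>prs n S. F (Gen a) * F (Gen b)"
      have "(\<Sum>(a, b)\<in>prs n S. F (Gen a) * H (Gen b)) = - (?s^2) * ?T"
        unfolding Hv sum_distrib_left by (rule sum.cong) (auto simp: algebra_simps)
      then have "mul n F H d = of_rat r * (- (?s^2) * F (Prd S) + ?s^3 * ?T) + F (Prd S) * ?s + - (?s^2) * ?T"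
        by (simp only: Prd mul_Prd Hv r)
      also have "\<dots> = (1 - of_rat r * ?s) * (?s * F (Prd S)) - (1 - of_rat r * ?s) * (?s^2 * ?T)"
        by (simp add: algebra_simps power2_eq_square power3_eq_cube)
      finally show ?thesis using s by (simp add: Prd dl_def)
    qed
  qed
  with H show ?thesis by blast
qed

lemma ideal_Jset: "ideal (Jset n) (Aalg n)"
proof (rule idealI)
  interpret cring "Aalg n" by (rule cring_Aalg)
  show "ring (Aalg n)" by (rule ring_axioms)
  show "subgroup (Jset n) (add_monoid (Aalg n))"
  proof (rule group.subgroupI[OF a_group])
    show "Jset n \<subseteq> carrier (add_monoid (Aalg n))" by (auto simp: Jset_def carrier_Aalg)
    show "Jset n \<noteq> {}" unfolding Jset_def using formQ_zero by force
    fix a assume "a \<in> Jset n"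
    then obtain F where F: "F \<in> formQ n" "F One = 0" "a = eF n F" by (auto simp: Jset_def)
    then have "\<ominus>\<^bsub>Aalg n\<^esub> a = eF n (\<lambda>d. - F d)"
      by (intro minus_equality) (auto simp: ops_Aalg formQ_minus one_zero_Aalg carrier_Aalg)
    moreover have "eF n (\<lambda>d. - F d) \<in> Jset n" unfolding Jset_def using F by (intro imageI) (simp add: formQ_minus)
    ultimately show "inv\<^bsub>add_monoid (Aalg n)\<^esub> a \<in> Jset n" by (simp add: a_inv_def)
    fix b assume "b \<in> Jset n"
    then obtain H where H: "H \<in> formQ n" "H One = 0" "b = eF n H" by (auto simp: Jset_def)
    have "eF n (\<lambda>d. F d + H d) \<in> Jset n" unfolding Jset_def using F H by (intro imageI) (simp add: formQ_add)
    then show "a \<otimes>\<^bsub>add_monoid (Aalg n)\<^esub> b \<in> Jset n" using F H by (simp add: ops_Aalg)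
  qed
  fix a x assume "a \<in> Jset n" "x \<in> carrier (Aalg n)"
  then obtain F H where F: "F \<in> formQ n" "F One = 0" "a = eF n F" and H: "H \<in> formQ n" "x = eF n H"
    by (auto simp: Jset_def carrier_Aalg)
  have "eF n (mul n F H) \<in> Jset n" unfolding Jset_def using F H by (intro imageI) (simp add: formQ_mul)
  then show ax: "a \<otimes>\<^bsub>Aalg n\<^esub> x \<in> Jset n" using F H by (simp add: ops_Aalg)
  have "x \<otimes>\<^bsub>Aalg n\<^esub> a = a \<otimes>\<^bsub>Aalg n\<^esub> x"
    using F H by (simp add: ops_Aalg mul_comm[of n F H])
  then show "x \<otimes>\<^bsub>Aalg n\<^esub> a \<in> Jset n" using ax by simp
qed

text \<open>The algebra is local: everything outside \<open>Jset\<close> is invertible by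
  \<open>unit_formQ\<close>.\<close>

lemma proper_ideal_Aalg:
  assumes I: "ideal I (Aalg n)" "I \<noteq> carrier (Aalg n)"
  shows "I \<subseteq> Jset n"
proof
  interpret I: ideal I "Aalg n" by fact
  fix x assume x: "x \<in> I"
  then obtain F where F: "F \<in> formQ n" "x = eF n F" using I.Icarr by (auto simp: carrier_Aalg)
  have "F One = 0"
  proof (rule ccontr)
    assume "F One \<noteq> 0"
    then obtain H where H: "H \<in> formQ n" "mul n F H = dl One" using unit_formQ F by blast
    have "x \<otimes>\<^bsub>Aalg n\<^esub> eF n H \<in> I" using x H by (intro I.I_r_closed) (auto simp: carrier_Aalg)
    moreover have "x \<otimes>\<^bsub>Aalg n\<^esub> eF n H = \<one>\<^bsub>Aalg n\<^esub>" using F H by (simp add: ops_Aalg one_zero_Aalg)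
    ultimately have "I = carrier (Aalg n)" using I.one_imp_carrier by simp
    with I(2) show False by simp
  qed
  then show "x \<in> Jset n" using F by (auto simp: Jset_def)
qed

lemma jacobson_radical_Aalg: "jacobson_radical (Aalg n) = Jset n"
proof -
  have proper: "Jset n \<noteq> carrier (Aalg n)"
  proof
    assume "Jset n = carrier (Aalg n)"
    then have "eF n (dl One) \<in> Jset n" by (simp add: carrier_Aalg formQ_one)
    then obtain F where "F \<in> formQ n" "F One = 0" "eF n (dl One) = eF n F" by (auto simp: Jset_def)
    then have "F = dl One" by (subst (asm) eF_eq_iff) (auto simp: formQ_one)
    then show False using \<open>F One = 0\<close> by (simp add: dl_def)
  qed
  have "maximalideal (Jset n) (Aalg n)"
  proof (rule maximalidealI[OF ideal_Jset])
    show "carrier (Aalg n) \<noteq> Jset n" using proper by simp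
    fix I assume "ideal I (Aalg n)" "Jset n \<subseteq> I" "I \<subseteq> carrier (Aalg n)"
    then show "I = Jset n \<or> I = carrier (Aalg n)" using proper_ideal_Aalg by blast
  qed
  moreover have "I = Jset n" if "maximalideal I (Aalg n)" for I
  proof -
    interpret maximalideal I "Aalg n" by fact
    have "I \<subseteq> Jset n" using proper_ideal_Aalg[OF is_ideal] I_notcarr by blast
    then have "Jset n = I \<or> Jset n = carrier (Aalg n)"
      by (intro I_maximal ideal_Jset) (auto simp: Jset_def carrier_Aalg)
    then show ?thesis using proper by simp
  qed
  ultimately have "{I. maximalideal I (Aalg n)} = {Jset n}" by blast
  then have "jacobson_radical (Aalg n) = carrier (Aalg n) \<inter> Jset n"
    unfolding jacobson_radical_def by (simp only: Inter_insert Inter_empty Int_UNIV_right)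
  also have "\<dots> = Jset n" by (auto simp: Jset_def carrier_Aalg)
  finally show ?thesis .
qed

section \<open>The dimension of J / J^2\<close>

lemma ideal_JJ: "ideal (Jset n \<cdot>\<^bsub>Aalg n\<^esub> Jset n) (Aalg n)"
proof -
  interpret cring "Aalg n" by (rule cring_Aalg)
  show ?thesis by (intro ideal_prod_is_ideal ideal_Jset)
qed

text \<open>Generator coordinates are therefore well defined modulo J^2, which is what a lower bound
  for the dimension of J / J^2 rests on.\<close>

lemma JJ_gens:
  assumes "x \<in> Jset n \<cdot>\<^bsub>Aalg n\<^esub> Jset n"
  shows "\<exists>F\<in>formQ n. x = eF n F \<and> (\<forall>a. F (Gen a) = 0)"
  using assms
proof (induction x rule: ideal_prod.induct)
  case (prod i j)
  then obtain F H where F: "F \<in> formQ n" "F One = 0" "i = eF n F" "H \<in> formQ n" "H One = 0" "j = eF n H"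
    by (auto simp: Jset_def)
  show ?case by (rule bexI[of _ "mul n F H"]) (use F in \<open>auto simp: ops_Aalg formQ_mul\<close>)
next
  case (sum s1 s2)
  then obtain F H where F: "F \<in> formQ n" "\<forall>a. F (Gen a) = 0" "s1 = eF n F" "H \<in> formQ n" "\<forall>a. H (Gen a) = 0" "s2 = eF n H"
    by blast
  show ?case by (rule bexI[of _ "\<lambda>d. F d + H d"]) (use F in \<open>auto simp: ops_Aalg formQ_add\<close>)
qed

text \<open>The indicator functions of the points of S are independent, so a family whose span
  contains them has at least as many members as S.\<close>

lemma spanning_functions_card:
  fixes v :: "'t \<Rightarrow> 'a \<Rightarrow> 'f::field"
  assumes "finite T" "finite S"
    and span: "\<And>a. a \<in> S \<Longrightarrow> \<exists>l. \<forall>b. (if b = a then 1 else 0) = (\<Sum>t\<in>T. l t * v t b)"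
  shows "card S \<le> card T"
proof -
  interpret fs: vector_space "\<lambda>c (f::'a \<Rightarrow> 'f) x. c * f x"
    by unfold_locales (auto simp: fun_eq_iff algebra_simps)
  let ?e = "\<lambda>a b. if b = a then 1 else (0::'f)"
  have sum_apply: "(\<Sum>x\<in>Z. h x) b = (\<Sum>x\<in>Z. h x b)" for h :: "'z \<Rightarrow> 'a \<Rightarrow> 'f" and Z b
    by (induction Z rule: infinite_finite_induct) auto
  have inj: "inj_on ?e S" by (rule inj_onI) (metis zero_neq_one)
  have indep: "fs.independent (?e ` S)"
  proof
    assume "fs.dependent (?e ` S)"
    then obtain t u w where t: "finite t" "t \<subseteq> ?e ` S" and z: "(\<Sum>f\<in>t. (\<lambda>x. u f * f x)) = 0"
      and w: "w \<in> t" "u w \<noteq> 0"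
      unfolding fs.dependent_explicit by blast
    obtain a where "w = ?e a" using w(1) t(2) by blast
    then have a: "?e a \<in> t" and nz: "u (?e a) \<noteq> 0" using w by simp_all
    have zero: "u f * f a = 0" if f: "f \<in> t" "f \<noteq> ?e a" for f
    proof -
      obtain a' where "f = ?e a'" using t f by blast
      moreover have "a' \<noteq> a" using f calculation by blast
      ultimately show ?thesis by simp
    qed
    have "0 = (\<Sum>f\<in>t. u f * f a)" using fun_cong[OF z, of a] by (simp add: sum_apply)
    also have "\<dots> = (\<Sum>f\<in>{?e a}. u f * f a)"
      by (rule sum.mono_neutral_right) (use t a zero in auto)
    finally have "u (?e a) = 0" by simp
    with nz show False by contradiction
  qed
  have "?e ` S \<subseteq> fs.span (v ` T)"
  proof (clarify)
    fix a assume "a \<in> S"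
    then obtain l where l: "?e a b = (\<Sum>t\<in>T. l t * v t b)" for b using span by blast
    have "?e a = (\<Sum>t\<in>T. (\<lambda>x. l t * v t x))" by (rule ext) (simp only: sum_apply l)
    also have "\<dots> \<in> fs.span (v ` T)" by (intro fs.span_sum fs.span_scale fs.span_base) auto
    finally show "?e a \<in> fs.span (v ` T)" .
  qed
  from fs.independent_span_bound[OF _ indep this] have "card (?e ` S) \<le> card (v ` T)" using assms(1) by simp
  also have "\<dots> \<le> card T" by (rule card_image_le[OF assms(1)])
  finally show ?thesis by (simp add: card_image[OF inj])
qed

context
  fixes n :: nat
  assumes n3: "n \<ge> 3"
begin

abbreviation (input) PP where "PP \<equiv> Jset n \<cdot>\<^bsub>Aalg n\<^esub> Jset n"
abbreviation (input) QQ where "QQ \<equiv> quotient_module (Aalg n) (Jset n) PP"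

definition qF :: "(idx \<Rightarrow> quad) \<Rightarrow> (nat \<Rightarrow> complex) set" where "qF F = PP +>\<^bsub>Aalg n\<^esub> eF n F"

lemma vectorspace_QQ: "vectorspace kQ QQ"
  by (rule vectorspace_quotient_module[OF algebra_Aalg field_kQ ideal_Jset ideal_JJ])

lemma carrier_QQ: "carrier QQ = qF ` {F \<in> formQ n. F One = 0}"
  by (simp add: quotient_module_simps Jset_def image_image qF_def)

lemma qF_ops:
  assumes "F \<in> formQ n" "H \<in> formQ n"
  shows "qF F \<oplus>\<^bsub>QQ\<^esub> qF H = qF (\<lambda>d. F d + H d)" "of_rat r \<odot>\<^bsub>QQ\<^esub> qF F = qF (\<lambda>d. of_rat r * F d)"
proof -
  interpret P: ideal PP "Aalg n" by (rule ideal_JJ)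
  have c: "eF n F \<in> carrier (Aalg n)" "eF n H \<in> carrier (Aalg n)" using assms by (auto simp: carrier_Aalg)
  show "qF F \<oplus>\<^bsub>QQ\<^esub> qF H = qF (\<lambda>d. F d + H d)"
    unfolding quotient_module_simps qF_def using P.a_rcos_sum[OF c] ops_Aalg(2)[OF assms] by simp
  show "of_rat r \<odot>\<^bsub>QQ\<^esub> qF F = qF (\<lambda>d. of_rat r * F d)"
    unfolding quotient_module_simps qF_def
    using quotient_smult[OF algebra_Aalg ideal_JJ _ c(1), of "of_rat r"] smult_Aalg[OF assms(1), of r] by simp
qed

lemma qF_zero: "\<zero>\<^bsub>QQ\<^esub> = qF (\<lambda>_. 0)"
proof -
  interpret P: ideal PP "Aalg n" by (rule ideal_JJ)
  show ?thesis unfolding quotient_module_simps qF_def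
    using P.a_coset_add_zero[of PP] P.a_subset by (simp add: one_zero_Aalg)
qed

lemma qF_eq_gens:
  assumes "F \<in> formQ n" "H \<in> formQ n" "qF F = qF H" shows "F (Gen a) = H (Gen a)"
proof -
  interpret P: ideal PP "Aalg n" by (rule ideal_JJ)
  have c: "eF n F \<in> carrier (Aalg n)" using assms by (auto simp: carrier_Aalg)
  have "\<zero>\<^bsub>Aalg n\<^esub> \<oplus>\<^bsub>Aalg n\<^esub> eF n F \<in> qF F" unfolding qF_def a_r_coset_def'
    by (rule UN_I[OF additive_subgroup.zero_closed[OF ideal.axioms(1)[OF ideal_JJ]]]) simp
  then have "eF n F \<in> qF H" using assms(3) c by simp
  then obtain p where p: "p \<in> PP" "eF n F = p \<oplus>\<^bsub>Aalg n\<^esub> eF n H"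
    unfolding qF_def a_r_coset_def' by (elim UN_E singletonE)
  obtain W where W: "W \<in> formQ n" "p = eF n W" "\<forall>a. W (Gen a) = 0" using JJ_gens[OF p(1)] by blast
  have "eF n F = eF n (\<lambda>d. W d + H d)" using p(2) W assms(2) by (simp add: ops_Aalg)
  then have "F = (\<lambda>d. W d + H d)" by (rule iffD1[OF eF_eq_iff[OF assms(1) formQ_add[OF W(1) assms(2)]]])
  from fun_cong[OF this, of "Gen a"] show ?thesis using W(3) by simp
qed

lemma qF_finsum:
  assumes "finite T" "\<And>t. t \<in> T \<Longrightarrow> F t \<in> formQ n \<and> F t One = 0"
  shows "finsum QQ (\<lambda>t. qF (F t)) T = qF (\<lambda>d. \<Sum>t\<in>T. F t d)"
proof -
  interpret Q: vectorspace kQ QQ by (rule vectorspace_QQ)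
  show ?thesis using assms
  proof (induction T)
    case empty
    then show ?case by (simp add: qF_zero)
  next
    case (insert t T)
    have c: "qF (F s) \<in> carrier QQ" if "s \<in> insert t T" for s
      unfolding carrier_QQ using insert.prems[OF that] by blast
    have "finsum QQ (\<lambda>t. qF (F t)) (insert t T) = qF (F t) \<oplus>\<^bsub>QQ\<^esub> finsum QQ (\<lambda>t. qF (F t)) T"
      using insert.hyps c by (intro Q.finsum_insert) auto
    also have "\<dots> = qF (\<lambda>d. F t d + (\<Sum>t\<in>T. F t d))"
      using insert by (simp add: qF_ops formQ_sum)
    finally show ?case using insert.hyps by simp
  qed
qed

text \<open>Modulo J^2 the elements \<open>orb (Gen a) i\<close> are rational combinations of T. By
  \<open>dl_orb\<close> the indicator functions of the 2n + 1 generators are then combinations over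
  L of the generator coordinates of the elements of T, and \<open>spanning_functions_card\<close>
  compares the numbers.\<close>

lemma gen_set_card:
  assumes T: "finite T" "T \<subseteq> carrier QQ" "module.span kQ QQ T = carrier QQ"
  shows "2 * n + 1 \<le> card T"
proof -
  interpret Q: vectorspace kQ QQ by (rule vectorspace_QQ)
  have "\<forall>t\<in>T. \<exists>F. F \<in> formQ n \<and> F One = 0 \<and> t = qF F" using T(2) unfolding carrier_QQ by blast
  then obtain f where f: "\<And>t. t \<in> T \<Longrightarrow> f t \<in> formQ n \<and> f t One = 0 \<and> t = qF (f t)" by metis
  have comb: "\<exists>r. \<forall>b. H (Gen b) = (\<Sum>t\<in>T. of_rat (r t) * f t (Gen b))" if H: "H \<in> formQ n" "H One = 0" for H
  proof -
    have "qF H \<in> Q.span T" unfolding T(3) carrier_QQ using H by blast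
    then obtain c U where U: "finite U" "U \<subseteq> T" "c \<in> U \<rightarrow> carrier kQ" "qF H = Q.lincomb c U"
      unfolding Q.span_def by blast
    define r where "r t = (if t \<in> U then ratq (c t) else 0)" for t
    have "Q.lincomb c U = (\<Oplus>\<^bsub>QQ\<^esub>t\<in>U. qF (\<lambda>d. of_rat (r t) * f t d))"
      unfolding Q.lincomb_def
    proof (rule Q.finsum_cong')
      fix t assume t: "t \<in> U"
      then have ft: "f t \<in> formQ n" "t = qF (f t)" "f t One = 0" using f U(2) by auto
      have "c t = of_rat (r t)" using t U(3) by (auto simp: r_def of_rat_ratq Pi_iff)
      then have "c t \<odot>\<^bsub>QQ\<^esub> t = of_rat (r t) \<odot>\<^bsub>QQ\<^esub> qF (f t)" using ft(2) by simp
      then show "c t \<odot>\<^bsub>QQ\<^esub> t = qF (\<lambda>d. of_rat (r t) * f t d)" by (simp only: qF_ops(2)[OF ft(1) ft(1)])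
    next
      show "(\<lambda>t. qF (\<lambda>d. of_rat (r t) * f t d)) \<in> U \<rightarrow> carrier QQ"
        unfolding carrier_QQ using f U(2) formQ_smult by fastforce
    qed simp
    also have "\<dots> = qF (\<lambda>d. \<Sum>t\<in>U. of_rat (r t) * f t d)"
      by (rule qF_finsum[OF U(1)]) (use f U(2) formQ_smult in auto)
    finally have "H (Gen b) = (\<Sum>t\<in>U. of_rat (r t) * f t (Gen b))" for b
      unfolding U(4)[symmetric] using U(2) f H
      by (intro qF_eq_gens[of H "\<lambda>d. \<Sum>t\<in>U. of_rat (r t) * f t d" b]) (auto intro!: formQ_sum formQ_smult)
    moreover have "(\<Sum>t\<in>U. of_rat (r t) * f t (Gen b)) = (\<Sum>t\<in>T. of_rat (r t) * f t (Gen b))" for b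
      by (rule sum.mono_neutral_left) (use T(1) U(2) in \<open>auto simp: r_def\<close>)
    ultimately show ?thesis by auto
  qed
  have "card (gens n) \<le> card T"
  proof (rule spanning_functions_card[OF T(1) finite_gens])
    fix a assume a: "a \<in> gens n"
    have o: "orb (Gen a) i \<in> formQ n" "orb (Gen a) i One = 0" for i
      using orb_formQ[of "Gen a" n i] a by (auto simp: orb_def)
    have "\<forall>i. \<exists>r. \<forall>b. orb (Gen a) i (Gen b) = (\<Sum>t\<in>T. of_rat (r t) * f t (Gen b))" using comb[OF o] by blast
    then obtain r where r: "\<And>i b. orb (Gen a) i (Gen b) = (\<Sum>t\<in>T. of_rat (r i t) * f t (Gen b))" by metis
    have "(if b = a then 1 else 0) = (\<Sum>t\<in>T. (\<Sum>i<4. q_dual i * of_rat (r i t)) * f t (Gen b))" for b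
    proof -
      have "(if b = a then 1 else 0) = dl (Gen a) (Gen b)" by (simp add: dl_def)
      also have "\<dots> = (\<Sum>i<4. q_dual i * (\<Sum>t\<in>T. of_rat (r i t) * f t (Gen b)))" unfolding dl_orb r ..
      also have "\<dots> = (\<Sum>t\<in>T. (\<Sum>i<4. q_dual i * of_rat (r i t)) * f t (Gen b))"
        unfolding sum_distrib_left sum_distrib_right by (subst sum.swap) (simp add: ac_simps)
      finally show ?thesis .
    qed
    then show "\<exists>l. \<forall>b. (if b = a then 1 else 0) = (\<Sum>t\<in>T. l t * f t (Gen b))" by (intro exI allI)
  qed
  then show ?thesis by (simp add: card_gens[OF n3])
qed

text \<open>\<open>dim\<close> is a least cardinality of finite spanning sets, so it can be bounded
  from below only once such a set is known to exist.\<close>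

lemma fin_dim_QQ: "\<exists>T. finite T \<and> T \<subseteq> carrier QQ \<and> module.span kQ QQ T = carrier QQ"
proof -
  interpret Q: vectorspace kQ QQ by (rule vectorspace_QQ)
  let ?D = "(idxs n - {One}) \<times> {..<4::nat}"
  let ?S = "(\<lambda>p. qF (orb (fst p) (snd p))) ` ?D"
  have o: "orb d i \<in> formQ n \<and> orb d i One = 0" if "d \<in> idxs n - {One}" for d i
  proof -
    have "One \<noteq> actD g d" for g using that by (metis DiffD2 actD_invol actD_simps(1) insertI1)
    then have "orb d i One = 0" by (simp add: orb_def)
    then show ?thesis using that orb_formQ by blast
  qed
  have S: "?S \<subseteq> carrier QQ" unfolding carrier_QQ using o by force
  have sub: "submodule kQ (Q.span ?S) QQ" by (rule Q.span_is_submodule[OF S])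
  have "qF (\<lambda>e. \<Sum>p\<in>T. of_rat (r p) * orb (fst p) (snd p) e) \<in> Q.span ?S"
    if "finite T" "T \<subseteq> ?D" for T and r :: "idx \<times> nat \<Rightarrow> rat"
    using that
  proof (induction T)
    case empty
    have "Q.lincomb (\<lambda>_. 0) {} \<in> Q.span ?S" unfolding Q.span_def by blast
    then have "\<zero>\<^bsub>QQ\<^esub> \<in> Q.span ?S" by (simp add: Q.lincomb_def)
    then show ?case by (simp add: qF_zero)
  next
    case (insert p T)
    obtain d i where p: "p = (d, i)" "d \<in> idxs n - {One}" "i < 4" using insert.prems by auto
    have "qF (orb d i) \<in> Q.span ?S"
      by (rule subsetD[OF Q.in_own_span[OF S]]) (use p in force)
    then have "of_rat (r p) \<odot>\<^bsub>QQ\<^esub> qF (orb d i) \<in> Q.span ?S"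
      by (intro submodule.smult_closed[OF sub]) auto
    then have "qF (\<lambda>e. of_rat (r p) * orb d i e) \<oplus>\<^bsub>QQ\<^esub> qF (\<lambda>e. \<Sum>p\<in>T. of_rat (r p) * orb (fst p) (snd p) e) \<in> Q.span ?S"
      using insert.IH insert.prems o[OF p(2), of i] by (intro submodule.m_closed[OF sub]) (auto simp: qF_ops)
    also have "qF (\<lambda>e. of_rat (r p) * orb d i e) \<oplus>\<^bsub>QQ\<^esub> qF (\<lambda>e. \<Sum>p\<in>T. of_rat (r p) * orb (fst p) (snd p) e) =
      qF (\<lambda>e. of_rat (r p) * orb d i e + (\<Sum>p\<in>T. of_rat (r p) * orb (fst p) (snd p) e))"
    proof (intro qF_ops(1) formQ_sum formQ_smult)
      show "orb d i \<in> formQ n" using o p by blast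
      show "orb (fst q) (snd q) \<in> formQ n" if "q \<in> T" for q using o insert.prems that by fastforce
    qed
    finally show ?case using insert.hyps by (simp add: p)
  qed
  then have *: "qF (\<lambda>e. \<Sum>p\<in>?D. of_rat (r p) * orb (fst p) (snd p) e) \<in> Q.span ?S" for r :: "idx \<times> nat \<Rightarrow> rat"
    by simp
  have "qF F \<in> Q.span ?S" if F: "F \<in> formQ n" "F One = 0" for F
  proof -
    let ?r = "\<lambda>p. q_coord (snd p) (F (fst p)) / 4"
    have "(\<Sum>p\<in>?D. of_rat (?r p) * orb (fst p) (snd p) e) = (\<Sum>p\<in>idxs n \<times> {..<4}. of_rat (?r p) * orb (fst p) (snd p) e)" for e
      by (rule sum.mono_neutral_left) (auto simp: F(2) q_coord_def)
    then have "F = (\<lambda>e. \<Sum>p\<in>?D. of_rat (?r p) * orb (fst p) (snd p) e)"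
      using formQ_orb[OF F(1)] by simp
    then show ?thesis using *[of ?r] by simp
  qed
  then have "carrier QQ \<subseteq> Q.span ?S" unfolding carrier_QQ by blast
  moreover have "Q.span ?S \<subseteq> carrier QQ" by (rule Q.span_is_subset2[OF S])
  ultimately show ?thesis using S by (intro exI[of _ ?S]) auto
qed

lemma dim_QQ: "2 * n \<le> vectorspace.dim kQ QQ"
proof -
  let ?P = "\<lambda>m. \<exists>T. finite T \<and> card T = m \<and> T \<subseteq> carrier QQ \<and> module.span kQ QQ T = carrier QQ"
  have "\<exists>m. ?P m" using fin_dim_QQ by blast
  then have "?P (LEAST m. ?P m)" by (rule LeastI_ex)
  then obtain T where T: "finite T" "card T = (LEAST m. ?P m)" "T \<subseteq> carrier QQ" "module.span kQ QQ T = carrier QQ"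
    by (elim exE conjE)
  have "2 * n + 1 \<le> card T" by (rule gen_set_card[OF T(1,3,4)])
  moreover have "vectorspace.dim kQ QQ = card T"
    unfolding T(2) by (rule vectorspace.dim_def[OF vectorspace_QQ])
  ultimately show ?thesis by linarith
qed

end

section \<open>The algebraic closure of the rationals as a type\<close>

abbreviation KK :: "complex clos ring" where "KK \<equiv> closure_of_field kQ"
abbreviation toK :: "complex \<Rightarrow> complex clos" where "toK \<equiv> to_closure kQ"

lemma closure_KK: "algebraic_closure KK (toK ` carrier kQ)" "toK \<in> ring_hom kQ KK"
  using field.alg_closureE[OF field_kQ] by auto

lemma field_KK: "field KK"
  using closure_KK(1) by (rule algebraic_closure.axioms(1))

interpretation KK: cring KK using field_KK by (rule fieldE(1))

lemmas KK_Units = field.field_Units[OF field_KK]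

lemma closed_KK: "algebraically_closed KK"
proof -
  interpret algebraic_closure KK "toK ` carrier kQ" by (rule closure_KK)
  show ?thesis by (rule algebraically_closed_axioms)
qed

text \<open>The algebraic closure becomes a type in order to use the polynomials, sums and field
  arithmetic of the type classes. \<open>Kr\<close> and \<open>Ka\<close> translate to and from the
  elements of \<open>KK\<close>.\<close>

typedef qbar = "carrier KK" morphisms Kr Ka
  using KK.zero_closed by blast

lemma Kr_closed [simp]: "Kr x \<in> carrier KK"
  by (rule Kr)

lemma Kr_Ka: "x \<in> carrier KK \<Longrightarrow> Kr (Ka x) = x"
  by (rule Ka_inverse)

instantiation qbar :: field
begin
definition zero_qbar where "0 = Ka \<zero>\<^bsub>KK\<^esub>"
definition one_qbar where "1 = Ka \<one>\<^bsub>KK\<^esub>"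
definition plus_qbar where "x + y = Ka (Kr x \<oplus>\<^bsub>KK\<^esub> Kr y)"
definition times_qbar where "x * y = Ka (Kr x \<otimes>\<^bsub>KK\<^esub> Kr y)"
definition uminus_qbar where "- x = Ka (\<ominus>\<^bsub>KK\<^esub> Kr x)"
definition minus_qbar where "x - (y::qbar) = x + - y"
definition inverse_qbar where "inverse x = (if Kr x = \<zero>\<^bsub>KK\<^esub> then Ka \<zero>\<^bsub>KK\<^esub> else Ka (inv\<^bsub>KK\<^esub> Kr x))"
definition divide_qbar where "x div (y::qbar) = x * inverse y"

lemma Kr_ops: "Kr 0 = \<zero>\<^bsub>KK\<^esub>" "Kr 1 = \<one>\<^bsub>KK\<^esub>" "Kr (x + y) = Kr x \<oplus>\<^bsub>KK\<^esub> Kr y" "Kr (x * y) = Kr x \<otimes>\<^bsub>KK\<^esub> Kr y"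
  "Kr (- x) = \<ominus>\<^bsub>KK\<^esub> Kr x"
  by (simp_all add: zero_qbar_def one_qbar_def plus_qbar_def times_qbar_def uminus_qbar_def Kr_Ka)

instance
proof
  fix x y z :: qbar
  show "x * y * z = x * (y * z)" by (simp add: Kr_inject[symmetric] Kr_ops KK.m_assoc)
  show "x * y = y * x" by (simp add: Kr_inject[symmetric] Kr_ops KK.m_comm)
  show "1 * x = x" by (simp add: Kr_inject[symmetric] Kr_ops)
  show "x + y + z = x + (y + z)" by (simp add: Kr_inject[symmetric] Kr_ops KK.a_assoc)
  show "x + y = y + x" by (simp add: Kr_inject[symmetric] Kr_ops KK.a_comm)
  show "0 + x = x" by (simp add: Kr_inject[symmetric] Kr_ops)
  show "- x + x = 0" by (simp add: Kr_inject[symmetric] Kr_ops KK.l_neg)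
  show "x - y = x + - y" by (simp add: minus_qbar_def)
  show "(x + y) * z = x * z + y * z" by (simp add: Kr_inject[symmetric] Kr_ops KK.l_distr)
  show "(0::qbar) \<noteq> 1"
    using domain.one_not_zero[OF field.axioms(1)[OF field_KK]] by (auto simp: Kr_inject[symmetric] Kr_ops)
  show "x div y = x * inverse y" by (simp add: divide_qbar_def)
  show "inverse (0::qbar) = 0" by (simp add: inverse_qbar_def Kr_ops zero_qbar_def[symmetric])
  assume "x \<noteq> 0"
  then have nz: "Kr x \<noteq> \<zero>\<^bsub>KK\<^esub>" by (simp add: Kr_inject[symmetric] Kr_ops)
  then have u: "Kr x \<in> Units KK" by (simp add: KK_Units)
  then have "Kr (inverse x) = inv\<^bsub>KK\<^esub> Kr x" using nz by (simp add: inverse_qbar_def Kr_Ka)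
  then show "inverse x * x = 1" using u by (simp add: Kr_inject[symmetric] Kr_ops)
qed
end

lemma Kr_inverse: "x \<noteq> 0 \<Longrightarrow> Kr (inverse x) = inv\<^bsub>KK\<^esub> Kr x"
proof -
  assume "x \<noteq> 0"
  then have nz: "Kr x \<noteq> \<zero>\<^bsub>KK\<^esub>" by (simp add: Kr_inject[symmetric] Kr_ops)
  then have u: "Kr x \<in> Units KK" by (simp add: KK_Units)
  then show ?thesis using nz by (simp add: inverse_qbar_def Kr_Ka)
qed

lemma Kr_eq_zero_iff: "Kr x = \<zero>\<^bsub>KK\<^esub> \<longleftrightarrow> x = 0"
  by (metis Kr_inject Kr_ops(1))

lemma toK_hom: "ring_hom_ring kQ KK toK"
  by (rule ring_hom_ringI2) (use closure_KK(2) cring_kQ KK.ring_axioms in \<open>auto simp: cring_def\<close>)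

lemma toK_add: "a \<in> \<rat> \<Longrightarrow> b \<in> \<rat> \<Longrightarrow> toK (a + b) = toK a \<oplus>\<^bsub>KK\<^esub> toK b"
  using ring_hom_add[OF closure_KK(2), of a b] by simp

lemma toK_mult: "a \<in> \<rat> \<Longrightarrow> b \<in> \<rat> \<Longrightarrow> toK (a * b) = toK a \<otimes>\<^bsub>KK\<^esub> toK b"
  using ring_hom_mult[OF closure_KK(2), of a b] by simp

lemma toK_one: "toK 1 = \<one>\<^bsub>KK\<^esub>"
  using ring_hom_one[OF closure_KK(2)] by simp

lemma toK_zero: "toK 0 = \<zero>\<^bsub>KK\<^esub>"
  using ring_hom_zero[OF closure_KK(2) cring.axioms(1)[OF cring_kQ] KK.ring_axioms] by simp

lemma toK_closed: "z \<in> \<rat> \<Longrightarrow> toK z \<in> carrier KK"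
  using ring_hom_closed[OF closure_KK(2), of z] by simp

lemma toK_inj: "x \<in> \<rat> \<Longrightarrow> y \<in> \<rat> \<Longrightarrow> toK x = toK y \<Longrightarrow> x = y"
  using ring.indexed_const_inj_on[OF cring.axioms(1)[OF cring_kQ]] by (auto dest: inj_onD)

lemma Kr_of_nat: "Kr (of_nat m) = toK (of_nat m)"
proof (induction m)
  case 0
  then show ?case using toK_zero by (simp add: Kr_ops)
next
  case (Suc m)
  have "toK (1 + of_nat m) = toK 1 \<oplus>\<^bsub>KK\<^esub> toK (of_nat m)" using toK_add[of 1 "of_nat m"] by simp
  then show ?case using Suc toK_one by (simp add: Kr_ops)
qed

instance qbar :: field_char_0
proof
  show "inj (of_nat :: nat \<Rightarrow> qbar)"
  proof (rule injI)
    fix a b :: nat assume "(of_nat a :: qbar) = of_nat b"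
    then have "toK (of_nat a) = toK (of_nat b)" by (simp flip: Kr_of_nat)
    then have "(of_nat a :: complex) = of_nat b" by (intro toK_inj) auto
    then show "a = b" by simp
  qed
qed

lemma Kr_of_int: "Kr (of_int m) = toK (of_int m)"
proof (cases m rule: int_cases2)
  case (nonneg k)
  then show ?thesis by (simp add: Kr_of_nat)
next
  case (nonpos k)
  have "toK (of_int m) \<oplus>\<^bsub>KK\<^esub> toK (of_nat k) = \<zero>\<^bsub>KK\<^esub>"
    using toK_add[of "of_int m" "of_nat k"] toK_zero nonpos by simp
  moreover have "Kr (of_int m) \<oplus>\<^bsub>KK\<^esub> toK (of_nat k) = \<zero>\<^bsub>KK\<^esub>"
    using nonpos by (simp flip: Kr_of_nat Kr_ops)
  ultimately show ?thesis
    by (metis KK.add.r_cancel Kr_closed Kr_of_nat Rats_of_int toK_closed)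
qed

lemma Kr_of_rat: "Kr (of_rat r) = toK (of_rat r)"
proof (cases r)
  case (Fract a b)
  have b: "(of_int b :: qbar) \<noteq> 0" "(of_int b :: complex) \<noteq> 0" using Fract by auto
  have "(of_rat r :: qbar) * of_int b = of_int a" "(of_rat r :: complex) * of_int b = of_int a"
    using Fract b by (simp_all add: of_rat_rat)
  then have "Kr (of_rat r) \<otimes>\<^bsub>KK\<^esub> toK (of_int b) = toK (of_int a)"
    and "toK (of_rat r) \<otimes>\<^bsub>KK\<^esub> toK (of_int b) = toK (of_int a)"
    using toK_mult[of "of_rat r" "of_int b"] by (simp_all flip: Kr_of_int Kr_ops)
  moreover have "toK (of_int b) \<noteq> \<zero>\<^bsub>KK\<^esub>" using b(1) by (simp flip: Kr_of_int add: Kr_eq_zero_iff)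
  ultimately show ?thesis
    using domain.m_rcancel[OF field.axioms(1)[OF field_KK], of "toK (of_int b)" "Kr (of_rat r)" "toK (of_rat r)"]
    by (simp add: toK_closed)
qed

lemma exists_sqrt: "\<exists>y::qbar. y * y = x"
proof -
  let ?p = "[\<one>\<^bsub>KK\<^esub>, \<zero>\<^bsub>KK\<^esub>, \<ominus>\<^bsub>KK\<^esub> Kr x]"
  have p: "?p \<in> carrier (poly_ring KK)"
    unfolding univ_poly_carrier[symmetric] polynomial_def
    using domain.one_not_zero[OF field.axioms(1)[OF field_KK]] by simp
  have "KK.splitted ?p" by (rule algebraically_closed.roots_over_carrier[OF closed_KK p])
  then have "size (KK.roots ?p) = 2" by (simp add: KK.splitted_def)
  then obtain y where "y \<in># KK.roots ?p" by (metis multiset_nonemptyE size_empty zero_neq_numeral)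
  then have "KK.is_root ?p y" using domain.roots_mem_iff_is_root[OF field.axioms(1)[OF field_KK] p] by blast
  then have y: "y \<in> carrier KK" "KK.eval ?p y = \<zero>\<^bsub>KK\<^esub>" by (auto simp: KK.is_root_def)
  have "KK.eval ?p y = y \<otimes>\<^bsub>KK\<^esub> y \<oplus>\<^bsub>KK\<^esub> \<ominus>\<^bsub>KK\<^esub> Kr x"
    using y(1) by (simp add: numeral_2_eq_2 KK.m_comm)
  also have "\<dots> = Kr (Ka y * Ka y - x)" using y(1) by (simp add: Kr_ops Kr_Ka diff_conv_add_uminus del: add_uminus_conv_diff)
  finally have "Ka y * Ka y - x = 0" using y(2) by (simp add: Kr_eq_zero_iff)
  then show ?thesis by auto
qed

lemma exists_IS: "\<exists>p::qbar \<times> qbar. fst p * fst p = - 1 \<and> snd p * snd p = 3"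
  using exists_sqrt[of "- 1"] exists_sqrt[of 3] by auto

definition IS :: "qbar \<times> qbar" where "IS = (SOME p. fst p * fst p = - 1 \<and> snd p * snd p = 3)"

lemma IS: "fst IS * fst IS = - 1" "snd IS * snd IS = 3"
  unfolding IS_def using someI_ex[OF exists_IS] by auto

definition iK :: "quad \<Rightarrow> qbar" where "iK = iota (fst IS) (snd IS)"

lemma iK_hom [simp]: "iK 0 = 0" "iK 1 = 1" "iK (x + y) = iK x + iK y" "iK (x * y) = iK x * iK y" "iK (of_rat r) = of_rat r"
  unfolding iK_def using iota_hom[OF IS] by auto

lemma inj_iK: "inj iK"
  unfolding iK_def by (rule iota_inj[OF IS])

section \<open>Scalar extensions in diagonal coordinates\<close>

text \<open>A ring with a carrier set that is a copy of a field given as a type. The two instances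
  are \<open>KK\<close> with \<open>qbar\<close> and \<open>kQ\<close> with \<open>rat\<close>, so
  that scalar extensions to both are computed once.\<close>

locale typed_ring = cring R for R :: "('c, 't) ring_scheme" (structure) +
  fixes rep :: "'b::field_char_0 \<Rightarrow> 'c"
  assumes rep_bij: "bij_betw rep UNIV (carrier R)"
    and rep_ops: "rep 0 = \<zero>" "rep 1 = \<one>" "\<And>x y. rep (x + y) = rep x \<oplus> rep y" "\<And>x y. rep (x * y) = rep x \<otimes> rep y"
begin

definition ab :: "'c \<Rightarrow> 'b" where "ab = inv_into UNIV rep"

lemma rep_closed [simp]: "rep x \<in> carrier R"
  using rep_bij by (auto simp: bij_betw_def)

lemma ab_rep [simp]: "ab (rep x) = x"
  using rep_bij by (simp add: ab_def bij_betw_def)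

lemma rep_ab: "c \<in> carrier R \<Longrightarrow> rep (ab c) = c"
  using rep_bij by (simp add: ab_def bij_betw_def f_inv_into_f)

lemma rep_sum: "finite T \<Longrightarrow> finsum R (\<lambda>x. rep (f x)) T = rep (\<Sum>x\<in>T. f x)"
  by (induction T rule: finite_induct) (auto simp: rep_ops)

end

interpretation KT: typed_ring KK Kr
proof (intro typed_ring.intro typed_ring_axioms.intro)
  show "bij_betw Kr UNIV (carrier KK)"
    by (metis type_definition_qbar type_definition.Rep_range type_definition.Rep_inject bij_betw_def inj_def)
qed (auto simp: Kr_ops KK.cring_axioms)

interpretation QT: typed_ring kQ "of_rat :: rat \<Rightarrow> complex"
proof (intro typed_ring.intro typed_ring_axioms.intro)
  show "bij_betw (of_rat :: rat \<Rightarrow> complex) UNIV (carrier kQ)"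
    by (auto simp: bij_betw_def inj_def Rats_def)
qed (auto simp: cring_kQ of_rat_add of_rat_mult)

text \<open>The coefficient ring R and the field L are both mapped into a field over which the
  algebra splits, by j and i. For the algebraic closure this field is the closure itself, with i an
  embedding of L; for R = \<rat> it is L.\<close>

locale scalar = rat_form n B + typed_ring R rep
  for n B and R :: "('c, 't) ring_scheme" (structure) and rep :: "'b::field_char_0 \<Rightarrow> 'c" +
  fixes h :: "complex \<Rightarrow> 'c" and j :: "'b \<Rightarrow> 'f::field_char_0" and i :: "quad \<Rightarrow> 'f"
  assumes h: "\<And>r. h (of_rat r) = rep (of_rat r)"
    and j: "j 0 = 0" "j 1 = 1" "\<And>x y. j (x + y) = j x + j y" "\<And>x y. j (x * y) = j x * j y" "\<And>r. j (of_rat r) = of_rat r" "inj j"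
    and i: "i 0 = 0" "i 1 = 1" "\<And>x y. i (x + y) = i x + i y" "\<And>x y. i (x * y) = i x * i y" "\<And>r. i (of_rat r) = of_rat r" "inj i"
begin

definition ME :: "('c, (nat \<Rightarrow> complex) \<Rightarrow> 'c) module" where "ME = scalar_ext kQ (Aalg n) B R h"

lemma ME_carrier: "carrier ME = B \<rightarrow>\<^sub>E carrier R"
  by (simp add: ME_def scalar_ext_def)

text \<open>The passage from coordinates in the rational basis B to coordinates in the split basis.
  It embeds the scalar extension into the split algebra and turns its structure constants into
  \<open>mul\<close>.\<close>

definition psi :: "((nat \<Rightarrow> complex) \<Rightarrow> 'c) \<Rightarrow> idx \<Rightarrow> 'f" where
  "psi v d = (\<Sum>x\<in>B. j (ab (v x)) * i (xF x d))"

lemma i_sum: "i (\<Sum>x\<in>T. f x) = (\<Sum>x\<in>T. i (f x))"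
  by (induction T rule: infinite_finite_induct) (auto simp: i)

lemma j_sum: "j (\<Sum>x\<in>T. f x) = (\<Sum>x\<in>T. j (f x))"
  by (induction T rule: infinite_finite_induct) (auto simp: j)

lemma ME_D: "v \<in> carrier ME \<Longrightarrow> x \<in> B \<Longrightarrow> v x \<in> carrier R"
  by (auto simp: ME_carrier)

lemma psi_coord:
  assumes "x \<in> B" shows "(\<Sum>d\<in>idxs n. psi v d * i (cf d x)) = j (ab (v x))"
proof -
  have "(\<Sum>d\<in>idxs n. psi v d * i (cf d x)) = (\<Sum>y\<in>B. j (ab (v y)) * i (\<Sum>d\<in>idxs n. xF y d * cf d x))"
    unfolding psi_def i_sum i sum_distrib_left sum_distrib_right by (subst sum.swap) (simp add: ac_simps)
  also have "\<dots> = (\<Sum>y\<in>B. if y = x then j (ab (v y)) else 0)"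
    using assms by (intro sum.cong refl) (simp add: xF_cf i)
  also have "\<dots> = j (ab (v x))" using assms by simp
  finally show ?thesis .
qed

lemma psi_inj: assumes "v \<in> carrier ME" "w \<in> carrier ME" "\<And>d. psi v d = psi w d" shows "v = w"
proof (rule PiE_ext[OF assms(1,2)[unfolded ME_carrier]])
  fix x assume x: "x \<in> B"
  have "j (ab (v x)) = j (ab (w x))" using psi_coord[OF x, of v] psi_coord[OF x, of w] assms(3) by simp
  then have "ab (v x) = ab (w x)" using j(6) by (auto dest: injD)
  then show "v x = w x" using rep_ab ME_D[OF assms(1) x] ME_D[OF assms(2) x] by metis
qed

lemma psi_supp: "supp n (psi v)"
  unfolding supp_def psi_def by (auto intro!: sum.neutral simp: formQ_supp[OF xF_formQ] i)

lemma psi_add: assumes "v \<in> carrier ME" "w \<in> carrier ME"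
  shows "v \<oplus>\<^bsub>ME\<^esub> w \<in> carrier ME" "psi (v \<oplus>\<^bsub>ME\<^esub> w) d = psi v d + psi w d"
proof -
  have e: "v \<oplus>\<^bsub>ME\<^esub> w = (\<lambda>z\<in>B. v z \<oplus> w z)" by (simp add: ME_def scalar_ext_def)
  show "v \<oplus>\<^bsub>ME\<^esub> w \<in> carrier ME" unfolding e ME_carrier using assms ME_D by auto
  have "ab (v z \<oplus> w z) = ab (v z) + ab (w z)" if "z \<in> B" for z
    using ME_D[OF assms(1) that] ME_D[OF assms(2) that] by (metis ab_rep rep_ab rep_ops(3))
  then show "psi (v \<oplus>\<^bsub>ME\<^esub> w) d = psi v d + psi w d"
    by (simp add: psi_def e j distrib_right sum.distrib)
qed

lemma psi_smult: assumes "c \<in> carrier R" "v \<in> carrier ME"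
  shows "c \<odot>\<^bsub>ME\<^esub> v \<in> carrier ME" "psi (c \<odot>\<^bsub>ME\<^esub> v) d = j (ab c) * psi v d"
proof -
  have e: "c \<odot>\<^bsub>ME\<^esub> v = (\<lambda>z\<in>B. c \<otimes> v z)" by (simp add: ME_def scalar_ext_def)
  show "c \<odot>\<^bsub>ME\<^esub> v \<in> carrier ME" unfolding e ME_carrier using assms ME_D by auto
  have "ab (c \<otimes> v z) = ab c * ab (v z)" if "z \<in> B" for z
    using ME_D[OF assms(2) that] assms(1) by (metis ab_rep rep_ab rep_ops(4))
  then show "psi (c \<odot>\<^bsub>ME\<^esub> v) d = j (ab c) * psi v d"
    by (simp add: psi_def e j mult.assoc sum_distrib_left)
qed

lemma i_rc: assumes "F \<in> formQ n" shows "(\<Sum>z\<in>B. of_rat (rc F z) * i (xF z d)) = i (F d)"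
  by (subst (2) rc_expand[OF assms]) (simp add: i_sum i)

lemma psi_mult: assumes "v \<in> carrier ME" "w \<in> carrier ME"
  shows "v \<otimes>\<^bsub>ME\<^esub> w \<in> carrier ME" "psi (v \<otimes>\<^bsub>ME\<^esub> w) = mul n (psi v) (psi w)"
proof -
  have e: "v \<otimes>\<^bsub>ME\<^esub> w = (\<lambda>z\<in>B. \<Oplus>x\<in>B. \<Oplus>y\<in>B. (v x \<otimes> w y) \<otimes> h (coords kQ (Aalg n) B (x \<otimes>\<^bsub>Aalg n\<^esub> y) z))"
    by (simp add: ME_def scalar_ext_def)
  let ?s = "\<lambda>z. \<Sum>x\<in>B. \<Sum>y\<in>B. ab (v x) * ab (w y) * of_rat (rc (mul n (xF x) (xF y)) z)"
  have s: "(\<Oplus>x\<in>B. \<Oplus>y\<in>B. (v x \<otimes> w y) \<otimes> h (coords kQ (Aalg n) B (x \<otimes>\<^bsub>Aalg n\<^esub> y) z)) = rep (?s z)" if z: "z \<in> B" for z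
  proof -
    have t: "(v x \<otimes> w y) \<otimes> h (coords kQ (Aalg n) B (x \<otimes>\<^bsub>Aalg n\<^esub> y) z) =
        rep (ab (v x) * ab (w y) * of_rat (rc (mul n (xF x) (xF y)) z))" if xy: "x \<in> B" "y \<in> B" for x y
    proof -
      have "x \<otimes>\<^bsub>Aalg n\<^esub> y = eF n (mul n (xF x) (xF y))"
        using ops_Aalg(1)[OF xF_formQ[OF xy(1)] xF_formQ[OF xy(2)]] by (simp add: eF_xF xy)
      then have "h (coords kQ (Aalg n) B (x \<otimes>\<^bsub>Aalg n\<^esub> y) z) = rep (of_rat (rc (mul n (xF x) (xF y)) z))"
        using coords_rc[OF formQ_mul[OF xF_formQ[OF xy(1)] xF_formQ[OF xy(2)]] z] h by simp
      then show ?thesis using ME_D[OF assms(1) xy(1)] ME_D[OF assms(2) xy(2)] by (simp add: rep_ops rep_ab)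
    qed
    have "(\<Oplus>y\<in>B. (v x \<otimes> w y) \<otimes> h (coords kQ (Aalg n) B (x \<otimes>\<^bsub>Aalg n\<^esub> y) z)) =
        rep (\<Sum>y\<in>B. ab (v x) * ab (w y) * of_rat (rc (mul n (xF x) (xF y)) z))" if x: "x \<in> B" for x
    proof -
      have "(\<Oplus>y\<in>B. (v x \<otimes> w y) \<otimes> h (coords kQ (Aalg n) B (x \<otimes>\<^bsub>Aalg n\<^esub> y) z)) =
        (\<Oplus>y\<in>B. rep (ab (v x) * ab (w y) * of_rat (rc (mul n (xF x) (xF y)) z)))"
        by (rule finsum_cong') (use t x in auto)
      then show ?thesis by (simp only: rep_sum[OF finB])
    qed
    then have "(\<Oplus>x\<in>B. \<Oplus>y\<in>B. (v x \<otimes> w y) \<otimes> h (coords kQ (Aalg n) B (x \<otimes>\<^bsub>Aalg n\<^esub> y) z)) =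
      (\<Oplus>x\<in>B. rep (\<Sum>y\<in>B. ab (v x) * ab (w y) * of_rat (rc (mul n (xF x) (xF y)) z)))"
      by (intro finsum_cong') auto
    then show ?thesis by (simp only: rep_sum[OF finB])
  qed
  show "v \<otimes>\<^bsub>ME\<^esub> w \<in> carrier ME" unfolding e ME_carrier by (auto simp: s)
  show "psi (v \<otimes>\<^bsub>ME\<^esub> w) = mul n (psi v) (psi w)"
  proof
    fix d
    have "psi (v \<otimes>\<^bsub>ME\<^esub> w) d = (\<Sum>z\<in>B. j (?s z) * i (xF z d))"
      unfolding psi_def e by (intro sum.cong refl) (simp add: s)
    also have "\<dots> = (\<Sum>x\<in>B. \<Sum>y\<in>B. j (ab (v x)) * j (ab (w y)) * (\<Sum>z\<in>B. of_rat (rc (mul n (xF x) (xF y)) z) * i (xF z d)))"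
      unfolding j_sum j sum_distrib_left sum_distrib_right
      by (subst sum.swap, rule sum.cong[OF refl], subst sum.swap) (simp add: mult.assoc)
    also have "\<dots> = (\<Sum>x\<in>B. \<Sum>y\<in>B. j (ab (v x)) * j (ab (w y)) * i (mul n (xF x) (xF y) d))"
      by (intro sum.cong refl) (simp add: i_rc formQ_mul xF_formQ)
    also have "\<dots> = (\<Sum>x\<in>B. \<Sum>y\<in>B. j (ab (v x)) * (j (ab (w y)) * mul n (\<lambda>d. i (xF x d)) (\<lambda>d. i (xF y d)) d))"
      using mul_hom[of i n, OF i(3,4,1)] by (simp add: mult.assoc)
    also have "\<dots> = mul n (psi v) (psi w) d"
    proof -
      have "mul n (psi v) (psi w) = (\<lambda>d. \<Sum>x\<in>B. mul n (\<lambda>d. j (ab (v x)) * i (xF x d)) (psi w) d)"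
        unfolding psi_def[abs_def] by (rule mul_sum_left)
      also have "\<dots> = (\<lambda>d. \<Sum>x\<in>B. \<Sum>y\<in>B. mul n (\<lambda>d. j (ab (v x)) * i (xF x d)) (\<lambda>d. j (ab (w y)) * i (xF y d)) d)"
        unfolding psi_def[abs_def] mul_sum ..
      finally show ?thesis by (simp add: mul_smult mul_smult_left mult.left_commute)
    qed
    finally show "psi (v \<otimes>\<^bsub>ME\<^esub> w) d = mul n (psi v) (psi w) d" .
  qed
qed

lemma psi_one: "\<one>\<^bsub>ME\<^esub> \<in> carrier ME" "psi \<one>\<^bsub>ME\<^esub> = dl One"
proof -
  have e: "\<one>\<^bsub>ME\<^esub> = (\<lambda>z\<in>B. rep (of_rat (rc (dl One) z)))"
    by (auto simp: ME_def scalar_ext_def one_zero_Aalg coords_rc[OF formQ_one] h intro!: restrict_ext)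
  show "\<one>\<^bsub>ME\<^esub> \<in> carrier ME" unfolding e ME_carrier by auto
  show "psi \<one>\<^bsub>ME\<^esub> = dl One"
  proof
    fix d
    have "psi \<one>\<^bsub>ME\<^esub> d = (\<Sum>z\<in>B. of_rat (rc (dl One) z) * i (xF z d))"
      unfolding psi_def e by (intro sum.cong refl) (simp add: j)
    also have "\<dots> = i (dl One d)" by (rule i_rc[OF formQ_one])
    finally show "psi \<one>\<^bsub>ME\<^esub> d = dl One d" by (simp add: dl_def i)
  qed
qed

lemma basis_vec_mem: "x \<in> B \<Longrightarrow> basis_vec R B x \<in> carrier ME"
  by (auto simp: basis_vec_def ME_carrier)

lemma psi_basis_vec: assumes "x \<in> B" shows "psi (basis_vec R B x) d = i (xF x d)"
proof -
  have ab01: "ab \<one> = 1" "ab \<zero> = 0" by (simp_all flip: rep_ops)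
  have "psi (basis_vec R B x) d = (\<Sum>z\<in>B. if z = x then i (xF z d) else 0)"
    unfolding psi_def basis_vec_def by (intro sum.cong refl) (simp add: ab01 j)
  then show ?thesis using assms by simp
qed

subsection \<open>Diagonal automorphisms\<close>

definition IM :: "(idx \<Rightarrow> 'f) set" where "IM = psi ` carrier ME"

definition psii :: "(idx \<Rightarrow> 'f) \<Rightarrow> (nat \<Rightarrow> complex) \<Rightarrow> 'c" where "psii = inv_into (carrier ME) psi"

lemma inj_psi: "inj_on psi (carrier ME)"
  by (rule inj_onI, rule psi_inj) (auto simp: fun_eq_iff)

lemma psii_mem: "w \<in> IM \<Longrightarrow> psii w \<in> carrier ME" and psi_psii: "w \<in> IM \<Longrightarrow> psi (psii w) = w"
  by (auto simp: psii_def IM_def inv_into_into f_inv_into_f)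

lemma psii_psi: "v \<in> carrier ME \<Longrightarrow> psii (psi v) = v"
  by (simp add: psii_def inj_psi)

definition df :: "(gen \<Rightarrow> 'f) \<Rightarrow> ((nat \<Rightarrow> complex) \<Rightarrow> 'c) \<Rightarrow> (nat \<Rightarrow> complex) \<Rightarrow> 'c" where
  "df c = (\<lambda>v\<in>carrier ME. psii (\<lambda>d. wt c d * psi v d))"

text \<open>Besides the relations, the diagonal map and its inverse must preserve the image of
  \<open>psi\<close>, that is, be defined over R. Over the closure this is automatic
  (\<open>KS_diagok\<close>); over \<rat> it follows from compatibility with the Galois action
  (\<open>QS_diagok\<close>).\<close>

definition diagok :: "(gen \<Rightarrow> 'f) \<Rightarrow> bool" where
  "diagok c \<longleftrightarrow> rel n c \<and> (\<forall>w\<in>IM. (\<lambda>d. wt c d * w d) \<in> IM) \<and> (\<forall>w\<in>IM. (\<lambda>d. inverse (wt c d) * w d) \<in> IM)"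

lemma psi_df: assumes "diagok c" "v \<in> carrier ME"
  shows "df c v \<in> carrier ME" "psi (df c v) = (\<lambda>d. wt c d * psi v d)"
proof -
  have "(\<lambda>d. wt c d * psi v d) \<in> IM" using assms by (auto simp: diagok_def IM_def)
  then show "df c v \<in> carrier ME" "psi (df c v) = (\<lambda>d. wt c d * psi v d)"
    using assms(2) psii_mem psi_psii by (auto simp: df_def)
qed

lemma diagok_inverse: "diagok c \<Longrightarrow> diagok (\<lambda>a. inverse (c a))"
  by (auto simp: diagok_def rel_inverse wt_inverse)

lemma diagok_mult: assumes "diagok c" "diagok c'" shows "diagok (\<lambda>a. c a * c' a)"
proof -
  have c: "(\<lambda>d. wt c d * w d) \<in> IM" "(\<lambda>d. inverse (wt c d) * w d) \<in> IM"
    and c': "(\<lambda>d. wt c' d * w d) \<in> IM" "(\<lambda>d. inverse (wt c' d) * w d) \<in> IM" if "w \<in> IM" for w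
    using assms that by (simp_all add: diagok_def)
  then show ?thesis using assms by (simp add: diagok_def rel_mult wt_mult mult.assoc c[OF c'(1)] c[OF c'(2)])
qed

lemma df_mult: assumes "diagok c" "diagok c'" shows "compose (carrier ME) (df c) (df c') = df (\<lambda>a. c a * c' a)"
proof
  fix v
  show "compose (carrier ME) (df c) (df c') v = df (\<lambda>a. c a * c' a) v"
  proof (cases "v \<in> carrier ME")
    case True
    then show ?thesis
      by (intro psi_inj) (simp_all add: compose_eq psi_df assms diagok_mult wt_mult mult.assoc)
  qed (auto simp: compose_def df_def)
qed

lemma df_one: "df (\<lambda>a. 1) = (\<lambda>v\<in>carrier ME. v)"
  by (auto simp: df_def wt_one psii_psi intro!: restrict_ext)

lemma df_cong: assumes "\<And>a. a \<in> gens n \<Longrightarrow> c a = c' a" shows "df c = df c'"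
proof -
  have "(\<lambda>d. wt c d * psi v d) = (\<lambda>d. wt c' d * psi v d)" for v
    using wt_cong[of n c c', OF assms] psi_supp[of v] by (auto simp: fun_eq_iff supp_def)
  then show ?thesis by (simp add: df_def)
qed

lemma df_bij: assumes "diagok c" shows "bij_betw (df c) (carrier ME) (carrier ME)"
proof (rule bij_betwI[where g = "df (\<lambda>a. inverse (c a))"])
  note i = diagok_inverse[OF assms]
  have nz: "c a \<noteq> 0" if "a \<in> gens n" for a using assms rel_nz that by (auto simp: diagok_def)
  have one: "df (\<lambda>a. inverse (c a) * c a) v = v" "df (\<lambda>a. c a * inverse (c a)) v = v" if "v \<in> carrier ME" for v
  proof -
    have "df (\<lambda>a. inverse (c a) * c a) = df (\<lambda>a. 1)" by (rule df_cong) (simp add: nz)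
    moreover have "df (\<lambda>a. c a * inverse (c a)) = df (\<lambda>a. 1)" by (rule df_cong) (simp add: nz)
    ultimately show "df (\<lambda>a. inverse (c a) * c a) v = v" "df (\<lambda>a. c a * inverse (c a)) v = v"
      using that by (simp_all add: df_one)
  qed
  show "df c \<in> carrier ME \<rightarrow> carrier ME" "df (\<lambda>a. inverse (c a)) \<in> carrier ME \<rightarrow> carrier ME"
    using psi_df assms i by auto
  fix v assume v: "v \<in> carrier ME"
  show "df (\<lambda>a. inverse (c a)) (df c v) = v"
    using fun_cong[OF df_mult[OF i assms], of v] one(1)[OF v] v by (simp add: compose_eq)
  show "df c (df (\<lambda>a. inverse (c a)) v) = v"
    using fun_cong[OF df_mult[OF assms i], of v] one(2)[OF v] v by (simp add: compose_eq)
qed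

lemma df_aut: assumes "diagok c" shows "df c \<in> alg_aut R ME"
  unfolding alg_aut_def Bij_def
proof (intro CollectI conjI IntI)
  have r: "rel n c" using assms by (simp add: diagok_def)
  show "df c \<in> extensional (carrier ME)" by (simp add: df_def)
  show "bij_betw (df c) (carrier ME) (carrier ME)" by (rule df_bij[OF assms])
  show "df c \<in> ring_hom ME ME"
  proof (rule ring_hom_memI)
    fix v w assume v: "v \<in> carrier ME" "w \<in> carrier ME"
    show "df c v \<in> carrier ME" by (rule psi_df[OF assms v(1)])
    show "df c (v \<otimes>\<^bsub>ME\<^esub> w) = df c v \<otimes>\<^bsub>ME\<^esub> df c w"
      by (rule psi_inj) (simp_all add: psi_df psi_mult assms v mul_wt[OF r])
    show "df c (v \<oplus>\<^bsub>ME\<^esub> w) = df c v \<oplus>\<^bsub>ME\<^esub> df c w"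
      by (rule psi_inj) (simp_all add: psi_df psi_add assms v distrib_left)
  next
    show "df c \<one>\<^bsub>ME\<^esub> = \<one>\<^bsub>ME\<^esub>"
      by (rule psi_inj) (simp_all add: psi_df psi_one assms dl_def)
  qed
  show "\<forall>b\<in>carrier R. \<forall>v\<in>carrier ME. df c (b \<odot>\<^bsub>ME\<^esub> v) = b \<odot>\<^bsub>ME\<^esub> df c v"
  proof (intro ballI)
    fix b v assume v: "b \<in> carrier R" "v \<in> carrier ME"
    show "df c (b \<odot>\<^bsub>ME\<^esub> v) = b \<odot>\<^bsub>ME\<^esub> df c v"
      by (rule psi_inj) (simp_all add: psi_df psi_smult assms v mult.left_commute)
  qed
qed

text \<open>A diagonal matrix carried back to the basis B by the mutually inverse matrices
  \<open>xF\<close> and \<open>cf\<close>. The entries are linear in the weights.\<close>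

lemma mat_entry_df:
  assumes "diagok c" "x \<in> B" "y \<in> B"
  shows "mat_entry R B x y (df c) \<in> carrier R"
    "j (ab (mat_entry R B x y (df c))) = (\<Sum>d\<in>idxs n. wt c d * i (xF x d) * i (cf d y))"
proof -
  note m = psi_df[OF assms(1) basis_vec_mem[OF assms(2)]]
  show "mat_entry R B x y (df c) \<in> carrier R" using ME_D[OF m(1) assms(3)] by (simp add: mat_entry_def)
  show "j (ab (mat_entry R B x y (df c))) = (\<Sum>d\<in>idxs n. wt c d * i (xF x d) * i (cf d y))"
    using psi_coord[OF assms(3), of "df c (basis_vec R B x)"] by (simp add: mat_entry_def m psi_basis_vec assms)
qed

end

section \<open>Scalar extension to the algebraic closure and to \<rat> itself\<close>

context rat_form
begin

sublocale KS: scalar n B KK Kr "toK \<circ> (\<lambda>c. c)" "\<lambda>x. x" iK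
  by unfold_locales (auto simp: Kr_of_rat inj_iK)

sublocale QS: scalar n B kQ "of_rat :: rat \<Rightarrow> complex" "\<lambda>c. c" "of_rat :: rat \<Rightarrow> quad" "\<lambda>x. x"
  by unfold_locales (auto simp: of_rat_add of_rat_mult inj_def)

lemma ME_eq: "geom_ext kQ (Aalg n) B kQ (\<lambda>c. c) = KS.ME"
  by (simp add: geom_ext_def KS.ME_def)

lemma geom_Aut_eq: "geom_Aut kQ (Aalg n) B kQ (\<lambda>c. c) = alg_aut KK KS.ME"
  by (simp add: geom_Aut_def Aut_functor_def KS.ME_def)

lemma Aut_Q_eq: "Aut_functor kQ (Aalg n) B kQ (\<lambda>c. c) = alg_aut kQ QS.ME"
  by (simp add: Aut_functor_def QS.ME_def)

text \<open>Over the closure the algebra is split: \<open>cf\<close> provides a preimage of every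
  function that is supported on the basis.\<close>

lemma KS_IM: "KS.IM = {w. supp n w}"
proof (intro equalityI subsetI)
  fix w assume "w \<in> KS.IM"
  then show "w \<in> {w. supp n w}" using KS.psi_supp by (auto simp: KS.IM_def)
next
  fix w :: "idx \<Rightarrow> qbar" assume "w \<in> {w. supp n w}"
  then have w: "supp n w" by simp
  define v where "v = (\<lambda>x\<in>B. Kr (\<Sum>d\<in>idxs n. w d * iK (cf d x)))"
  have v: "v \<in> carrier KS.ME" by (auto simp: v_def KS.ME_carrier)
  have "KS.psi v = w"
  proof
    fix e
    have "KS.psi v e = (\<Sum>x\<in>B. (\<Sum>d\<in>idxs n. w d * iK (cf d x)) * iK (xF x e))"
      unfolding KS.psi_def by (intro sum.cong refl) (simp add: v_def)
    also have "\<dots> = (\<Sum>d\<in>idxs n. w d * iK (\<Sum>x\<in>B. cf d x * xF x e))"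
      unfolding KS.i_sum iK_hom sum_distrib_left sum_distrib_right by (subst sum.swap) (simp add: ac_simps)
    also have "\<dots> = (\<Sum>d\<in>idxs n. if d = e then w d else 0)"
      by (intro sum.cong refl) (simp add: dl_cf[symmetric], auto simp: dl_def)
    also have "\<dots> = w e" using w by (auto simp: supp_def)
    finally show "KS.psi v e = w e" .
  qed
  then show "w \<in> KS.IM" using v by (auto simp: KS.IM_def)
qed

lemma QS_IM: "QS.IM = formQ n"
proof (intro equalityI subsetI)
  fix w assume "w \<in> QS.IM"
  then obtain v where "w = QS.psi v" by (auto simp: QS.IM_def)
  then show "w \<in> formQ n" unfolding QS.psi_def[abs_def] by (auto intro!: formQ_sum formQ_smult xF_formQ)
next
  fix F assume F: "F \<in> formQ n"
  let ?v = "\<lambda>x\<in>B. complex_of_rat (rc F x)"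
  have "?v \<in> carrier QS.ME" by (auto simp: QS.ME_carrier)
  moreover have e: "QS.psi ?v d = F d" for d
  proof -
    have "QS.psi ?v d = (\<Sum>x\<in>B. of_rat (rc F x) * xF x d)" unfolding QS.psi_def by (intro sum.cong refl) simp
    then show ?thesis using fun_cong[OF rc_expand[OF F], of d] by simp
  qed
  moreover have "F = QS.psi ?v" by (rule ext) (rule e[symmetric])
  ultimately show "F \<in> QS.IM" unfolding QS.IM_def by (intro image_eqI)
qed

lemma KS_diagok: "rel n c \<Longrightarrow> KS.diagok c"
  by (auto simp: KS.diagok_def KS_IM supp_def)

definition rational :: "(gen \<Rightarrow> quad) \<Rightarrow> bool" where
  "rational c \<longleftrightarrow> rel n c \<and> (\<forall>g a. c (act g a) = cj g (c a))"

lemma QS_diagok: assumes "rational c" shows "QS.diagok c"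
proof -
  have e: "c (act g a) = cj g (c a)" "inverse (c (act g a)) = cj g (inverse (c a))" for g a
    using assms by (cases g; simp add: rational_def)+
  have "(\<lambda>d. wt c d * F d) \<in> formQ n" "(\<lambda>d. wt (\<lambda>a. inverse (c a)) d * F d) \<in> formQ n" if "F \<in> formQ n" for F
    using formQ_wt[of c, OF e(1) that] formQ_wt[of "\<lambda>a. inverse (c a)", OF e(2) that] by auto
  then show ?thesis using assms by (auto simp: QS.diagok_def QS_IM wt_inverse rational_def)
qed

lemma rational_rel: "rational c \<Longrightarrow> rel n (\<lambda>a. iK (c a))"
  by (rule rel_hom) (auto simp: inj_iK rational_def)

lemma mat_entry_rational:
  assumes "rational c" "x \<in> B" "y \<in> B"
  shows "mat_entry kQ B x y (QS.df c) \<in> \<rat>"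
    "mat_entry KK B x y (KS.df (\<lambda>a. iK (c a))) = toK (mat_entry kQ B x y (QS.df c))"
proof -
  note Q = QS.mat_entry_df[OF QS_diagok[OF assms(1)] assms(2,3)]
  note K = KS.mat_entry_df[OF KS_diagok[OF rational_rel[OF assms(1)]] assms(2,3)]
  show r: "mat_entry kQ B x y (QS.df c) \<in> \<rat>" using Q(1) by simp
  let ?r = "QT.ab (mat_entry kQ B x y (QS.df c))"
  have w: "wt (\<lambda>a. iK (c a)) d = iK (wt c d)" for d by (rule wt_hom) auto
  have "KT.ab (mat_entry KK B x y (KS.df (\<lambda>a. iK (c a)))) = iK (of_rat ?r)"
    unfolding K(2) Q(2) by (simp add: w KS.i_sum)
  then have "Kr (KT.ab (mat_entry KK B x y (KS.df (\<lambda>a. iK (c a))))) = Kr (of_rat ?r)" by simp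
  then show "mat_entry KK B x y (KS.df (\<lambda>a. iK (c a))) = toK (mat_entry kQ B x y (QS.df c))"
    using KT.rep_ab[OF K(1)] QT.rep_ab[OF Q(1)] by (simp add: Kr_of_rat)
qed

lemma extend_map_df:
  assumes "rational c"
  shows "extend_map B kQ KK toK (QS.df c) = KS.df (\<lambda>a. iK (c a))"
proof (rule extensionalityI[where A = "carrier KS.ME"])
  show "extend_map B kQ KK toK (QS.df c) \<in> extensional (carrier KS.ME)"
    by (simp add: extend_map_def KS.ME_carrier)
  show "KS.df (\<lambda>a. iK (c a)) \<in> extensional (carrier KS.ME)" by (simp add: KS.df_def)
  fix v assume v: "v \<in> carrier KS.ME"
  note D = KS_diagok[OF rational_rel[OF assms]] and DQ = QS_diagok[OF assms]
  define m where "m x y = QT.ab (mat_entry kQ B x y (QS.df c))" for x y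
  have m: "mat_entry kQ B x y (QS.df c) = of_rat (m x y)" if "x \<in> B" "y \<in> B" for x y
    unfolding m_def by (rule QT.rep_ab[OF QS.mat_entry_df(1)[OF DQ that], symmetric])
  \<comment> \<open>The action of the diagonal map on a rational basis vector, read in L; applying
    \<open>iK\<close> gives the action over the closure.\<close>
  have row: "(\<Sum>y\<in>B. of_rat (m x y) * xF y d) = wt c d * xF x d" if x: "x \<in> B" for x d
  proof -
    have "QS.psi (QS.df c (basis_vec kQ B x)) d = wt c d * QS.psi (basis_vec kQ B x) d"
      using QS.psi_df(2)[OF DQ QS.basis_vec_mem[OF x]] by simp
    then show ?thesis by (simp add: QS.psi_basis_vec x) (simp add: QS.psi_def m_def mat_entry_def)
  qed
  have val: "extend_map B kQ KK toK (QS.df c) v = (\<lambda>y\<in>B. Kr (\<Sum>x\<in>B. KT.ab (v x) * of_rat (m x y)))"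
  proof -
    have "finsum KK (\<lambda>x. v x \<otimes>\<^bsub>KK\<^esub> toK (mat_entry kQ B x y (QS.df c))) B = Kr (\<Sum>x\<in>B. KT.ab (v x) * of_rat (m x y))" if y: "y \<in> B" for y
    proof -
      have "finsum KK (\<lambda>x. v x \<otimes>\<^bsub>KK\<^esub> toK (mat_entry kQ B x y (QS.df c))) B = finsum KK (\<lambda>x. Kr (KT.ab (v x) * of_rat (m x y))) B"
        by (rule KK.finsum_cong') (use KS.ME_D[OF v] y in \<open>auto simp: m Kr_ops KT.rep_ab Kr_of_rat intro!: KK.m_closed toK_closed\<close>)
      then show ?thesis by (simp only: KT.rep_sum[OF finB])
    qed
    then show ?thesis using v unfolding extend_map_def KS.ME_carrier by (auto intro!: restrict_ext)
  qed
  have mem: "extend_map B kQ KK toK (QS.df c) v \<in> carrier KS.ME" unfolding val KS.ME_carrier by auto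
  show "extend_map B kQ KK toK (QS.df c) v = KS.df (\<lambda>a. iK (c a)) v"
  proof (rule KS.psi_inj[OF mem KS.psi_df(1)[OF D v]])
    fix d
    have "KS.psi (extend_map B kQ KK toK (QS.df c) v) d = (\<Sum>y\<in>B. (\<Sum>x\<in>B. KT.ab (v x) * of_rat (m x y)) * iK (xF y d))"
      unfolding KS.psi_def val by (intro sum.cong refl) simp
    also have "\<dots> = (\<Sum>x\<in>B. KT.ab (v x) * iK (\<Sum>y\<in>B. of_rat (m x y) * xF y d))"
      unfolding KS.i_sum iK_hom sum_distrib_left sum_distrib_right by (subst sum.swap) (simp add: ac_simps)
    also have "\<dots> = iK (wt c d) * KS.psi v d"
      by (simp add: row KS.psi_def sum_distrib_left mult.left_commute)
    also have "iK (wt c d) = wt (\<lambda>a. iK (c a)) d" by (rule wt_hom[symmetric]) auto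
    finally show "KS.psi (extend_map B kQ KK toK (QS.df c) v) d = KS.psi (KS.df (\<lambda>a. iK (c a)) v) d"
      by (simp add: KS.psi_df(2)[OF D v])
  qed
qed

subsection \<open>The matrix of an automorphism in diagonal coordinates\<close>

text \<open>The matrix of f in the split basis, by \<open>mt_opK\<close>. The formula is linear in
  the entries of f for the basis B, so the entries of \<open>mt\<close> are polynomial functions on
  the automorphism group.\<close>

definition mt :: "(((nat \<Rightarrow> complex) \<Rightarrow> complex clos) \<Rightarrow> ((nat \<Rightarrow> complex) \<Rightarrow> complex clos)) \<Rightarrow> idx \<Rightarrow> idx \<Rightarrow> qbar" where
  "mt f d e = (\<Sum>x\<in>B. \<Sum>y\<in>B. iK (cf d x * xF y e) * KT.ab (mat_entry KK B x y f))"

definition opK :: "(((nat \<Rightarrow> complex) \<Rightarrow> complex clos) \<Rightarrow> ((nat \<Rightarrow> complex) \<Rightarrow> complex clos)) \<Rightarrow> (idx \<Rightarrow> qbar) \<Rightarrow> idx \<Rightarrow> qbar" where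
  "opK f w = KS.psi (f (KS.psii w))"

lemma psii_supp: "supp n w \<Longrightarrow> KS.psii w \<in> carrier KS.ME" "supp n w \<Longrightarrow> KS.psi (KS.psii w) = w"
  using KS.psii_mem KS.psi_psii by (auto simp: KS_IM)

lemma supp_add: "supp n u \<Longrightarrow> supp n v \<Longrightarrow> supp n (\<lambda>d. u d + v d)" for u v :: "idx \<Rightarrow> qbar"
  by (auto simp: supp_def)

lemma supp_smult: "supp n v \<Longrightarrow> supp n (\<lambda>d. r * v d)" for v :: "idx \<Rightarrow> qbar"
  by (auto simp: supp_def)

lemma supp_sum: "(\<And>x. x \<in> T \<Longrightarrow> supp n (F x)) \<Longrightarrow> supp n (\<lambda>d. \<Sum>x\<in>T. F x d)" for F :: "'z \<Rightarrow> idx \<Rightarrow> qbar"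
  by (auto simp: supp_def intro!: sum.neutral)

lemma supp_dl: "d \<in> idxs n \<Longrightarrow> supp n (dl d)"
  by (auto simp: supp_def dl_def)

context
  fixes f
  assumes f: "f \<in> alg_aut KK KS.ME"
begin

lemma aut_mem: "v \<in> carrier KS.ME \<Longrightarrow> f v \<in> carrier KS.ME"
  using f by (auto simp: alg_aut_def ring_hom_def)

lemma aut_inj: "inj_on f (carrier KS.ME)"
  using f by (auto simp: alg_aut_def Bij_def bij_betw_def)

lemma opK_psi: "v \<in> carrier KS.ME \<Longrightarrow> opK f (KS.psi v) = KS.psi (f v)"
  by (simp add: opK_def KS.psii_psi)

lemma opK_supp: "supp n (opK f w)"
  unfolding opK_def by (rule KS.psi_supp)

lemma opK_add: assumes "supp n u" "supp n v" shows "opK f (\<lambda>d. u d + v d) = (\<lambda>d. opK f u d + opK f v d)"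
proof -
  note m = psii_supp[OF assms(1)] psii_supp[OF assms(2)]
  have "KS.psii (\<lambda>d. u d + v d) = KS.psii u \<oplus>\<^bsub>KS.ME\<^esub> KS.psii v"
    by (rule KS.psi_inj) (use m assms in \<open>simp_all add: KS.psi_add psii_supp supp_add\<close>)
  moreover have "f (KS.psii u \<oplus>\<^bsub>KS.ME\<^esub> KS.psii v) = f (KS.psii u) \<oplus>\<^bsub>KS.ME\<^esub> f (KS.psii v)"
    using f m by (auto simp: alg_aut_def ring_hom_def)
  ultimately show ?thesis unfolding opK_def using m by (auto simp: KS.psi_add aut_mem)
qed

lemma opK_smult: assumes "supp n v" shows "opK f (\<lambda>d. r * v d) = (\<lambda>d. r * opK f v d)"
proof -
  note m = psii_supp[OF assms]
  have "KS.psii (\<lambda>d. r * v d) = Kr r \<odot>\<^bsub>KS.ME\<^esub> KS.psii v"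
    by (rule KS.psi_inj) (use m assms in \<open>simp_all add: KS.psi_smult psii_supp supp_smult\<close>)
  moreover have "f (Kr r \<odot>\<^bsub>KS.ME\<^esub> KS.psii v) = Kr r \<odot>\<^bsub>KS.ME\<^esub> f (KS.psii v)"
    using f m by (auto simp: alg_aut_def)
  ultimately show ?thesis unfolding opK_def using m by (auto simp: KS.psi_smult aut_mem)
qed

lemma opK_mul: assumes "supp n u" "supp n v" shows "opK f (mul n u v) = mul n (opK f u) (opK f v)"
proof -
  note m = psii_supp[OF assms(1)] psii_supp[OF assms(2)]
  have "KS.psii (mul n u v) = KS.psii u \<otimes>\<^bsub>KS.ME\<^esub> KS.psii v"
    by (rule KS.psi_inj) (use m assms in \<open>simp_all add: KS.psi_mult psii_supp supp_mul\<close>)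
  moreover have "f (KS.psii u \<otimes>\<^bsub>KS.ME\<^esub> KS.psii v) = f (KS.psii u) \<otimes>\<^bsub>KS.ME\<^esub> f (KS.psii v)"
    using f m by (auto simp: alg_aut_def ring_hom_def)
  ultimately show ?thesis unfolding opK_def using m by (auto simp: KS.psi_mult aut_mem)
qed

lemma opK_zero: "opK f (\<lambda>_. 0) = (\<lambda>_. 0)"
  using opK_smult[of "\<lambda>_. 0" 0] by (simp add: supp_def)

lemma opK_one: "opK f (dl One) = dl One"
proof -
  have "KS.psii (dl One) = \<one>\<^bsub>KS.ME\<^esub>" using KS.psii_psi[OF KS.psi_one(1)] by (simp add: KS.psi_one)
  moreover have "f \<one>\<^bsub>KS.ME\<^esub> = \<one>\<^bsub>KS.ME\<^esub>" using f by (auto simp: alg_aut_def ring_hom_def)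
  ultimately show ?thesis by (simp add: opK_def KS.psi_one)
qed

lemma opK_sum: "(\<And>x. x \<in> T \<Longrightarrow> supp n (F x)) \<Longrightarrow> opK f (\<lambda>d. \<Sum>x\<in>T. F x d) = (\<lambda>d. \<Sum>x\<in>T. opK f (F x) d)"
proof (induction T rule: infinite_finite_induct)
  case (insert x T)
  then show ?case by (simp add: opK_add supp_sum)
qed (simp_all add: opK_zero)

lemma mt_opK: assumes d: "d \<in> idxs n" shows "mt f d = opK f (dl d)"
proof
  fix e
  have bv: "KS.psi (basis_vec KK B x) = (\<lambda>e. iK (xF x e))" if "x \<in> B" for x
    using KS.psi_basis_vec[OF that] by auto
  have s: "supp n (\<lambda>e. iK (xF x e))" if "x \<in> B" for x
    using formQ_supp[OF xF_formQ[OF that]] by (auto simp: supp_def)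
  have "dl d = (\<lambda>e. \<Sum>x\<in>B. iK (cf d x) * iK (xF x e))"
  proof
    fix e
    have "(dl d e :: qbar) = iK (dl d e)" by (simp add: dl_def)
    then show "dl d e = (\<Sum>x\<in>B. iK (cf d x) * iK (xF x e))" by (simp add: dl_cf[OF d] KS.i_sum)
  qed
  then have "opK f (dl d) = opK f (\<lambda>e. \<Sum>x\<in>B. iK (cf d x) * iK (xF x e))" by simp
  also have "\<dots> = (\<lambda>e. \<Sum>x\<in>B. iK (cf d x) * opK f (\<lambda>e. iK (xF x e)) e)"
    by (subst opK_sum) (auto simp: s supp_smult opK_smult)
  finally have "opK f (dl d) e = (\<Sum>x\<in>B. iK (cf d x) * opK f (\<lambda>e. iK (xF x e)) e)" by simp
  also have "\<dots> = (\<Sum>x\<in>B. iK (cf d x) * KS.psi (f (basis_vec KK B x)) e)"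
    by (intro sum.cong refl) (simp add: bv[symmetric] opK_psi KS.basis_vec_mem)
  also have "\<dots> = mt f d e"
    by (simp add: mt_def KS.psi_def mat_entry_def sum_distrib_left mult.commute mult.left_commute)
  finally show "mt f d e = opK f (dl d) e" ..
qed

lemma opK_expand: assumes "supp n w" shows "opK f w = (\<lambda>e. \<Sum>d\<in>idxs n. w d * mt f d e)"
proof -
  have "w = (\<lambda>e. \<Sum>d\<in>idxs n. w d * dl d e)"
    using assms by (auto simp: dl_def supp_def if_distrib fun_eq_iff cong: if_cong)
  then have "opK f w = opK f (\<lambda>e. \<Sum>d\<in>idxs n. w d * dl d e)" by simp
  also have "\<dots> = (\<lambda>e. \<Sum>d\<in>idxs n. w d * mt f d e)"
    by (subst opK_sum) (auto simp: supp_dl supp_smult opK_smult mt_opK)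
  finally show ?thesis .
qed

lemma autsys_mt: "autsys n (mt f)"
  unfolding autsys_def
proof (intro conjI ballI allI impI)
  show "supp n (mt f a)" if "a \<in> idxs n" for a using that by (simp add: mt_opK opK_supp)
  show "mt f One = dl One" by (simp add: mt_opK opK_one)
  fix a b assume ab: "a \<in> gens n" "b \<in> gens n"
  have p: "mul n (mt f (Gen a)) (mt f (Gen b)) = opK f (mul n (dl (Gen a)) (dl (Gen b)))"
    using ab by (simp add: mt_opK opK_mul supp_dl)
  then show "mul n (mt f (Gen a)) (mt f (Gen b)) = (if pc a b = {} then \<lambda>_. 0 else mt f (Prd (pc a b)))"
    using ab by (simp add: mul_dl_Gen opK_zero mt_opK Prd_in_idxs)
  fix c assume c: "c \<in> gens n"
  have "mul n (mul n (dl (Gen a)) (dl (Gen b))) (dl (Gen c)) = (\<lambda>_. 0 :: qbar)"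
    using ab by (intro mul_no_gens) (auto simp: dl_def)
  then show "mul n (mul n (mt f (Gen a)) (mt f (Gen b))) (mt f (Gen c)) = (\<lambda>_. 0)"
    unfolding p using ab c by (simp add: mt_opK opK_mul[symmetric] supp_dl supp_mul opK_zero)
next
  fix z :: "idx \<Rightarrow> qbar" and a assume z: "\<forall>d. (\<Sum>a\<in>idxs n. z a * mt f a d) = 0" and a: "a \<in> idxs n"
  let ?w = "\<lambda>d. if d \<in> idxs n then z d else 0"
  have w: "supp n ?w" by (simp add: supp_def)
  have z0: "supp n (\<lambda>_. 0 :: qbar)" by (simp add: supp_def)
  have "opK f ?w = (\<lambda>_. 0)" unfolding opK_expand[OF w] using z by (auto intro!: ext)
  then have "KS.psi (f (KS.psii ?w)) d = KS.psi (f (KS.psii (\<lambda>_. 0))) d" for d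
    using opK_zero unfolding opK_def by simp
  then have "f (KS.psii ?w) = f (KS.psii (\<lambda>_. 0))"
    by (intro KS.psi_inj aut_mem psii_supp w z0)
  from inj_onD[OF aut_inj this psii_supp(1)[OF w] psii_supp(1)[OF z0]]
  have "KS.psi (KS.psii ?w) = KS.psi (KS.psii (\<lambda>_. 0))" by (rule arg_cong)
  then have "?w = (\<lambda>_. 0)" unfolding psii_supp(2)[OF w] psii_supp(2)[OF z0] .
  from fun_cong[OF this, of a] a show "z a = 0" by simp
qed

lemma aut_eq_df:
  assumes "rel n c" "\<And>a. a \<in> idxs n \<Longrightarrow> mt f a = (\<lambda>d. wt c a * dl a d)"
  shows "f = KS.df c"
proof (rule extensionalityI[where A = "carrier KS.ME"])
  show "f \<in> extensional (carrier KS.ME)" using f by (auto simp: alg_aut_def Bij_def)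
  show "KS.df c \<in> extensional (carrier KS.ME)" by (simp add: KS.df_def)
  fix v assume v: "v \<in> carrier KS.ME"
  show "f v = KS.df c v"
  proof (rule KS.psi_inj[OF aut_mem[OF v] KS.psi_df(1)[OF KS_diagok[OF assms(1)] v]])
    fix e
    have "KS.psi (f v) e = (\<Sum>d\<in>idxs n. KS.psi v d * (wt c d * dl d e))"
      unfolding opK_psi[OF v, symmetric] opK_expand[OF KS.psi_supp] by (intro sum.cong refl) (simp add: assms(2))
    also have "\<dots> = wt c e * KS.psi v e"
      using KS.psi_supp[of v] by (auto simp: dl_def supp_def if_distrib mult.commute cong: if_cong)
    finally show "KS.psi (f v) e = KS.psi (KS.df c v) e" by (simp add: KS.psi_df(2)[OF KS_diagok[OF assms(1)] v])
  qed
qed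

end

lemma mt_df: assumes "rel n c" "a \<in> idxs n" shows "mt (KS.df c) a = (\<lambda>d. wt c a * dl a d)"
proof -
  note D = KS_diagok[OF assms(1)]
  have "mt (KS.df c) a = (\<lambda>d. wt c d * dl a d)"
    using mt_opK[OF KS.df_aut[OF D] assms(2)] psii_supp[OF supp_dl[OF assms(2)]]
    by (simp add: opK_def KS.psi_df[OF D])
  then show ?thesis by (auto simp: dl_def)
qed

subsection \<open>A regular element of the torus\<close>

text \<open>Integers that satisfy the torus relations additively, with 0 at e: the pairs of u give 1
  + 2 = 3 and -1 - 2 = -3, the values at the two y; members of the other pairs are opposite. All
  values are distinct and, for generators, at most n in absolute value.\<close>

fun offset :: "gen \<Rightarrow> int" where
  "offset (GU a b) = (if a then -1 else 1) * (if b then 2 else 1)"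
| "offset (GY a) = (if a then -3 else 3)"
| "offset GE = 0"
| "offset (GP a k) = (if a then -1 else 1) * (4 + int k)"

text \<open>Each relation has two factors on either side, so a common shift preserves it. This shift
  puts all exponents between 3n + 20 and 5n + 20, so a sum of two exceeds every single one and the
  weights of generators differ from those of products and of 1.\<close>

definition expo :: "gen \<Rightarrow> nat" where "expo a = nat (4 * int n + 20 + offset a)"

lemma offset_bound: "a \<in> gens n \<Longrightarrow> \<bar>offset a\<bar> \<le> int n"
  using n3 by (cases a) auto

lemma int_expo: "a \<in> gens n \<Longrightarrow> int (expo a) = 4 * int n + 20 + offset a"
  using offset_bound[of a] by (simp add: expo_def)

lemma offset_inj: "offset a = offset b \<Longrightarrow> a = b"
  by (cases a; cases b) (auto split: if_splits)

definition t0 :: "gen \<Rightarrow> qbar" where "t0 a = 2 ^ expo a"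

lemma two_power_eq: "(2::qbar) ^ a = 2 ^ b \<longleftrightarrow> a = b"
proof -
  have "(2::qbar) ^ a = of_nat (2 ^ a)" "(2::qbar) ^ b = of_nat (2 ^ b)" by simp_all
  then show ?thesis by (simp only: of_nat_eq_iff) simp
qed

lemma rel_t0: "rel n t0"
proof (rule relI)
  have e: "t0 a * t0 b = t0 c * t0 d"
    if "a \<in> gens n" "b \<in> gens n" "c \<in> gens n" "d \<in> gens n" "offset a + offset b = offset c + offset d" for a b c d
  proof -
    have "int (expo a + expo b) = int (expo c + expo d)" using that int_expo by simp
    then have "expo a + expo b = expo c + expo d" by (simp only: of_nat_eq_iff)
    then show ?thesis by (simp add: t0_def flip: power_add)
  qed
  show "t0 a \<noteq> 0" for a by (simp add: t0_def)
  show "t0 (GU x False) * t0 (GU x True) = t0 (GY x) * t0 GE" for x by (rule e) auto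
  show "t0 (GY False) * t0 (GY True) = t0 GE ^ 2" unfolding power2_eq_square by (rule e) auto
  show "t0 (GP False k) * t0 (GP True k) = t0 GE ^ 2" if "k < n - 3" for k
    unfolding power2_eq_square by (rule e) (use that in auto)
qed

lemma expo_bounds: "a \<in> gens n \<Longrightarrow> 3 * n + 20 \<le> expo a \<and> expo a \<le> 5 * n + 20"
  using offset_bound[of a] int_expo[of a] by linarith

lemma expo_inj: assumes "a \<in> gens n" "b \<in> gens n" "expo a = expo b" shows "a = b"
  using offset_inj[of a b] int_expo[OF assms(1)] int_expo[OF assms(2)] assms(3) by simp

lemma t0_regular: assumes "a \<in> gens n" "d \<in> idxs n" "d \<noteq> Gen a" shows "wt t0 d \<noteq> wt t0 (Gen a)"
  using assms(2)
proof (cases rule: idxs_cases)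
  case 1
  then show ?thesis using expo_bounds[OF assms(1)] two_power_eq[of 0 "expo a"] by (auto simp: t0_def)
next
  case (2 b)
  then show ?thesis using assms expo_inj[of b a] by (auto simp: t0_def two_power_eq)
next
  case (3 b c)
  then have "wt t0 d = 2 ^ (expo b + expo c)" by (simp add: rel_wt[OF rel_t0] t0_def power_add)
  moreover have "expo b + expo c \<noteq> expo a" using expo_bounds[of a] expo_bounds[of b] expo_bounds[of c] 3 assms by auto
  ultimately show ?thesis by (simp add: t0_def two_power_eq)
qed

definition TK where "TK = KS.df ` {c. rel n c}"

lemma centralizer_t0:
  assumes f: "f \<in> alg_aut KK KS.ME"
    and comm: "\<And>v. v \<in> carrier KS.ME \<Longrightarrow> f (KS.df t0 v) = KS.df t0 (f v)"
  shows "f \<in> TK"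
proof -
  note D = KS_diagok[OF rel_t0]
  have "wt t0 a * mt f a d = wt t0 d * mt f a d" if a: "a \<in> idxs n" for a d
  proof -
    note m = psii_supp[OF supp_dl[OF a]]
    have "KS.psi (KS.df t0 (KS.psii (dl a))) = (\<lambda>d. wt t0 a * dl a d)"
      unfolding KS.psi_df(2)[OF D m(1)] m(2) by (auto simp: dl_def)
    then have "KS.psi (f (KS.df t0 (KS.psii (dl a)))) = (\<lambda>d. wt t0 a * mt f a d)"
      unfolding opK_psi[OF f KS.psi_df(1)[OF D m(1)], symmetric] mt_opK[OF f a]
      by (simp add: opK_smult[OF f] supp_dl a)
    moreover have "KS.psi (KS.df t0 (f (KS.psii (dl a)))) = (\<lambda>d. wt t0 d * mt f a d)"
      unfolding KS.psi_df(2)[OF D aut_mem[OF f m(1)]] mt_opK[OF f a] opK_def ..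
    ultimately have "(\<lambda>d. wt t0 a * mt f a d) = (\<lambda>d. wt t0 d * mt f a d)" using comm[OF m(1)] by simp
    from fun_cong[OF this, of d] show ?thesis .
  qed
  then obtain c where "rel n c" "\<forall>a\<in>idxs n. mt f a = (\<lambda>d. wt c a * dl a d)"
    using autsys_diagonal[OF autsys_mt[OF f], of t0] t0_regular by blast
  then have "f = KS.df c" using aut_eq_df[OF f] by blast
  then show ?thesis using \<open>rel n c\<close> by (auto simp: TK_def)
qed

end

section \<open>Rational curves in the torus\<close>

text \<open>\<open>LP D G\<close>: the function \<open>G\<close> is regular on the complement of the zeros of \<open>D\<close>.\<close>

definition LP :: "'f::field poly \<Rightarrow> ('f \<Rightarrow> 'f) \<Rightarrow> bool" where
  "LP D G \<longleftrightarrow> (\<exists>P N. \<forall>z. poly D z \<noteq> 0 \<longrightarrow> G z * poly D z ^ N = poly P z)"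

lemma LP_poly: "LP D (\<lambda>z. poly P z)"
  unfolding LP_def by (rule exI[of _ P], rule exI[of _ 0]) simp

lemma LP_const: "LP D (\<lambda>z. c)"
  using LP_poly[of D "[:c:]"] by simp

lemma LP_quot: "(\<And>z. poly D z \<noteq> 0 \<Longrightarrow> G z * poly D z = poly P z) \<Longrightarrow> LP D G"
  unfolding LP_def by (rule exI[of _ P], rule exI[of _ 1]) simp

lemma LP_add: assumes "LP D G" "LP D H" shows "LP D (\<lambda>z. G z + H z)"
proof -
  obtain P N where 1: "\<And>z. poly D z \<noteq> 0 \<Longrightarrow> G z * poly D z ^ N = poly P z" using assms(1) unfolding LP_def by blast
  obtain Q M where 2: "\<And>z. poly D z \<noteq> 0 \<Longrightarrow> H z * poly D z ^ M = poly Q z" using assms(2) unfolding LP_def by blast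
  show ?thesis unfolding LP_def
  proof (rule exI[of _ "P * D ^ M + Q * D ^ N"], rule exI[of _ "N + M"], intro allI impI)
    fix z assume z: "poly D z \<noteq> 0"
    show "(G z + H z) * poly D z ^ (N + M) = poly (P * D ^ M + Q * D ^ N) z"
      by (simp add: 1[OF z, symmetric] 2[OF z, symmetric] power_add algebra_simps)
  qed
qed

lemma LP_mult: assumes "LP D G" "LP D H" shows "LP D (\<lambda>z. G z * H z)"
proof -
  obtain P N where 1: "\<And>z. poly D z \<noteq> 0 \<Longrightarrow> G z * poly D z ^ N = poly P z" using assms(1) unfolding LP_def by blast
  obtain Q M where 2: "\<And>z. poly D z \<noteq> 0 \<Longrightarrow> H z * poly D z ^ M = poly Q z" using assms(2) unfolding LP_def by blast
  show ?thesis unfolding LP_def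
  proof (rule exI[of _ "P * Q"], rule exI[of _ "N + M"], intro allI impI)
    fix z assume z: "poly D z \<noteq> 0"
    show "G z * H z * poly D z ^ (N + M) = poly (P * Q) z"
      by (simp add: 1[OF z, symmetric] 2[OF z, symmetric] power_add algebra_simps)
  qed
qed

lemma LP_sum: "(\<And>x. x \<in> T \<Longrightarrow> LP D (G x)) \<Longrightarrow> LP D (\<lambda>z. \<Sum>x\<in>T. G x z)"
  by (induction T rule: infinite_finite_induct) (simp_all add: LP_const LP_add)

lemma LP_cong: assumes "\<And>z. poly D z \<noteq> 0 \<Longrightarrow> G z = H z" shows "LP D G \<longleftrightarrow> LP D H"
  unfolding LP_def using assms by simp

text \<open>A regular function on an open subset of the line vanishes if it vanishes at the rational
  points there. This carries statements from rational parameters to all parameters.\<close>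

lemma LP_zero:
  fixes D :: "'f::field_char_0 poly"
  assumes "LP D G" "D \<noteq> 0" "\<And>r. poly D (of_rat r) \<noteq> 0 \<Longrightarrow> G (of_rat r) = 0" "poly D z \<noteq> 0"
  shows "G z = 0"
proof -
  obtain P N where P: "\<And>z. poly D z \<noteq> 0 \<Longrightarrow> G z * poly D z ^ N = poly P z" using assms(1) unfolding LP_def by blast
  have "poly (P * D) (of_rat r) = poly 0 (of_rat r)" for r
    by (cases "poly D (of_rat r) = 0") (use P[of "of_rat r"] assms(3)[of r] in auto)
  then have "P * D = 0" by (rule poly_eqI_rat)
  then have "P = 0" using assms(2) by simp
  then show ?thesis using P[OF assms(4)] assms(4) by simp
qed

text \<open>Irreducibility of the affine line: two nonempty principal open sets meet, because a
  product of nonzero polynomials is nonzero.\<close>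

lemma LP_common_nonzero:
  fixes D :: "'f::field_char_0 poly"
  assumes "LP D G" "LP D H" "poly D x \<noteq> 0" "G x \<noteq> 0" "poly D y \<noteq> 0" "H y \<noteq> 0"
  shows "\<exists>z. poly D z \<noteq> 0 \<and> G z \<noteq> 0 \<and> H z \<noteq> 0"
proof (rule ccontr)
  assume "\<not> ?thesis"
  then have *: "poly D z \<noteq> 0 \<Longrightarrow> G z * H z = 0" for z by auto
  obtain P N where P: "\<And>z. poly D z \<noteq> 0 \<Longrightarrow> G z * poly D z ^ N = poly P z" using assms(1) unfolding LP_def by blast
  obtain Q M where Q: "\<And>z. poly D z \<noteq> 0 \<Longrightarrow> H z * poly D z ^ M = poly Q z" using assms(2) unfolding LP_def by blast
  have nz: "P \<noteq> 0" "Q \<noteq> 0" "D \<noteq> 0" using P[OF assms(3)] Q[OF assms(5)] assms by auto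
  have "poly (P * Q * D) z = 0" for z
    by (cases "poly D z = 0") (use P[of z] Q[of z] *[of z] in auto)
  then have "P * Q * D = 0" using poly_all_0_iff_0[of "P * Q * D"] by blast
  then show False using nz by simp
qed

lemma KT_ab_ops: "x \<in> carrier KK \<Longrightarrow> y \<in> carrier KK \<Longrightarrow> KT.ab (x \<oplus>\<^bsub>KK\<^esub> y) = KT.ab x + KT.ab y"
  "x \<in> carrier KK \<Longrightarrow> y \<in> carrier KK \<Longrightarrow> KT.ab (x \<otimes>\<^bsub>KK\<^esub> y) = KT.ab x * KT.ab y"
  by (metis KT.ab_rep KT.rep_ab KT.rep_ops(3)) (metis KT.ab_rep KT.rep_ab KT.rep_ops(4))

lemma KT_ab_zero_iff: "x \<in> carrier KK \<Longrightarrow> KT.ab x = 0 \<longleftrightarrow> x = \<zero>\<^bsub>KK\<^esub>"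
  by (metis KT.ab_rep KT.rep_ab KT.rep_ops(1))

lemma poly_funs_sum:
  assumes "finite T" "\<And>x. x \<in> T \<Longrightarrow> \<exists>p\<in>poly_funs KK (carrier KK) F. \<forall>s\<in>S. p s = Kr (G x s)"
  shows "\<exists>p\<in>poly_funs KK (carrier KK) F. \<forall>s\<in>S. p s = Kr (\<Sum>x\<in>T. G x s)"
  using assms
proof (induction T rule: finite_induct)
  case empty
  have "(\<lambda>_. Kr 0) \<in> poly_funs KK (carrier KK) F" by (rule poly_funs.const) simp
  then show ?case by (rule bexI[rotated]) simp
next
  case (insert x T)
  then obtain p q where "p \<in> poly_funs KK (carrier KK) F" "\<forall>s\<in>S. p s = Kr (G x s)"
    and "q \<in> poly_funs KK (carrier KK) F" "\<forall>s\<in>S. q s = Kr (\<Sum>x\<in>T. G x s)" by (metis insertI1 insertI2)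
  then show ?case using insert.hyps by (intro bexI[OF _ poly_funs.add[of p _ _ _ q]]) (simp_all add: Kr_ops)
qed

lemma poly_funs_scale:
  assumes "\<exists>p\<in>poly_funs KK (carrier KK) F. \<forall>s\<in>S. p s = Kr (G s)"
  shows "\<exists>p\<in>poly_funs KK (carrier KK) F. \<forall>s\<in>S. p s = Kr (c * G s)"
proof -
  obtain p where p: "p \<in> poly_funs KK (carrier KK) F" "\<forall>s\<in>S. p s = Kr (G s)" using assms by blast
  show ?thesis
    by (rule bexI[OF _ poly_funs.mult[OF poly_funs.const[of "Kr c"] p(1)]]) (use p(2) in \<open>simp_all add: Kr_ops\<close>)
qed

context rat_form
begin

abbreviation PF where "PF \<equiv> poly_funs KK (carrier KK) (entries KK B)"
abbreviation Top where "Top \<equiv> Aut_topology kQ (Aalg n) B kQ (\<lambda>c. c)"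

lemma Top_eq: "Top = topology_generated_by {{s \<in> alg_aut KK KS.ME. p s \<noteq> \<zero>\<^bsub>KK\<^esub>} | p. p \<in> PF}"
  by (simp add: Aut_topology_def zariski_def geom_Aut_eq)

lemma entries_closed: "f \<in> alg_aut KK KS.ME \<Longrightarrow> g \<in> entries KK B \<Longrightarrow> g f \<in> carrier KK"
proof -
  assume f: "f \<in> alg_aut KK KS.ME" and "g \<in> entries KK B"
  then obtain x y where "g = mat_entry KK B x y" "x \<in> B" "y \<in> B" unfolding entries_def by blast
  then show "g f \<in> carrier KK"
    using KS.ME_D[OF aut_mem[OF f KS.basis_vec_mem]] by (simp add: mat_entry_def)
qed

lemma PF_closed: "q \<in> PF \<Longrightarrow> f \<in> alg_aut KK KS.ME \<Longrightarrow> q f \<in> carrier KK"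
proof -
  assume q: "q \<in> PF" and f: "f \<in> alg_aut KK KS.ME"
  show "q f \<in> carrier KK"
    using q
  proof induction
    case (coord g)
    show ?case by (rule entries_closed[OF f coord])
  qed simp_all
qed

lemma df_mem: "rel n c \<Longrightarrow> KS.df c \<in> alg_aut KK KS.ME"
  by (rule KS.df_aut[OF KS_diagok])

lemma topspace_Top: "topspace Top = alg_aut KK KS.ME"
proof -
  let ?o = "\<lambda>_ :: ((nat \<Rightarrow> complex) \<Rightarrow> complex clos) \<Rightarrow> ((nat \<Rightarrow> complex) \<Rightarrow> complex clos). \<one>\<^bsub>KK\<^esub>"
  have o: "?o \<in> PF" by (rule poly_funs.const) simp
  have "\<one>\<^bsub>KK\<^esub> \<noteq> \<zero>\<^bsub>KK\<^esub>" by (rule domain.one_not_zero[OF field.axioms(1)[OF field_KK]])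
  then have "alg_aut KK KS.ME = {s \<in> alg_aut KK KS.ME. ?o s \<noteq> \<zero>\<^bsub>KK\<^esub>}" by simp
  then have "alg_aut KK KS.ME \<in> {{s \<in> alg_aut KK KS.ME. p s \<noteq> \<zero>\<^bsub>KK\<^esub>} | p. p \<in> PF}"
    using o by (intro CollectI exI[of _ ?o] conjI)
  then have "alg_aut KK KS.ME \<subseteq> \<Union>{{s \<in> alg_aut KK KS.ME. p s \<noteq> \<zero>\<^bsub>KK\<^esub>} | p. p \<in> PF}" by (rule Union_upper)
  moreover have "\<Union>{{s \<in> alg_aut KK KS.ME. p s \<noteq> \<zero>\<^bsub>KK\<^esub>} | p. p \<in> PF} \<subseteq> alg_aut KK KS.ME" by (rule Union_least) force
  ultimately show ?thesis unfolding Top_eq topology_generated_by_topspace by (rule equalityI[rotated])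
qed

text \<open>As K is a domain, the intersection of two generating sets is the generating set of the
  product. So the sets that generate the topology already form a base.\<close>

lemma open_Top_basic:
  assumes "openin Top U" "x \<in> U"
  shows "x \<in> alg_aut KK KS.ME \<and> (\<exists>p\<in>PF. p x \<noteq> \<zero>\<^bsub>KK\<^esub> \<and> (\<forall>s\<in>alg_aut KK KS.ME. p s \<noteq> \<zero>\<^bsub>KK\<^esub> \<longrightarrow> s \<in> U))"
proof -
  have "generate_topology_on {{s \<in> alg_aut KK KS.ME. p s \<noteq> \<zero>\<^bsub>KK\<^esub>} | p. p \<in> PF} U"
    using assms(1) by (simp add: Top_eq openin_topology_generated_by_iff)
  then show ?thesis using assms(2)
  proof (induction arbitrary: x)
    case Empty
    then show ?case by simp
  next
    case (Int a b)
    obtain p where p: "x \<in> alg_aut KK KS.ME" "p \<in> PF" "p x \<noteq> \<zero>\<^bsub>KK\<^esub>" "\<And>s. s \<in> alg_aut KK KS.ME \<Longrightarrow> p s \<noteq> \<zero>\<^bsub>KK\<^esub> \<Longrightarrow> s \<in> a"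
      using Int.IH(1)[of x] Int.prems by blast
    obtain q where q: "q \<in> PF" "q x \<noteq> \<zero>\<^bsub>KK\<^esub>" "\<And>s. s \<in> alg_aut KK KS.ME \<Longrightarrow> q s \<noteq> \<zero>\<^bsub>KK\<^esub> \<Longrightarrow> s \<in> b"
      using Int.IH(2)[of x] Int.prems by blast
    show ?case
    proof (intro conjI p(1) bexI[OF _ poly_funs.mult[OF p(2) q(1)]] ballI impI IntI)
      show "p x \<otimes>\<^bsub>KK\<^esub> q x \<noteq> \<zero>\<^bsub>KK\<^esub>"
        using domain.integral[OF field.axioms(1)[OF field_KK], of "p x" "q x"] p(3) q(2)
          PF_closed[OF p(2,1)] PF_closed[OF q(1) p(1)] by metis
      fix s assume s: "s \<in> alg_aut KK KS.ME" "p s \<otimes>\<^bsub>KK\<^esub> q s \<noteq> \<zero>\<^bsub>KK\<^esub>"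
      note c = PF_closed[OF p(2) s(1)] PF_closed[OF q(1) s(1)]
      show "s \<in> a" using s(2) c by (intro p(4)[OF s(1)]) auto
      show "s \<in> b" using s(2) c by (intro q(3)[OF s(1)]) auto
    qed
  next
    case (UN \<K>)
    then obtain k where k: "k \<in> \<K>" "x \<in> k" by blast
    then show ?case using UN.IH[OF k] by blast
  next
    case (Basis s)
    then show ?case by blast
  qed
qed

text \<open>A morphism to the torus from the open part of the line where D does not vanish.\<close>

definition curve :: "qbar poly \<Rightarrow> (qbar \<Rightarrow> gen \<Rightarrow> qbar) \<Rightarrow> bool" where
  "curve D k \<longleftrightarrow> D \<noteq> 0 \<and> (\<forall>z. poly D z \<noteq> 0 \<longrightarrow> rel n (k z)) \<and> (\<forall>a\<in>gens n. LP D (\<lambda>z. k z a))"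

lemma curve_scale: assumes "curve D k" "rel n c" shows "curve D (\<lambda>z a. c a * k z a)"
  using assms by (auto simp: curve_def intro!: rel_mult LP_mult LP_const)

lemma LP_wt: assumes "curve D k" "d \<in> idxs n" shows "LP D (\<lambda>z. wt (k z) d)"
  using assms(2)
proof (cases rule: idxs_cases)
  case 1
  then show ?thesis by (simp add: LP_const)
next
  case (2 a)
  then show ?thesis using assms(1) by (simp add: curve_def)
next
  case (3 a b)
  have "LP D (\<lambda>z. wt (k z) d) \<longleftrightarrow> LP D (\<lambda>z. k z a * k z b)"
  proof (rule LP_cong)
    fix z assume "poly D z \<noteq> 0"
    then have "rel n (k z)" using assms(1) by (simp add: curve_def)
    then show "wt (k z) d = k z a * k z b" unfolding 3(4) by (rule rel_wt) (use 3 in auto)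
  qed
  then show ?thesis using 3 assms(1) by (simp add: curve_def LP_mult)
qed

text \<open>Matrix entries of diagonal maps are linear in the weights, and the weights are regular
  along a curve; sums and products of regular functions are regular.\<close>

lemma LP_PF: assumes "curve D k" "q \<in> PF" shows "LP D (\<lambda>z. KT.ab (q (KS.df (k z))))"
proof -
  have r: "KS.df (k z) \<in> alg_aut KK KS.ME" if "poly D z \<noteq> 0" for z
    using df_mem assms(1) that by (auto simp: curve_def)
  show ?thesis using assms(2)
  proof induction
    case (const c)
    then show ?case by (simp add: LP_const)
  next
    case (coord f)
    then obtain x y where f: "f = mat_entry KK B x y" "x \<in> B" "y \<in> B" by (auto simp: entries_def)
    have "LP D (\<lambda>z. KT.ab (f (KS.df (k z)))) \<longleftrightarrow> LP D (\<lambda>z. \<Sum>d\<in>idxs n. wt (k z) d * iK (xF x d) * iK (cf d y))"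
    proof (rule LP_cong)
      fix z assume "poly D z \<noteq> 0"
      then have "rel n (k z)" using assms(1) by (simp add: curve_def)
      then show "KT.ab (f (KS.df (k z))) = (\<Sum>d\<in>idxs n. wt (k z) d * iK (xF x d) * iK (cf d y))"
        using KS.mat_entry_df(2)[OF KS_diagok f(2,3)] f(1) by simp
    qed
    also have "\<dots>" by (intro LP_sum LP_mult LP_const LP_wt[OF assms(1)])
    finally show ?case .
  next
    case (add p q)
    have "LP D (\<lambda>z. KT.ab (p (KS.df (k z)) \<oplus>\<^bsub>KK\<^esub> q (KS.df (k z)))) \<longleftrightarrow> LP D (\<lambda>z. KT.ab (p (KS.df (k z))) + KT.ab (q (KS.df (k z))))"
      by (rule LP_cong) (simp add: KT_ab_ops PF_closed[OF add.hyps(1) r] PF_closed[OF add.hyps(2) r])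
    then show ?case using LP_add[OF add.IH] by (rule iffD2)
  next
    case (mult p q)
    have "LP D (\<lambda>z. KT.ab (p (KS.df (k z)) \<otimes>\<^bsub>KK\<^esub> q (KS.df (k z)))) \<longleftrightarrow> LP D (\<lambda>z. KT.ab (p (KS.df (k z))) * KT.ab (q (KS.df (k z))))"
      by (rule LP_cong) (simp add: KT_ab_ops PF_closed[OF mult.hyps(1) r] PF_closed[OF mult.hyps(2) r])
    then show ?case using LP_mult[OF mult.IH] by (rule iffD2)
  qed
qed

text \<open>A separation would give two nonempty principal open sets of parameters without a common
  point, against the irreducibility of the line.\<close>

lemma curve_connected:
  assumes "curve D k" shows "connectedin Top ((\<lambda>z. KS.df (k z)) ` {z. poly D z \<noteq> 0})"
  unfolding connectedin
proof (intro conjI notI)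
  have r: "KS.df (k z) \<in> alg_aut KK KS.ME" if "poly D z \<noteq> 0" for z
    using df_mem assms that by (auto simp: curve_def)
  show "(\<lambda>z. KS.df (k z)) ` {z. poly D z \<noteq> 0} \<subseteq> topspace Top" unfolding topspace_Top using r by auto
  assume "\<exists>E1 E2. openin Top E1 \<and> openin Top E2 \<and> (\<lambda>z. KS.df (k z)) ` {z. poly D z \<noteq> 0} \<subseteq> E1 \<union> E2 \<and>
    E1 \<inter> E2 \<inter> (\<lambda>z. KS.df (k z)) ` {z. poly D z \<noteq> 0} = {} \<and> E1 \<inter> (\<lambda>z. KS.df (k z)) ` {z. poly D z \<noteq> 0} \<noteq> {} \<and>
    E2 \<inter> (\<lambda>z. KS.df (k z)) ` {z. poly D z \<noteq> 0} \<noteq> {}"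
  then obtain E1 E2 x y where E: "openin Top E1" "openin Top E2"
      "E1 \<inter> E2 \<inter> (\<lambda>z. KS.df (k z)) ` {z. poly D z \<noteq> 0} = {}"
    and x: "poly D x \<noteq> 0" "KS.df (k x) \<in> E1" and y: "poly D y \<noteq> 0" "KS.df (k y) \<in> E2"
    by blast
  obtain p where p: "p \<in> PF" "p (KS.df (k x)) \<noteq> \<zero>\<^bsub>KK\<^esub>" "\<And>s. s \<in> alg_aut KK KS.ME \<Longrightarrow> p s \<noteq> \<zero>\<^bsub>KK\<^esub> \<Longrightarrow> s \<in> E1"
    using open_Top_basic[OF E(1) x(2)] by blast
  obtain q where q: "q \<in> PF" "q (KS.df (k y)) \<noteq> \<zero>\<^bsub>KK\<^esub>" "\<And>s. s \<in> alg_aut KK KS.ME \<Longrightarrow> q s \<noteq> \<zero>\<^bsub>KK\<^esub> \<Longrightarrow> s \<in> E2"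
    using open_Top_basic[OF E(2) y(2)] by blast
  have "\<exists>z. poly D z \<noteq> 0 \<and> KT.ab (p (KS.df (k z))) \<noteq> 0 \<and> KT.ab (q (KS.df (k z))) \<noteq> 0"
    by (rule LP_common_nonzero[OF LP_PF[OF assms p(1)] LP_PF[OF assms q(1)] x(1) _ y(1)])
      (simp_all add: KT_ab_zero_iff PF_closed[OF p(1) r[OF x(1)]] PF_closed[OF q(1) r[OF y(1)]] p(2) q(2) y(1))
  then obtain z where z: "poly D z \<noteq> 0" "KT.ab (p (KS.df (k z))) \<noteq> 0" "KT.ab (q (KS.df (k z))) \<noteq> 0" by blast
  have "KS.df (k z) \<in> E1"
    using z(2) by (intro p(3) r[OF z(1)]) (simp add: KT_ab_zero_iff PF_closed[OF p(1) r[OF z(1)]])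
  moreover have "KS.df (k z) \<in> E2"
    using z(3) by (intro q(3) r[OF z(1)]) (simp add: KT_ab_zero_iff PF_closed[OF q(1) r[OF z(1)]])
  ultimately show False using E(3) z(1) by blast
qed

subsection \<open>One-parameter subgroups\<close>

definition gpc :: "nat \<Rightarrow> 'f::field \<Rightarrow> gen \<Rightarrow> 'f" where
  "gpc i p a = (if a = GP False i then p else if a = GP True i then 1 / p else 1)"

text \<open>The signs s are the exponents of \<alpha> on the u; e gets weight 1, so u u' = y e
  forces the weights of the y. The relation y y' = 1 holds for s in \<open>signs\<close>, as such an
  s takes each value at two of the four u.\<close>

fun muc :: "(bool \<Rightarrow> bool \<Rightarrow> bool) \<Rightarrow> 'f::field \<Rightarrow> gen \<Rightarrow> 'f" where
  "muc s \<alpha> (GU a b) = (if s a b then 1 / \<alpha> else \<alpha>)"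
| "muc s \<alpha> (GY a) = (if s a False then 1 / \<alpha> else \<alpha>) * (if s a True then 1 / \<alpha> else \<alpha>)"
| "muc s \<alpha> _ = 1"

text \<open>The three nontrivial characters of the Galois group, transferred to the u.\<close>

definition signs :: "(bool \<Rightarrow> bool \<Rightarrow> bool) set" where
  "signs = {\<lambda>a b. a, \<lambda>a b. b, \<lambda>a b. a \<noteq> b}"

lemma rel_scal: "p \<noteq> 0 \<Longrightarrow> rel n (\<lambda>_. p :: 'f::field)"
  by (rule relI) (auto simp: power2_eq_square)

lemma rel_gpc: "p \<noteq> 0 \<Longrightarrow> rel n (gpc i p)"
  by (rule relI) (auto simp: gpc_def)

lemma rel_muc: "\<alpha> \<noteq> 0 \<Longrightarrow> s \<in> signs \<Longrightarrow> rel n (muc s \<alpha>)"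
proof (rule relI)
  fix a assume "\<alpha> \<noteq> 0" then show "muc s \<alpha> a \<noteq> 0" by (cases a) auto
qed (auto simp: signs_def)

lemma rel_cong: assumes "\<And>a. a \<in> gens n \<Longrightarrow> c a = c' a" "rel n c" shows "rel n c'"
proof (rule relI)
  note e = rel_eqs[OF assms(2)]
  show "c' a \<noteq> 0" if "a \<in> gens n" for a using rel_nz[OF assms(2) that] assms(1)[OF that] by simp
  show "c' (GU x False) * c' (GU x True) = c' (GY x) * c' GE" for x using e(1)[of x] by (simp add: assms(1))
  show "c' (GY False) * c' (GY True) = (c' GE)\<^sup>2" using e(2) by (simp add: assms(1))
  show "c' (GP False i) * c' (GP True i) = (c' GE)\<^sup>2" if "i < n - 3" for i using e(3)[OF that] that by (simp add: assms(1))
qed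

text \<open>Three sign characters suffice because the weights of the \<open>u\<close>, divided by that of \<open>e\<close>, have
  product \<open>1\<close>; recovering the parameters takes square roots.\<close>

lemma torus_induct:
  assumes c: "rel n (c :: gen \<Rightarrow> qbar)" and one: "P (\<lambda>_. 1)"
    and cong: "\<And>c c'. P c \<Longrightarrow> (\<And>a. a \<in> gens n \<Longrightarrow> c a = c' a) \<Longrightarrow> P c'"
    and scal: "\<And>c s. P c \<Longrightarrow> s \<noteq> 0 \<Longrightarrow> P (\<lambda>a. c a * s)"
    and gp: "\<And>c i p. P c \<Longrightarrow> p \<noteq> 0 \<Longrightarrow> P (\<lambda>a. c a * gpc i p a)"
    and mu: "\<And>c s \<alpha>. P c \<Longrightarrow> s \<in> signs \<Longrightarrow> \<alpha> \<noteq> 0 \<Longrightarrow> P (\<lambda>a. c a * muc s \<alpha> a)"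
  shows "P c"
proof -
  define s where "s = c GE"
  define w where "w a b = c (GU a b) / s" for a b
  define p where "p i = c (GP False i) / s" for i
  have nz: "c a \<noteq> 0" if "a \<in> gens n" for a using rel_nz[OF c that] .
  have s: "s \<noteq> 0" by (simp add: s_def nz)
  have wnz: "w a b \<noteq> 0" for a b by (simp add: w_def nz s)
  note r = rel_eqs[OF c]
  have wY: "w a False * w a True * s = c (GY a)" for a
    using r(1)[of a] s by (simp add: w_def s_def field_simps)
  have "c (GY False) * c (GY True) = s ^ 2" using r(2) by (simp add: s_def)
  then have w4: "w False False * w False True * (w True False * w True True) = 1"
    unfolding wY[symmetric] using s by (simp add: power2_eq_square field_simps)
  \<comment> \<open>The four quotients w have to become \<alpha>\<beta>\<gamma>,
    \<alpha>/(\<beta>\<gamma>), \<beta>/(\<alpha>\<gamma>) and \<gamma>/(\<alpha>\<beta>). The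
    product of the first two is \<alpha>^2, that of the first and third is \<beta>^2, the first then
    gives \<gamma>, and the fourth is right because all four have product 1.\<close>
  obtain \<alpha> where \<alpha>: "\<alpha> * \<alpha> = w False False * w False True" using exists_sqrt by blast
  obtain \<beta> where \<beta>: "\<beta> * \<beta> = w False False * w True False" using exists_sqrt by blast
  have nz2: "\<alpha> \<noteq> 0" "\<beta> \<noteq> 0" using \<alpha> \<beta> wnz by auto
  define \<gamma> where "\<gamma> = w False False / (\<alpha> * \<beta>)"
  have \<gamma>: "\<gamma> \<noteq> 0" using nz2 wnz by (simp add: \<gamma>_def)
  define f where "f m a = (case a of GP b i \<Rightarrow> if i < m then gpc i (p i) a else 1 | _ \<Rightarrow> 1)" for m a
  have Pf: "P (f m)" if "m \<le> n - 3" for m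
    using that
  proof (induction m)
    case 0
    show ?case by (rule cong[OF one]) (auto simp: f_def split: gen.splits)
  next
    case (Suc m)
    have "p m \<noteq> 0" using Suc.prems nz s by (simp add: p_def)
    from gp[OF _ this] Suc show ?case
      by (intro cong[of "\<lambda>a. f m a * gpc m (p m) a" "f (Suc m)"]) (auto simp: f_def gpc_def split: gen.splits)
  qed
  define h where "h a = f (n - 3) a * s * muc (\<lambda>a b. a) \<alpha> a * muc (\<lambda>a b. b) \<beta> a * muc (\<lambda>a b. a \<noteq> b) \<gamma> a" for a
  have "P h"
    unfolding h_def by (intro mu scal Pf s \<gamma> nz2) (auto simp: signs_def)
  moreover have "h a = c a" if a: "a \<in> gens n" for a
  proof -
    have U: "h (GU a b) = c (GU a b)" for a b
    proof -
      have g: "\<alpha> * \<beta> * \<gamma> = w False False" using nz2 by (simp add: \<gamma>_def)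
      have "\<alpha> / (\<beta> * \<gamma>) = w False True" using \<alpha> g nz2 \<gamma> wnz[of False False]
        by (simp add: field_simps) (metis (no_types, opaque_lifting) mult.assoc mult.left_commute mult_left_cancel)
      moreover have "\<beta> / (\<alpha> * \<gamma>) = w True False" using \<beta> g nz2 \<gamma> wnz[of False False]
        by (simp add: field_simps) (metis (no_types, opaque_lifting) mult.assoc mult.left_commute mult_left_cancel)
      moreover have "\<gamma> / (\<alpha> * \<beta>) = w True True"
      proof -
        have "\<alpha> * \<alpha> * (\<beta> * \<beta>) * w True True = w False False"
          unfolding \<alpha> \<beta> using w4 by (simp add: ac_simps)
        then have "w False False / (\<alpha> * \<beta> * (\<alpha> * \<beta>)) = w True True"
          using nz2 by (simp add: field_simps)
        then show ?thesis using nz2 by (simp add: \<gamma>_def)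
      qed
      moreover have "h (GU a b) = s * (if a then 1 / \<alpha> else \<alpha>) * (if b then 1 / \<beta> else \<beta>) * (if a \<noteq> b then 1 / \<gamma> else \<gamma>)"
        by (simp add: h_def f_def)
      ultimately have "h (GU a b) = s * w a b" using g by (cases a; cases b) (auto simp: divide_inverse ac_simps)
      then show ?thesis using s by (simp add: w_def)
    qed
    show "h a = c a"
    proof (cases a)
      case (GY x)
      have "h (GY x) * s = h (GU x False) * h (GU x True)"
        by (simp add: h_def f_def)
      then have "h (GY x) * s = c (GY x) * s" unfolding U r(1) by (simp add: s_def)
      then show ?thesis using s GY by simp
    next
      case GE
      then show ?thesis by (simp add: h_def f_def s_def)
    next
      case (GP b i)
      then have i: "i < n - 3" using a by simp
      have "c (GP False i) * c (GP True i) = s ^ 2" using r(3)[OF i] by (simp add: s_def)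
      moreover have "c (GP False i) \<noteq> 0" using nz i by simp
      ultimately show ?thesis using GP i s
        by (cases b) (auto simp: h_def f_def gpc_def p_def field_simps power2_eq_square)
    qed (use U in simp)
  qed
  ultimately show ?thesis by (rule cong)
qed

lemma LP_X: "LP [:0, 1:] (\<lambda>z. z)" "LP [:0, 1:] (\<lambda>z. 1 / z)"
  using LP_poly[of "[:0, 1:]" "[:0, 1:]"] by (simp, intro LP_quot[of _ _ 1]) simp

lemma curve_scal: "curve [:0, 1:] (\<lambda>z _. z)"
  by (auto simp: curve_def rel_scal LP_X)

lemma curve_gpc: "curve [:0, 1:] (gpc i)"
  unfolding curve_def
proof (intro conjI ballI allI impI)
  fix a show "LP [:0, 1:] (\<lambda>z. gpc i z a)"
    unfolding gpc_def by (cases "a = GP False i"; cases "a = GP True i") (simp_all add: LP_X LP_const)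
qed (simp_all add: rel_gpc)

lemma LP_muc: assumes "LP D f" "LP D (\<lambda>z. 1 / f z)" shows "LP D (\<lambda>z. muc s (f z) a)"
proof -
  have i: "LP D (\<lambda>z. if b then 1 / f z else f z)" for b using assms by (cases b) simp_all
  show ?thesis by (cases a) (simp_all only: muc.simps, auto intro!: LP_const LP_mult i assms)
qed

lemma curve_muc: "s \<in> signs \<Longrightarrow> curve [:0, 1:] (muc s)"
  by (auto simp: curve_def rel_muc LP_muc LP_X)

text \<open>Each factor of \<open>torus_induct\<close> is reached from 1 along a one-parameter
  subgroup. Its translate by c is a connected curve, so the induction never leaves the component of
  the identity.\<close>

lemma TK_subset_geom_G: "TK \<subseteq> geom_G kQ (Aalg n) B kQ (\<lambda>c. c)"
proof
  fix f assume "f \<in> TK"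
  then obtain c where c: "rel n c" "f = KS.df c" by (auto simp: TK_def)
  let ?C = "connected_component_of Top (KS.df (\<lambda>_. 1))"
  \<comment> \<open>The parameter 1 gives the point c itself and the parameter z the
    product.\<close>
  have step: "rel n (\<lambda>a. c a * k z a) \<and> ?C (KS.df (\<lambda>a. c a * k z a))"
    if "rel n c \<and> ?C (KS.df c)" "curve [:0, 1:] k" "\<And>a. a \<in> gens n \<Longrightarrow> k 1 a = 1" "z \<noteq> 0" for c k z
  proof -
    let ?S = "(\<lambda>z. KS.df (\<lambda>a. c a * k z a)) ` {z. poly [:0, 1:] z \<noteq> 0}"
    have rc: "rel n c" using that(1) by (rule conjunct1)
    have "KS.df (\<lambda>a. c a * k 1 a) = KS.df c" by (rule KS.df_cong) (simp add: that(3))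
    moreover have "KS.df (\<lambda>a. c a * k 1 a) \<in> ?S" by (rule imageI) simp
    ultimately have 1: "KS.df c \<in> ?S" by (simp only:)
    have 2: "KS.df (\<lambda>a. c a * k z a) \<in> ?S" by (rule imageI) (simp add: that(4))
    have "connected_component_of Top (KS.df c) (KS.df (\<lambda>a. c a * k z a))"
      unfolding connected_component_of_def
      by (intro exI[of _ ?S] conjI curve_connected[OF curve_scale[OF that(2) rc]] 1 2)
    from connected_component_of_trans[OF conjunct2[OF that(1)] this]
    have "?C (KS.df (\<lambda>a. c a * k z a))" .
    moreover have "rel n (k z)" using that(2,4) by (simp add: curve_def)
    ultimately show ?thesis using rel_mult[OF rc] by blast
  qed
  have "rel n c \<and> ?C (KS.df c)"
    using c(1)
  proof (rule torus_induct)
    show "rel n (\<lambda>_. 1) \<and> ?C (KS.df (\<lambda>_. 1))"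
      by (simp add: rel_one connected_component_of_refl topspace_Top df_mem)
    show "rel n c' \<and> ?C (KS.df c')" if "rel n c \<and> ?C (KS.df c)" "\<And>a. a \<in> gens n \<Longrightarrow> c a = c' a" for c c'
      using that rel_cong[of c c'] KS.df_cong[of c c'] by auto
    show "rel n (\<lambda>a. c a * s) \<and> ?C (KS.df (\<lambda>a. c a * s))" if "rel n c \<and> ?C (KS.df c)" "s \<noteq> 0" for c s
      using step[OF that(1) curve_scal _ that(2)] by simp
    show "rel n (\<lambda>a. c a * gpc i p a) \<and> ?C (KS.df (\<lambda>a. c a * gpc i p a))" if "rel n c \<and> ?C (KS.df c)" "p \<noteq> 0" for c i p
      by (rule step[OF that(1) curve_gpc _ that(2)]) (simp add: gpc_def)
    show "rel n (\<lambda>a. c a * muc s \<alpha> a) \<and> ?C (KS.df (\<lambda>a. c a * muc s \<alpha> a))" if "rel n c \<and> ?C (KS.df c)" "s \<in> signs" "\<alpha> \<noteq> 0" for c s \<alpha>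
    proof (rule step[OF that(1) curve_muc[OF that(2)] _ that(3)])
      show "muc s 1 a = 1" for a by (cases a) auto
    qed
  qed
  moreover have "KS.df (\<lambda>_. 1) = (\<lambda>v \<in> B \<rightarrow>\<^sub>E carrier KK. v)" by (simp add: KS.df_one KS.ME_carrier)
  ultimately show "f \<in> geom_G kQ (Aalg n) B kQ (\<lambda>c. c)" unfolding geom_G_def using c(2) by simp
qed

lemma geom_G_aut: "g \<in> geom_G kQ (Aalg n) B kQ (\<lambda>c. c) \<Longrightarrow> g \<in> alg_aut KK KS.ME"
  using connected_component_of_subset_topspace[of Top] unfolding geom_G_def topspace_Top by blast

lemma mt_poly_fun: "\<exists>p\<in>PF. \<forall>f\<in>alg_aut KK KS.ME. p f = Kr (r * mt f d e)"
proof (rule poly_funs_scale)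
  show "\<exists>p\<in>PF. \<forall>f\<in>alg_aut KK KS.ME. p f = Kr (mt f d e)"
    unfolding mt_def
  proof (intro poly_funs_sum finB poly_funs_scale)
    fix x y assume xy: "x \<in> B" "y \<in> B"
    then have e: "mat_entry KK B x y \<in> entries KK B" by (auto simp: entries_def)
    show "\<exists>p\<in>PF. \<forall>f\<in>alg_aut KK KS.ME. p f = Kr (KT.ab (mat_entry KK B x y f))"
      by (rule bexI[OF _ poly_funs.coord[OF e]]) (use KT.rep_ab[OF entries_closed[OF _ e]] in simp)
  qed
qed

text \<open>The torus is the centralizer of \<open>t0\<close>, which in the split basis is described
  by linear equations. This is why it is closed.\<close>

lemma TK_iff: "f \<in> TK \<longleftrightarrow> f \<in> alg_aut KK KS.ME \<and> (\<forall>a\<in>idxs n. \<forall>d\<in>idxs n. (wt t0 a - wt t0 d) * mt f a d = 0)"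
proof
  assume "f \<in> TK"
  then obtain c where c: "rel n c" "f = KS.df c" by (auto simp: TK_def)
  then show "f \<in> alg_aut KK KS.ME \<and> (\<forall>a\<in>idxs n. \<forall>d\<in>idxs n. (wt t0 a - wt t0 d) * mt f a d = 0)"
    by (auto simp: df_mem mt_df dl_def)
next
  assume f: "f \<in> alg_aut KK KS.ME \<and> (\<forall>a\<in>idxs n. \<forall>d\<in>idxs n. (wt t0 a - wt t0 d) * mt f a d = 0)"
  then obtain c where "rel n c" "\<forall>a\<in>idxs n. mt f a = (\<lambda>d. wt c a * dl a d)"
    using autsys_diagonal[OF autsys_mt, of f t0] t0_regular by (auto simp: left_diff_distrib)
  then have "f = KS.df c" using aut_eq_df f by blast
  then show "f \<in> TK" using \<open>rel n c\<close> by (auto simp: TK_def)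
qed

lemma closed_TK: "closedin Top TK"
proof -
  define p where "p a d = (SOME p. p \<in> PF \<and> (\<forall>f\<in>alg_aut KK KS.ME. p f = Kr ((wt t0 a - wt t0 d) * mt f a d)))" for a d
  have p: "p a d \<in> PF" "f \<in> alg_aut KK KS.ME \<Longrightarrow> p a d f = Kr ((wt t0 a - wt t0 d) * mt f a d)" for a d f
    using someI_ex[OF mt_poly_fun[of "wt t0 a - wt t0 d" a d, unfolded Bex_def]] unfolding p_def by simp_all
  have "openin Top {s \<in> alg_aut KK KS.ME. p a d s \<noteq> \<zero>\<^bsub>KK\<^esub>}" for a d
    unfolding Top_eq by (rule topology_generated_by_Basis) (use p(1) in blast)
  then have "openin Top (\<Union>a\<in>idxs n. \<Union>d\<in>idxs n. {s \<in> alg_aut KK KS.ME. p a d s \<noteq> \<zero>\<^bsub>KK\<^esub>})"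
    by (intro openin_Union) auto
  moreover have "(\<Union>a\<in>idxs n. \<Union>d\<in>idxs n. {s \<in> alg_aut KK KS.ME. p a d s \<noteq> \<zero>\<^bsub>KK\<^esub>}) = topspace Top - TK"
  proof -
    have "{s \<in> alg_aut KK KS.ME. p a d s \<noteq> \<zero>\<^bsub>KK\<^esub>} = {s \<in> alg_aut KK KS.ME. (wt t0 a - wt t0 d) * mt s a d \<noteq> 0}" for a d
      by (rule Collect_cong) (metis p(2) Kr_eq_zero_iff)
    then show ?thesis unfolding topspace_Top TK_iff[abs_def] set_diff_eq by (simp only:) (auto simp only: TK_iff)
  qed
  moreover have "TK \<subseteq> topspace Top" unfolding topspace_Top using TK_iff by (intro subsetI) simp
  ultimately show ?thesis unfolding closedin_def by simp
qed

subsection \<open>Density of the rational points of the torus\<close>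

definition vanQ where
  "vanQ q \<longleftrightarrow> (\<forall>c. rational c \<longrightarrow> q (KS.df (\<lambda>a. iK (c a))) = \<zero>\<^bsub>KK\<^esub>)"

text \<open>The point c lies in the Zariski closure of the rational points of the torus, and so do
  its translates by rational points r. With the translates built in, the property passes to
  products: rational values of a curve are absorbed into r.\<close>

definition dense :: "(gen \<Rightarrow> qbar) \<Rightarrow> bool" where
  "dense c \<longleftrightarrow> rel n c \<and> (\<forall>r q. rational r \<longrightarrow> q \<in> PF \<longrightarrow> vanQ q \<longrightarrow> q (KS.df (\<lambda>a. c a * iK (r a))) = \<zero>\<^bsub>KK\<^esub>)"

lemma rational_mult: "rational c \<Longrightarrow> rational c' \<Longrightarrow> rational (\<lambda>a. c a * c' a)"
  by (simp add: rational_def rel_mult)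

lemma dense_cong: assumes "dense c" "\<And>a. a \<in> gens n \<Longrightarrow> c a = c' a" shows "dense c'"
proof -
  have "KS.df (\<lambda>a. c a * iK (r a)) = KS.df (\<lambda>a. c' a * iK (r a))" for r
    by (rule KS.df_cong) (simp add: assms)
  then show ?thesis using assms rel_cong[of c c'] by (simp add: dense_def)
qed

text \<open>For fixed r, the value of q at c r k(z) is a regular function of z. At rational z the
  factor r k(z) is a rational point, so the value is zero by the density of c; by
  \<open>LP_zero\<close> it is zero everywhere.\<close>

lemma dense_curve:
  assumes c: "dense c" and k: "curve D k" and z: "poly D z \<noteq> 0"
    and Q: "\<And>t. poly D (of_rat t) \<noteq> 0 \<Longrightarrow> \<exists>r. rational r \<and> (\<forall>a\<in>gens n. k (of_rat t) a = iK (r a))"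
  shows "dense (\<lambda>a. c a * k z a)"
  unfolding dense_def
proof (intro conjI allI impI)
  have rc: "rel n c" using c by (simp add: dense_def)
  show "rel n (\<lambda>a. c a * k z a)" using rc k z by (auto simp: curve_def intro!: rel_mult)
  fix r q assume r: "rational r" and q: "q \<in> PF" "vanQ q"
  note rr = rational_rel[OF r]
  have kk: "curve D (\<lambda>z a. (c a * iK (r a)) * k z a)" by (rule curve_scale[OF k rel_mult[OF rc rr]])
  have e: "KS.df (\<lambda>a. (c a * iK (r a)) * k z a) \<in> alg_aut KK KS.ME" if "poly D z \<noteq> 0" for z
    using kk that by (intro df_mem) (simp add: curve_def)
  have "KT.ab (q (KS.df (\<lambda>a. (c a * iK (r a)) * k z a))) = 0"
  proof (rule LP_zero[OF LP_PF[OF kk q(1)] _ _ z])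
    show "D \<noteq> 0" using k by (simp add: curve_def)
    fix t assume t: "poly D (of_rat t) \<noteq> 0"
    obtain r' where r': "rational r'" "\<forall>a\<in>gens n. k (of_rat t) a = iK (r' a)" using Q[OF t] by blast
    have "KS.df (\<lambda>a. (c a * iK (r a)) * k (of_rat t) a) = KS.df (\<lambda>a. c a * iK (r a * r' a))"
      by (rule KS.df_cong) (simp add: r' mult.assoc)
    moreover have "q (KS.df (\<lambda>a. c a * iK (r a * r' a))) = \<zero>\<^bsub>KK\<^esub>"
      using c q rational_mult[OF r r'(1)] unfolding dense_def by blast
    ultimately show "KT.ab (q (KS.df (\<lambda>a. (c a * iK (r a)) * k (of_rat t) a))) = 0"
      by (simp add: KT_ab_zero_iff)
  qed
  then have "q (KS.df (\<lambda>a. (c a * iK (r a)) * k z a)) = \<zero>\<^bsub>KK\<^esub>" by (simp add: KT_ab_zero_iff PF_closed[OF q(1) e[OF z]])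
  then show "q (KS.df (\<lambda>a. c a * k z a * iK (r a))) = \<zero>\<^bsub>KK\<^esub>" by (simp add: ac_simps)
qed

lemma iK_eq_0_iff [simp]: "iK x = 0 \<longleftrightarrow> x = 0"
  using injD[OF inj_iK, of x 0] by auto

lemma iK_minus [simp]: "iK (- x) = - iK x"
proof -
  have "iK (- x) + iK x = iK (- x + x)" by (simp only: iK_hom)
  then show ?thesis by (simp add: eq_neg_iff_add_eq_0)
qed

lemma iK_diff [simp]: "iK (x - y) = iK x - iK y"
  unfolding diff_conv_add_uminus by (simp only: iK_hom iK_minus)

lemma iK_inverse [simp]: "iK (inverse x) = inverse (iK x)"
proof (cases "x = 0")
  case False
  then have "iK x * iK (inverse x) = 1" by (simp flip: iK_hom(4))
  then show ?thesis by (simp add: inverse_unique)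
qed simp

lemma iK_divide [simp]: "iK (x / y) = iK x / iK y"
  by (simp add: divide_inverse)

text \<open>The one-parameter subgroups \<open>muc s\<close> are not split over \<open>\<rat>\<close>.  With \<open>e = i\<close>, \<open>\<surd>3\<close> or \<open>i \<surd>3\<close>, the
  substitution \<open>\<alpha> = (z + e) / (z - e)\<close> makes their values at rational \<open>z\<close> rational: conjugation
  inverts \<open>\<alpha>\<close> exactly when it changes the sign of \<open>e\<close>.\<close>

lemma dense_muc:
  assumes c: "dense c" and s: "s \<in> signs" and \<alpha>: "\<alpha> \<noteq> 0"
  shows "dense (\<lambda>a. c a * muc s \<alpha> a)"
proof (cases "\<alpha> = 1")
  \<comment> \<open>The value \<alpha> = 1 is missed by the substitution, which takes it at
    infinity.\<close>
  case True
  have "muc s (1::qbar) a = 1" for a by (cases a) auto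
  then show ?thesis unfolding True by (intro dense_cong[OF c]) simp
next
  case False
  \<comment> \<open>The sign function s comes from a character \<sigma> of the Galois group, and e
    is an eigenvector for it in L.\<close>
  obtain e \<sigma> where e: "e \<noteq> 0" "\<And>g. cj g e = (if \<sigma> g then - e else e)"
    and \<sigma>: "\<And>a b g. s (a \<noteq> fst g) (b \<noteq> snd g) = (s a b \<noteq> \<sigma> g)"
  proof -
    consider "s = (\<lambda>a b. a)" | "s = (\<lambda>a b. b)" | "s = (\<lambda>a b. a \<noteq> b)" using s by (auto simp: signs_def)
    then show ?thesis
    proof cases
      case 1
      then show ?thesis by (intro that[of "Quad 0 1 0 0" fst]) (auto simp: quad.expand zero_quad_def)
    next
      case 2
      then show ?thesis by (intro that[of "Quad 0 0 1 0" snd]) (auto simp: quad.expand zero_quad_def)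
    next
      case 3
      then show ?thesis by (intro that[of "Quad 0 0 0 1" "\<lambda>g. fst g \<noteq> snd g"]) (auto simp: quad.expand zero_quad_def)
    qed
  qed
  let ?e = "iK e"
  let ?D = "[:- ?e, 1:] * [:?e, 1:]" and ?m = "\<lambda>z. (z + ?e) / (z - ?e)"
  have "poly ?D z = (z - ?e) * (z + ?e)" for z by (simp add: algebra_simps)
  then have D: "poly ?D z \<noteq> 0 \<longleftrightarrow> z - ?e \<noteq> 0 \<and> z + ?e \<noteq> 0" for z by (simp only: mult_eq_0_iff) simp
  have L1: "LP ?D ?m" by (rule LP_quot[of _ _ "[:?e, 1:] ^ 2"]) (simp only: D, simp add: field_simps power2_eq_square)
  have "LP ?D (\<lambda>z. (z - ?e) / (z + ?e))"
    by (rule LP_quot[of _ _ "[:- ?e, 1:] ^ 2"]) (simp only: D, simp add: field_simps power2_eq_square)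
  then have L2: "LP ?D (\<lambda>z. 1 / ?m z)" by simp
  have k: "curve ?D (\<lambda>z. muc s (?m z))"
    unfolding curve_def
  proof (intro conjI allI impI ballI)
    show "rel n (muc s (?m z))" if "poly ?D z \<noteq> 0" for z using that unfolding D by (intro rel_muc s) simp
    show "LP ?D (\<lambda>z. muc s (?m z) a)" for a by (rule LP_muc[OF L1 L2])
  qed simp
  \<comment> \<open>The solution z of (z + e) / (z - e) = \<alpha>.\<close>
  let ?z = "?e * (\<alpha> + 1) / (\<alpha> - 1)"
  have a1: "\<alpha> - 1 \<noteq> 0" using False by simp
  have z: "?z - ?e = 2 * ?e / (\<alpha> - 1)" "?z + ?e = 2 * ?e * \<alpha> / (\<alpha> - 1)"
    using a1 by (simp_all add: field_simps)
  have Dz: "poly ?D ?z \<noteq> 0" unfolding D z using e(1) \<alpha> a1 by simp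
  have mz: "?m ?z = \<alpha>" unfolding z using e(1) a1 by simp
  have "dense (\<lambda>a. c a * muc s (?m ?z) a)"
  proof (rule dense_curve[OF c k Dz])
    fix t assume t: "poly ?D (of_rat t) \<noteq> 0"
    then have t': "iK (of_rat t - e) \<noteq> 0" "iK (of_rat t + e) \<noteq> 0" unfolding D by simp_all
    let ?q = "(of_rat t + e) / (of_rat t - e)"
    have q: "?q \<noteq> 0" using t' by (simp del: iK_hom iK_diff)
    have cq: "cj g ?q = (if \<sigma> g then 1 / ?q else ?q)" for g by (simp add: e)
    have "rational (muc s ?q)"
      unfolding rational_def
    proof (intro conjI allI rel_muc q s)
      fix g :: gal and a :: gen
      obtain u v where g: "g = (u, v)" by force
      \<comment> \<open>The second flag of g at most exchanges the two factors in the weight of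
        y.\<close>
      have Y: "(if s (a \<noteq> u) False then 1 / ?q else ?q) * (if s (a \<noteq> u) True then 1 / ?q else ?q) =
        (if s (a \<noteq> u) (False \<noteq> v) then 1 / ?q else ?q) * (if s (a \<noteq> u) (True \<noteq> v) then 1 / ?q else ?q)" for a
        by (cases v) (simp_all add: mult.commute)
      have cj1: "cj g (if b then 1 / ?q else ?q) = (if b \<noteq> \<sigma> g then 1 / ?q else ?q)" for b
        using cq[of g] by (cases b) (simp_all only: cj_divide cj_hom if_True if_False simp_thms, auto)
      show "muc s ?q (act g a) = cj g (muc s ?q a)"
      proof (cases a)
        case (GU a b)
        then show ?thesis using \<sigma>[of a g b] cj1[of "s a b"] by (simp only: act.simps muc.simps)
      next
        case (GY a)
        have "muc s ?q (act g (GY a)) = (if s (a \<noteq> u) False then 1 / ?q else ?q) * (if s (a \<noteq> u) True then 1 / ?q else ?q)"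
          by (simp add: g)
        also have "\<dots> = cj g (if s a False then 1 / ?q else ?q) * cj g (if s a True then 1 / ?q else ?q)"
          unfolding Y cj1 using \<sigma>[of a g False] \<sigma>[of a g True] by (simp only: g fst_conv snd_conv)
        finally show ?thesis unfolding GY muc.simps cj_hom .
      qed auto
    qed
    moreover have "muc s (?m (of_rat t)) a = iK (muc s ?q a)" for a by (cases a) auto
    ultimately show "\<exists>r. rational r \<and> (\<forall>a\<in>gens n. muc s (?m (of_rat t)) a = iK (r a))" by blast
  qed
  then show ?thesis unfolding mz .
qed

lemma dense_torus: assumes "rel n c" shows "dense c"
  using assms
proof (rule torus_induct)
  show "dense (\<lambda>_. 1)" by (auto simp: dense_def rel_one vanQ_def)
  show "dense c'" if "dense c" "\<And>a. a \<in> gens n \<Longrightarrow> c a = c' a" for c c' by (rule dense_cong[OF that])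
  show "dense (\<lambda>a. c a * s)" if "dense c" "s \<noteq> 0" for c s
  proof (rule dense_curve[OF that(1) curve_scal])
    fix t assume "poly [:0, 1:] (of_rat t) \<noteq> (0::qbar)"
    then show "\<exists>r. rational r \<and> (\<forall>a\<in>gens n. of_rat t = iK (r a))"
      by (intro exI[of _ "\<lambda>_. of_rat t"]) (auto simp: rational_def rel_scal)
  qed (use that in simp)
  show "dense (\<lambda>a. c a * gpc i p a)" if "dense c" "p \<noteq> 0" for c i p
  proof (rule dense_curve[OF that(1) curve_gpc])
    fix t assume "poly [:0, 1:] (of_rat t) \<noteq> (0::qbar)"
    moreover have "gpc i (of_rat t) (act g a) = cj g (gpc i (of_rat t) a)" for g a
      by (cases a) (auto simp: gpc_def)
    ultimately show "\<exists>r. rational r \<and> (\<forall>a\<in>gens n. gpc i (of_rat t) a = iK (r a))"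
      by (intro exI[of _ "gpc i (of_rat t)"]) (auto simp: rational_def rel_gpc, auto simp: gpc_def)
  qed (use that in simp)
qed (rule dense_muc)

lemma vanQ_TK: assumes "q \<in> PF" "vanQ q" "f \<in> TK" shows "q f = \<zero>\<^bsub>KK\<^esub>"
proof -
  obtain c where c: "rel n c" "f = KS.df c" using assms(3) by (auto simp: TK_def)
  have "rational (\<lambda>_. 1)" by (simp add: rational_def rel_one)
  then show ?thesis using dense_torus[OF c(1)] assms(1,2) c(2) unfolding dense_def by fastforce
qed

end

section \<open>The rank\<close>

text \<open>Free coordinates on the torus: three of the u, the element e, and one member of each
  pair p, p', which makes 4 + (n - 3) = n + 1. The other weights are solved from the relations; the
  fourth u comes from N(u) = e^4. \<open>gcode l\<close> is the generator whose weight is the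
  coordinate l.\<close>

fun chi :: "(nat \<Rightarrow> 'f::field) \<Rightarrow> gen \<Rightarrow> 'f" where
  "chi u (GU a b) = (if a then if b then u 3 ^ 4 / (u 0 * u 1 * u 2) else u 2 else if b then u 1 else u 0)"
| "chi u (GY a) = (if a then u 3 ^ 3 / (u 0 * u 1) else u 0 * u 1 / u 3)"
| "chi u GE = u 3"
| "chi u (GP a i) = (if a then u 3 ^ 2 / u (4 + i) else u (4 + i))"

definition gcode :: "nat \<Rightarrow> gen" where
  "gcode l = (if l = 0 then GU False False else if l = 1 then GU False True else if l = 2 then GU True False
     else if l = 3 then GE else GP False (l - 4))"

lemma chi_mult: "chi (\<lambda>l. u l * v l) a = chi u a * chi v a"
  by (cases a) (auto simp: power_mult_distrib)

lemma chi_gcode: "chi u (gcode l) = u l"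
  by (simp add: gcode_def)

lemma poly_funs_mono: assumes "p \<in> poly_funs K C F" "F \<subseteq> F'" shows "p \<in> poly_funs K C F'"
  using assms(1) by induction (use assms(2) in \<open>auto intro: poly_funs.intros\<close>)

lemma poly_funs_prod:
  assumes "\<exists>p\<in>poly_funs KK (carrier KK) F. \<forall>s\<in>S. p s = Kr (G s)"
    and "\<exists>p\<in>poly_funs KK (carrier KK) F. \<forall>s\<in>S. p s = Kr (H s)"
  shows "\<exists>p\<in>poly_funs KK (carrier KK) F. \<forall>s\<in>S. p s = Kr (G s * H s)"
proof -
  obtain p q where p: "p \<in> poly_funs KK (carrier KK) F" "\<forall>s\<in>S. p s = Kr (G s)"
    and q: "q \<in> poly_funs KK (carrier KK) F" "\<forall>s\<in>S. q s = Kr (H s)"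
    using assms by blast
  show ?thesis by (rule bexI[OF _ poly_funs.mult[OF p(1) q(1)]]) (use p(2) q(2) in \<open>simp add: Kr_ops\<close>)
qed

context rat_form
begin

lemma gcode_gens: "l < n + 1 \<Longrightarrow> gcode l \<in> gens n"
  using n3 by (auto simp: gcode_def)

lemma chi_cong: assumes "\<And>l. l < n + 1 \<Longrightarrow> u l = v l" "a \<in> gens n" shows "chi u a = chi v a"
  using assms(2) n3 by (cases a) (auto simp: assms(1))

lemma rel_chi: assumes "\<And>l. l < n + 1 \<Longrightarrow> u l \<noteq> 0" shows "rel n (chi u)"
proof (rule relI)
  have u: "u 0 \<noteq> 0" "u 1 \<noteq> 0" "u 2 \<noteq> 0" "u 3 \<noteq> 0" "i < n - 3 \<Longrightarrow> u (4 + i) \<noteq> 0" for i using assms n3 by auto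
  fix a assume "a \<in> gens n" then show "chi u a \<noteq> 0" using u by (cases a) auto
next
  have u: "u 0 \<noteq> 0" "u 1 \<noteq> 0" "u 2 \<noteq> 0" "u 3 \<noteq> 0" using assms n3 by auto
  show "chi u (GU x False) * chi u (GU x True) = chi u (GY x) * chi u GE" for x
    using u by (cases x) (auto simp: field_simps power_Suc numeral_eq_Suc)
  show "chi u (GY False) * chi u (GY True) = (chi u GE)\<^sup>2" using u by (auto simp: field_simps numeral_eq_Suc)
next
  fix i assume "i < n - 3"
  then have "u (4 + i) \<noteq> 0" using assms n3 by auto
  then show "chi u (GP False i) * chi u (GP True i) = (chi u GE)\<^sup>2" by simp
qed

lemma chi_coords: assumes c: "rel n c" and a: "a \<in> gens n" shows "c a = chi (\<lambda>l. c (gcode l)) a"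
proof -
  have nz: "c (GU x y) \<noteq> 0" "c GE \<noteq> 0" "i < n - 3 \<Longrightarrow> c (GP z i) \<noteq> 0" for x y i z using rel_nz[OF c] by auto
  note r = rel_eqs[OF c]
  have YF: "c (GY False) = c (GU False False) * c (GU False True) / c GE" using r(1)[of False] nz by (simp add: field_simps)
  have YT: "c (GY True) = c GE ^ 3 / (c (GU False False) * c (GU False True))"
    using r(2) nz unfolding YF by (simp add: field_simps numeral_eq_Suc)
  have TT: "c (GU True True) = c GE ^ 4 / (c (GU False False) * c (GU False True) * c (GU True False))"
    using r(1)[of True] nz unfolding YT by (simp add: field_simps numeral_eq_Suc)
  show ?thesis
  proof (cases a)
    case (GU x y)
    then show ?thesis using TT by (cases x; cases y) (auto simp: gcode_def)
  next
    case (GY x)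
    then show ?thesis using YF YT by (cases x) (auto simp: gcode_def)
  next
    case (GP x i)
    then show ?thesis using r(3)[of i] nz a by (cases x) (auto simp: gcode_def field_simps)
  qed (simp add: gcode_def)
qed

abbreviation HK where "HK \<equiv> alg_aut_group KK KS.ME"
abbreviation GmK where "GmK \<equiv> Gm_power KK (n + 1)"

definition tc :: "(nat \<Rightarrow> complex clos) \<Rightarrow> nat \<Rightarrow> qbar" where "tc t = (\<lambda>l. KT.ab (t l))"

definition phi where "phi t = KS.df (chi (tc t))"

lemma HK_simps: "carrier HK = alg_aut KK KS.ME" "\<one>\<^bsub>HK\<^esub> = (\<lambda>v\<in>carrier KS.ME. v)"
  "f \<in> Bij (carrier KS.ME) \<Longrightarrow> g \<in> Bij (carrier KS.ME) \<Longrightarrow> f \<otimes>\<^bsub>HK\<^esub> g = compose (carrier KS.ME) f g"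
  by (simp_all add: alg_aut_group_def BijGroup_def)

lemma aut_Bij: "f \<in> alg_aut KK KS.ME \<Longrightarrow> f \<in> Bij (carrier KS.ME)"
  by (simp add: alg_aut_def)

lemma HK_df_mult: assumes "rel n c" "rel n c'" shows "KS.df c \<otimes>\<^bsub>HK\<^esub> KS.df c' = KS.df (\<lambda>a. c a * c' a)"
  by (simp add: HK_simps aut_Bij df_mem assms KS.df_mult KS_diagok)

lemma subgroup_TK: "subgroup TK HK"
proof
  show "TK \<subseteq> carrier HK" by (auto simp: HK_simps TK_def df_mem)
  show "\<one>\<^bsub>HK\<^esub> \<in> TK" unfolding HK_simps TK_def
    by (rule image_eqI[of _ _ "\<lambda>_. 1"]) (simp_all add: KS.df_one rel_one)
  show "f \<otimes>\<^bsub>HK\<^esub> g \<in> TK" if f: "f \<in> TK" and g: "g \<in> TK" for f g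
  proof -
    obtain c where c: "rel n c" "f = KS.df c" using f unfolding TK_def by blast
    obtain c' where c': "rel n c'" "g = KS.df c'" using g unfolding TK_def by blast
    show ?thesis unfolding c(2) c'(2) HK_df_mult[OF c(1) c'(1)] TK_def
      using rel_mult[OF c(1) c'(1)] by (intro imageI CollectI)
  qed
  show "inv\<^bsub>HK\<^esub> f \<in> TK" if f: "f \<in> TK" for f
  proof -
    obtain c where c: "rel n c" "f = KS.df c" using f unfolding TK_def by blast
    let ?c = "\<lambda>a. inverse (c a)"
    have r: "rel n ?c" by (rule rel_inverse[OF c(1)])
    have e: "KS.df (\<lambda>a. ?c a * c a) = \<one>\<^bsub>HK\<^esub>" "KS.df (\<lambda>a. c a * ?c a) = \<one>\<^bsub>HK\<^esub>"
      unfolding HK_simps KS.df_one[symmetric] by (rule KS.df_cong; simp add: rel_nz[OF c(1)])+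
    have "inv\<^bsub>HK\<^esub> f = KS.df ?c"
      unfolding m_inv_def
    proof (rule the_equality)
      show "KS.df ?c \<in> carrier HK \<and> f \<otimes>\<^bsub>HK\<^esub> KS.df ?c = \<one>\<^bsub>HK\<^esub> \<and> KS.df ?c \<otimes>\<^bsub>HK\<^esub> f = \<one>\<^bsub>HK\<^esub>"
        using c r e by (simp add: HK_df_mult HK_simps(1) df_mem)
      fix y assume y: "y \<in> carrier HK \<and> f \<otimes>\<^bsub>HK\<^esub> y = \<one>\<^bsub>HK\<^esub> \<and> y \<otimes>\<^bsub>HK\<^esub> f = \<one>\<^bsub>HK\<^esub>"
      \<comment> \<open>Uniqueness of the inverse is taken from the group of all bijections, with
        which \<open>HK\<close> shares multiplication and unit.\<close>
      have B: "group (BijGroup (carrier KS.ME))" by (rule group_BijGroup)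
      have m: "g \<otimes>\<^bsub>HK\<^esub> h = g \<otimes>\<^bsub>BijGroup (carrier KS.ME)\<^esub> h" "\<one>\<^bsub>HK\<^esub> = \<one>\<^bsub>BijGroup (carrier KS.ME)\<^esub>" for g h
        by (simp_all add: alg_aut_group_def)
      have car: "y \<in> carrier (BijGroup (carrier KS.ME))" "f \<in> carrier (BijGroup (carrier KS.ME))"
          "KS.df ?c \<in> carrier (BijGroup (carrier KS.ME))"
        using y aut_Bij c r by (auto simp: BijGroup_def HK_simps df_mem)
      have "KS.df ?c \<otimes>\<^bsub>HK\<^esub> f = \<one>\<^bsub>HK\<^esub>" using c r e by (simp add: HK_df_mult)
      then have "inv\<^bsub>BijGroup (carrier KS.ME)\<^esub> f = KS.df ?c"
        using group.inv_equality[OF B _ car(2,3)] by (simp add: m)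
      moreover have "inv\<^bsub>BijGroup (carrier KS.ME)\<^esub> f = y"
        using group.inv_equality[OF B _ car(2,1)] y by (simp add: m)
      ultimately show "y = KS.df ?c" by simp
    qed
    then show ?thesis using r by (auto simp: TK_def)
  qed
qed

lemma Gm_D: assumes "t \<in> carrier GmK" "l < n + 1"
  shows "t l \<in> carrier KK" "tc t l \<noteq> 0" "Kr (tc t l) = t l" "Kr (inverse (tc t l)) = inv\<^bsub>KK\<^esub> (t l)"
proof -
  have u: "t l \<in> Units KK" using assms by (auto simp: Gm_power_def units_of_def)
  then show c: "t l \<in> carrier KK" by (rule KK.Units_closed)
  have "t l \<noteq> \<zero>\<^bsub>KK\<^esub>" using u by (simp add: KK_Units)
  then show nz: "tc t l \<noteq> 0" using c by (simp add: tc_def KT_ab_zero_iff)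
  show k: "Kr (tc t l) = t l" using c by (simp add: tc_def KT.rep_ab)
  show "Kr (inverse (tc t l)) = inv\<^bsub>KK\<^esub> (t l)" by (simp add: Kr_inverse[OF nz] k)
qed

lemma rel_tc: "t \<in> carrier GmK \<Longrightarrow> rel n (chi (tc t))"
  by (rule rel_chi) (rule Gm_D(2))

lemma mt_phi: assumes "t \<in> carrier GmK" "l < n + 1" shows "mt (phi t) (Gen (gcode l)) (Gen (gcode l)) = tc t l"
  using mt_df[OF rel_tc[OF assms(1)], of "Gen (gcode l)"] gcode_gens[OF assms(2)]
  by (simp add: phi_def chi_gcode dl_def)

lemma phi_iso: "phi \<in> iso GmK (HK\<lparr>carrier := TK\<rparr>)"
  unfolding iso_def
proof (intro CollectI conjI homI)
  show "phi t \<in> carrier (HK\<lparr>carrier := TK\<rparr>)" if "t \<in> carrier GmK" for t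
    using rel_tc[OF that] by (simp add: phi_def TK_def)
  show "phi (t \<otimes>\<^bsub>GmK\<^esub> t') = phi t \<otimes>\<^bsub>HK\<lparr>carrier := TK\<rparr>\<^esub> phi t'" if t: "t \<in> carrier GmK" "t' \<in> carrier GmK" for t t'
  proof -
    have "tc (t \<otimes>\<^bsub>GmK\<^esub> t') l = tc t l * tc t' l" if l: "l < n + 1" for l
      using l Gm_D(1)[OF t(1) l] Gm_D(1)[OF t(2) l]
      by (simp add: tc_def Gm_power_def product_group_def units_of_def KT_ab_ops)
    then have "chi (tc (t \<otimes>\<^bsub>GmK\<^esub> t')) a = chi (tc t) a * chi (tc t') a" if "a \<in> gens n" for a
      using chi_cong[of "tc (t \<otimes>\<^bsub>GmK\<^esub> t')" "\<lambda>l. tc t l * tc t' l" a] that by (simp add: chi_mult)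
    then have "phi (t \<otimes>\<^bsub>GmK\<^esub> t') = KS.df (\<lambda>a. chi (tc t) a * chi (tc t') a)"
      unfolding phi_def by (rule KS.df_cong)
    then show ?thesis by (simp add: phi_def HK_df_mult[OF rel_tc[OF t(1)] rel_tc[OF t(2)]])
  qed
  show "bij_betw phi (carrier GmK) (carrier (HK\<lparr>carrier := TK\<rparr>))"
    unfolding bij_betw_def
  proof (intro conjI inj_onI)
    fix t t' assume t: "t \<in> carrier GmK" "t' \<in> carrier GmK" "phi t = phi t'"
    have P: "t \<in> {..<n + 1} \<rightarrow>\<^sub>E Units KK" "t' \<in> {..<n + 1} \<rightarrow>\<^sub>E Units KK"
      using t by (simp_all add: Gm_power_def units_of_def)
    show "t = t'"
    proof (rule PiE_ext[OF P])
      fix l assume "l \<in> {..<n + 1}"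
      then have l: "l < n + 1" by simp
      have "tc t l = tc t' l" using mt_phi[OF t(1) l] mt_phi[OF t(2) l] t(3) by simp
      then have "Kr (tc t l) = Kr (tc t' l)" by simp
      then show "t l = t' l" by (simp only: Gm_D(3)[OF t(1) l] Gm_D(3)[OF t(2) l])
    qed
  next
    have "f \<in> phi ` carrier GmK" if f: "f \<in> TK" for f
    proof -
      obtain c where c: "rel n c" "f = KS.df c" using f unfolding TK_def by blast
      let ?t = "\<lambda>l\<in>{..<n + 1}. Kr (c (gcode l))"
      have "Kr (c (gcode l)) \<in> Units KK" if "l < n + 1" for l
        using rel_nz[OF c(1) gcode_gens[OF that]] by (simp add: KK_Units Kr_eq_zero_iff)
      then have t: "?t \<in> carrier GmK" by (auto simp: Gm_power_def units_of_def)
      have "phi ?t = KS.df c"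
        unfolding phi_def
      proof (rule KS.df_cong)
        fix a assume a: "a \<in> gens n"
        show "chi (tc ?t) a = c a"
          unfolding chi_coords[OF c(1) a] by (rule chi_cong[OF _ a]) (simp add: tc_def)
      qed
      then show ?thesis using t c(2) by (intro image_eqI[of _ _ ?t]) simp_all
    qed
    moreover have "phi t \<in> TK" if "t \<in> carrier GmK" for t using rel_tc[OF that] by (simp add: phi_def TK_def)
    ultimately show "phi ` carrier GmK = carrier (HK\<lparr>carrier := TK\<rparr>)" by (simp, intro equalityI subsetI) auto
  qed
qed

abbreviation PG where "PG \<equiv> poly_funs KK (carrier KK) (Gm_coords KK (n + 1))"

lemma PG_coord: "l < n + 1 \<Longrightarrow> \<exists>p\<in>PG. \<forall>t\<in>carrier GmK. p t = Kr (tc t l)"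
  "l < n + 1 \<Longrightarrow> \<exists>p\<in>PG. \<forall>t\<in>carrier GmK. p t = Kr (inverse (tc t l))"
proof -
  assume l: "l < n + 1"
  have c: "(\<lambda>t. t l) \<in> Gm_coords KK (n + 1)"
    unfolding Gm_coords_def using l by (intro UnI1 CollectI exI[of _ l] conjI refl)
  have i: "(\<lambda>t. inv\<^bsub>KK\<^esub> (t l)) \<in> Gm_coords KK (n + 1)"
    unfolding Gm_coords_def using l by (intro UnI2 CollectI exI[of _ l] conjI refl)
  note poly_funs.coord[OF c, of KK "carrier KK"] poly_funs.coord[OF i, of KK "carrier KK"]
  then show "\<exists>p\<in>PG. \<forall>t\<in>carrier GmK. p t = Kr (tc t l)" "\<exists>p\<in>PG. \<forall>t\<in>carrier GmK. p t = Kr (inverse (tc t l))"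
    using Gm_D(3,4)[OF _ l] by force+
qed

lemma PG_const: "\<exists>p\<in>PG. \<forall>t\<in>carrier GmK. p t = Kr c"
  by (rule bexI[OF _ poly_funs.const[of "Kr c"]]) simp_all

lemma PG_chi: assumes "a \<in> gens n" shows "\<exists>p\<in>PG. \<forall>t\<in>carrier GmK. p t = Kr (chi (tc t) a)"
proof -
  have s: "0 < n + 1" "1 < n + 1" "2 < n + 1" "3 < n + 1" using n3 by auto
  note P = poly_funs_prod PG_coord(1)[OF s(1)] PG_coord(1)[OF s(2)] PG_coord(1)[OF s(3)] PG_coord(1)[OF s(4)]
    PG_coord(2)[OF s(1)] PG_coord(2)[OF s(2)] PG_coord(2)[OF s(3)] PG_coord(2)[OF s(4)] PG_const
  note d = divide_inverse inverse_mult_distrib power2_eq_square power4_eq_xxxx power3_eq_cube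
  show ?thesis
  proof (cases a)
    case (GU x y)
    then show ?thesis unfolding GU chi.simps d by (cases x; cases y) (simp only: if_True if_False, intro P)+
  next
    case (GY x)
    then show ?thesis unfolding GY chi.simps d by (cases x) (simp only: if_True if_False, intro P)+
  next
    case GE
    then show ?thesis unfolding GE chi.simps by (intro P)
  next
    case (GP x i)
    then have l: "4 + i < n + 1" using assms by auto
    show ?thesis unfolding GP chi.simps d
      by (cases x) (simp only: if_True if_False, intro P PG_coord[OF l])+
  qed
qed

lemma PG_wt: assumes "d \<in> idxs n" shows "\<exists>p\<in>PG. \<forall>t\<in>carrier GmK. p t = Kr (wt (chi (tc t)) d)"
  using assms
proof (cases rule: idxs_cases)
  case 1
  then show ?thesis using PG_const[of 1] by simp
next
  case (2 a)
  then show ?thesis using PG_chi by simp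
next
  case (3 a b)
  have "wt (chi (tc t)) d = chi (tc t) a * chi (tc t) b" if "t \<in> carrier GmK" for t
    unfolding 3(4) by (rule rel_wt[OF rel_tc[OF that] 3(1-3)])
  then show ?thesis using poly_funs_prod[OF PG_chi[OF 3(1)] PG_chi[OF 3(2)]] by simp
qed

lemma phi_poly: assumes "x \<in> B" "y \<in> B" shows "\<exists>p\<in>PG. \<forall>t\<in>carrier GmK. mat_entry KK B x y (phi t) = p t"
proof -
  have "mat_entry KK B x y (phi t) = Kr (\<Sum>d\<in>idxs n. iK (xF x d) * iK (cf d y) * wt (chi (tc t)) d)" if "t \<in> carrier GmK" for t
  proof -
    note m = KS.mat_entry_df[OF KS_diagok[OF rel_tc[OF that]] assms]
    have "KT.ab (mat_entry KK B x y (phi t)) = (\<Sum>d\<in>idxs n. iK (xF x d) * iK (cf d y) * wt (chi (tc t)) d)"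
      unfolding phi_def using m(2) by (simp add: ac_simps)
    then show ?thesis using KT.rep_ab[OF m(1)] by (simp add: phi_def)
  qed
  moreover obtain p where "p \<in> PG" "\<forall>t\<in>carrier GmK. p t = Kr (\<Sum>d\<in>idxs n. iK (xF x d) * iK (cf d y) * wt (chi (tc t)) d)"
  proof -
    have "\<exists>p\<in>PG. \<forall>t\<in>carrier GmK. p t = Kr (\<Sum>d\<in>idxs n. iK (xF x d) * iK (cf d y) * wt (chi (tc t)) d)"
      by (intro poly_funs_sum finite_idxs poly_funs_scale PG_wt)
    then show ?thesis using that by blast
  qed
  ultimately show ?thesis by (intro bexI[of _ p]) simp_all
qed

text \<open>A coordinate of the torus is a diagonal entry of the matrix in the split basis, hence a
  polynomial function.\<close>

lemma phi_inverse_poly: assumes "l < n + 1"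
  shows "\<exists>p\<in>poly_funs KK (carrier KK) (entries KK B \<union> inv_entries KK B). \<forall>t\<in>carrier GmK. t l = p (phi t)"
proof -
  obtain p where p: "p \<in> PF" "\<forall>f\<in>alg_aut KK KS.ME. p f = Kr (1 * mt f (Gen (gcode l)) (Gen (gcode l)))"
    using mt_poly_fun[of 1 "Gen (gcode l)" "Gen (gcode l)"] by blast
  have "t l = p (phi t)" if t: "t \<in> carrier GmK" for t
  proof -
    have "phi t \<in> alg_aut KK KS.ME" unfolding phi_def by (rule df_mem[OF rel_tc[OF t]])
    then have "p (phi t) = Kr (mt (phi t) (Gen (gcode l)) (Gen (gcode l)))" using p(2) by simp
    then show ?thesis unfolding mt_phi[OF t assms] Gm_D(3)[OF t assms] by simp
  qed
  moreover have "p \<in> poly_funs KK (carrier KK) (entries KK B \<union> inv_entries KK B)" by (rule poly_funs_mono[OF p(1)]) simp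
  ultimately show ?thesis by (intro bexI[of _ p]) auto
qed

subsection \<open>The torus is defined over the rationals\<close>

abbreviation PQ where "PQ \<equiv> poly_funs KK (toK ` carrier kQ) (entries KK B)"

text \<open>\<open>defined_over_base\<close> asks for an identity on all endomorphisms, not only on
  automorphisms. This is the domain on which polynomial functions take values in
  \<open>KK\<close>.\<close>

definition EC where "EC = {f. \<forall>g\<in>entries KK B. g f \<in> carrier KK}"

text \<open>The value of a formal combination with coefficients in K of polynomial functions, kept
  as a list so that its length can serve as the induction measure.\<close>

definition lc where "lc L f = (\<Sum>x\<leftarrow>L. fst x * KT.ab (snd x f))"

lemma PF_EC: assumes "q \<in> PF" "f \<in> EC" shows "q f \<in> carrier KK"
  using assms(1)
proof induction
  case (coord g)
  then show ?case using assms(2) unfolding EC_def by blast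
qed simp_all

lemma PQ_PF: "q \<in> PQ \<Longrightarrow> q \<in> PF"
proof (induction rule: poly_funs.induct)
  case (const c)
  then obtain z where "z \<in> \<rat>" "c = toK z" by auto
  then show ?case using toK_closed by (intro poly_funs.const) simp
qed (rule poly_funs.coord poly_funs.add poly_funs.mult; assumption)+

lemma df_EC: "rel n c \<Longrightarrow> KS.df c \<in> EC"
  unfolding EC_def using entries_closed[OF df_mem] by blast

lemma PQ_one: "(\<lambda>_. \<one>\<^bsub>KK\<^esub>) \<in> PQ"
  by (rule poly_funs.const) (rule image_eqI[of _ _ 1], simp_all add: toK_one)

lemma toK_rat: "toK (complex_of_rat r) \<in> toK ` carrier kQ" "toK (complex_of_rat r) = Kr (of_rat r)"
  by (simp_all add: Kr_of_rat)

lemma KT_ab_one: "KT.ab \<one>\<^bsub>KK\<^esub> = 1"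
  by (metis KT.ab_rep Kr_ops(2))

lemma lc_scale: assumes "\<forall>x\<in>set L. snd x \<in> PQ" "q \<in> PQ"
  shows "\<forall>x\<in>set (map (\<lambda>x. (c * fst x, \<lambda>s. q s \<otimes>\<^bsub>KK\<^esub> snd x s)) L). snd x \<in> PQ"
    "f \<in> EC \<Longrightarrow> lc (map (\<lambda>x. (c * fst x, \<lambda>s. q s \<otimes>\<^bsub>KK\<^esub> snd x s)) L) f = c * KT.ab (q f) * lc L f"
proof -
  show "\<forall>x\<in>set (map (\<lambda>x. (c * fst x, \<lambda>s. q s \<otimes>\<^bsub>KK\<^esub> snd x s)) L). snd x \<in> PQ"
  proof
    fix y assume "y \<in> set (map (\<lambda>x. (c * fst x, \<lambda>s. q s \<otimes>\<^bsub>KK\<^esub> snd x s)) L)"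
    then obtain x where x: "x \<in> set L" "y = (c * fst x, \<lambda>s. q s \<otimes>\<^bsub>KK\<^esub> snd x s)" unfolding set_map by (rule imageE)
    show "snd y \<in> PQ" unfolding x(2) snd_conv by (rule poly_funs.mult[OF assms(2)]) (use assms(1) x(1) in blast)
  qed
  assume f: "f \<in> EC"
  show "lc (map (\<lambda>x. (c * fst x, \<lambda>s. q s \<otimes>\<^bsub>KK\<^esub> snd x s)) L) f = c * KT.ab (q f) * lc L f"
    using assms(1)
  proof (induction L)
    case (Cons x L)
    have x: "snd x \<in> PQ" using Cons.prems by simp
    have "KT.ab (q f \<otimes>\<^bsub>KK\<^esub> snd x f) = KT.ab (q f) * KT.ab (snd x f)"
      by (rule KT_ab_ops(2)[OF PF_EC[OF PQ_PF[OF assms(2)] f] PF_EC[OF PQ_PF[OF x] f]])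
    then show ?case using Cons by (simp add: lc_def algebra_simps)
  qed (simp add: lc_def)
qed

lemma lc_mult:
  assumes "\<forall>x\<in>set L. snd x \<in> PQ" "\<forall>x\<in>set M. snd x \<in> PQ"
  shows "\<exists>N. (\<forall>x\<in>set N. snd x \<in> PQ) \<and> (\<forall>f\<in>EC. lc N f = lc L f * lc M f)"
  using assms(1)
proof (induction L)
  case Nil
  show ?case by (rule exI[of _ "[]"]) (simp add: lc_def)
next
  case (Cons x L)
  then obtain N where N: "\<forall>x\<in>set N. snd x \<in> PQ" "\<forall>f\<in>EC. lc N f = lc L f * lc M f" by auto
  have x: "snd x \<in> PQ" using Cons.prems by simp
  let ?N = "map (\<lambda>y. (fst x * fst y, \<lambda>s. snd x s \<otimes>\<^bsub>KK\<^esub> snd y s)) M"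
  note S = lc_scale[where c = "fst x", OF assms(2) x]
  show ?case
  proof (rule exI[of _ "?N @ N"], intro conjI ballI)
    show "snd y \<in> PQ" if "y \<in> set (?N @ N)" for y using that S(1) N(1) unfolding set_append by blast
    fix f assume f: "f \<in> EC"
    have "lc (?N @ N) f = lc ?N f + lc N f" by (simp add: lc_def)
    also have "\<dots> = (fst x * KT.ab (snd x f) + lc L f) * lc M f" using S(2)[OF f] N(2) f by (simp add: algebra_simps)
    finally show "lc (?N @ N) f = lc (x # L) f * lc M f" by (simp add: lc_def)
  qed
qed

lemma PF_lc: assumes "p \<in> PF" shows "\<exists>L. (\<forall>x\<in>set L. snd x \<in> PQ) \<and> (\<forall>f\<in>EC. KT.ab (p f) = lc L f)"
  using assms
proof induction
  case (const c)
  show ?case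
    by (rule exI[of _ "[(KT.ab c, \<lambda>_. \<one>\<^bsub>KK\<^esub>)]"]) (use PQ_one in \<open>simp add: lc_def KT_ab_one\<close>)
next
  case (coord g)
  show ?case
    by (rule exI[of _ "[(1, g)]"]) (simp add: lc_def poly_funs.coord[OF coord])
next
  case (add p q)
  then obtain L M where L: "\<forall>x\<in>set L. snd x \<in> PQ" "\<forall>f\<in>EC. KT.ab (p f) = lc L f"
    and M: "\<forall>x\<in>set M. snd x \<in> PQ" "\<forall>f\<in>EC. KT.ab (q f) = lc M f" by blast
  have "KT.ab (p f \<oplus>\<^bsub>KK\<^esub> q f) = lc (L @ M) f" if "f \<in> EC" for f
    using that L(2) M(2) PF_EC[OF add.hyps(1) that] PF_EC[OF add.hyps(2) that] by (simp add: KT_ab_ops lc_def)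
  then show ?case using L(1) M(1) by (intro exI[of _ "L @ M"]) auto
next
  case (mult p q)
  then obtain L M where L: "\<forall>x\<in>set L. snd x \<in> PQ" "\<forall>f\<in>EC. KT.ab (p f) = lc L f"
    and M: "\<forall>x\<in>set M. snd x \<in> PQ" "\<forall>f\<in>EC. KT.ab (q f) = lc M f" by blast
  obtain N where N: "\<forall>x\<in>set N. snd x \<in> PQ" "\<forall>f\<in>EC. lc N f = lc L f * lc M f" using lc_mult[OF L(1) M(1)] by blast
  have "KT.ab (p f \<otimes>\<^bsub>KK\<^esub> q f) = lc N f" if "f \<in> EC" for f
    using that L(2) M(2) N(2) PF_EC[OF mult.hyps(1) that] PF_EC[OF mult.hyps(2) that] by (simp add: KT_ab_ops)
  then show ?case using N(1) by (intro exI[of _ N]) simp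
qed

lemma PQ_rational: assumes "q \<in> PQ" "rational c" shows "\<exists>r. q (KS.df (\<lambda>a. iK (c a))) = Kr (of_rat r)"
  using assms(1)
proof induction
  case (const z)
  then obtain r where "z = toK (of_rat r)" by (auto simp: Rats_def)
  then show ?case by (auto simp: Kr_of_rat)
next
  case (coord g)
  then obtain x y where g: "g = mat_entry KK B x y" "x \<in> B" "y \<in> B" unfolding entries_def by blast
  obtain r where "mat_entry kQ B x y (QS.df c) = of_rat r"
    using mat_entry_rational(1)[OF assms(2) g(2,3)] by (auto simp: Rats_def)
  then show ?case unfolding g(1) mat_entry_rational(2)[OF assms(2) g(2,3)] by (intro exI[of _ r]) (simp only: Kr_of_rat)
next
  case (add p q)
  then obtain r s where "p (KS.df (\<lambda>a. iK (c a))) = Kr (of_rat r)" "q (KS.df (\<lambda>a. iK (c a))) = Kr (of_rat s)" by blast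
  then show ?case by (intro exI[of _ "r + s"]) (simp only: of_rat_add Kr_ops)
next
  case (mult p q)
  then obtain r s where "p (KS.df (\<lambda>a. iK (c a))) = Kr (of_rat r)" "q (KS.df (\<lambda>a. iK (c a))) = Kr (of_rat s)" by blast
  then show ?case by (intro exI[of _ "r * s"]) (simp only: of_rat_mult Kr_ops)
qed

text \<open>In a shortest representation of a polynomial vanishing on the rational points, every term
  vanishes there: otherwise evaluation at a rational point expresses one coefficient rationally in
  terms of the others, and its term can be absorbed.\<close>

lemma vanQ_lc:
  assumes "\<forall>x\<in>set L. snd x \<in> PQ" "\<And>c. rational c \<Longrightarrow> lc L (KS.df (\<lambda>a. iK (c a))) = 0"
  shows "\<exists>M. (\<forall>x\<in>set M. snd x \<in> PQ \<and> vanQ (snd x)) \<and> (\<forall>f\<in>EC. lc L f = lc M f)"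
  using assms
proof (induction "length L" arbitrary: L rule: less_induct)
  case less
  show ?case
  proof (cases "\<forall>x\<in>set L. vanQ (snd x)")
    case True
    then show ?thesis using less.prems(1) by (intro exI[of _ L]) simp
  next
    case False
    then obtain x where x: "x \<in> set L" "\<not> vanQ (snd x)" by blast
    then obtain c where c: "rational c" "snd x (KS.df (\<lambda>a. iK (c a))) \<noteq> \<zero>\<^bsub>KK\<^esub>" unfolding vanQ_def by blast
    define g where "g = KS.df (\<lambda>a. iK (c a))"
    define \<rho> where "\<rho> q = (SOME r. q g = Kr (of_rat r))" for q
    have \<rho>: "q g = Kr (of_rat (\<rho> q))" if "q \<in> PQ" for q
      unfolding \<rho>_def using PQ_rational[OF that c(1)] unfolding g_def by (rule someI_ex)
    have xP: "snd x \<in> PQ" using less.prems(1) x(1) by blast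
    have nz: "\<rho> (snd x) \<noteq> 0" using c(2) \<rho>[OF xP] unfolding g_def by (auto simp: Kr_ops)
    obtain L1 L2 where L: "L = L1 @ x # L2" using split_list[OF x(1)] by blast
    \<comment> \<open>Each other term y is replaced by y - (y(g) / x(g)) x, with a rational factor.
      Since the whole combination vanishes at g, these corrections add up to the term of x, which is
      thereby absorbed.\<close>
    define k where "k y = - (\<rho> (snd y) / \<rho> (snd x))" for y :: "qbar \<times> _"
    define sh where "sh y = (fst y, \<lambda>s. snd y s \<oplus>\<^bsub>KK\<^esub> toK (of_rat (k y)) \<otimes>\<^bsub>KK\<^esub> snd x s)" for y :: "qbar \<times> _"
    have inP: "\<forall>y\<in>set (L1 @ L2). snd y \<in> PQ" using less.prems(1) L by auto
    have shP: "snd (sh y) \<in> PQ" if "snd y \<in> PQ" for y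
      unfolding sh_def snd_conv
      by (rule poly_funs.add[OF that poly_funs.mult[OF poly_funs.const[OF toK_rat(1)] xP]])
    have sum: "lc (map sh M) f = lc M f - KT.ab (snd x f) / of_rat (\<rho> (snd x)) * lc M g"
      if "\<forall>y\<in>set M. snd y \<in> PQ" "f \<in> EC" for M f
      using that(1)
    proof (induction M)
      case (Cons y M)
      have y: "snd y \<in> PQ" using Cons.prems by simp
      have c: "snd y f \<in> carrier KK" "snd x f \<in> carrier KK" using PF_EC[OF PQ_PF that(2)] y xP by auto
      have "KT.ab (snd (sh y) f) = KT.ab (snd y f) + of_rat (k y) * KT.ab (snd x f)"
        using c by (simp add: sh_def toK_rat(2) KT_ab_ops)
      moreover have "KT.ab (snd y g) = of_rat (\<rho> (snd y))" by (simp add: \<rho>[OF y])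
      moreover have "fst (sh y) = fst y" by (simp add: sh_def)
      ultimately have "fst (sh y) * KT.ab (snd (sh y) f) =
          fst y * KT.ab (snd y f) - KT.ab (snd x f) / of_rat (\<rho> (snd x)) * (fst y * KT.ab (snd y g))"
        by (simp add: k_def of_rat_minus of_rat_divide right_diff_distrib)
      moreover have "lc (map sh M) f = lc M f - KT.ab (snd x f) / of_rat (\<rho> (snd x)) * lc M g" using Cons by simp
      ultimately show ?case unfolding lc_def list.map sum_list.Cons by (simp only: lc_def[symmetric] ring_distribs) simp
    qed (simp add: lc_def)
    have "lc L g = lc (L1 @ L2) g + fst x * of_rat (\<rho> (snd x))" unfolding L lc_def by (simp add: \<rho>[OF xP])
    then have Lg: "lc (L1 @ L2) g = - (fst x * of_rat (\<rho> (snd x)))"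
      using less.prems(2)[OF c(1)] unfolding g_def by (simp add: eq_neg_iff_add_eq_0)
    have eq: "lc (map sh (L1 @ L2)) f = lc L f" if "f \<in> EC" for f
    proof -
      have "lc (map sh (L1 @ L2)) f = lc (L1 @ L2) f + KT.ab (snd x f) * fst x"
        unfolding sum[OF inP that] Lg using nz by simp
      then show ?thesis by (simp add: L lc_def)
    qed
    have "\<exists>M. (\<forall>x\<in>set M. snd x \<in> PQ \<and> vanQ (snd x)) \<and> (\<forall>f\<in>EC. lc (map sh (L1 @ L2)) f = lc M f)"
    proof (rule less.hyps)
      show "length (map sh (L1 @ L2)) < length L" by (simp add: L)
      show "\<forall>y\<in>set (map sh (L1 @ L2)). snd y \<in> PQ"
      proof
        fix y assume "y \<in> set (map sh (L1 @ L2))"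
        then obtain z where "z \<in> set (L1 @ L2)" "y = sh z" unfolding set_map by (rule imageE)
        then show "snd y \<in> PQ" using shP inP by blast
      qed
      show "lc (map sh (L1 @ L2)) (KS.df (\<lambda>a. iK (c a))) = 0" if "rational c" for c
        using eq[OF df_EC[OF rational_rel[OF that]]] less.prems(2)[OF that] by simp
    qed
    then show ?thesis using eq by auto
  qed
qed

text \<open>A polynomial that vanishes on the torus vanishes at its rational points.
  \<open>vanQ_lc\<close> rewrites it as a combination of rational polynomials that vanish at these
  points, and by density they vanish on the whole torus.\<close>

lemma TK_defined_over_base: "defined_over_base kQ (Aalg n) B TK"
  unfolding defined_over_base_def Let_def ME_eq
proof (intro ballI impI)
  fix p assume p: "p \<in> PF" and z: "\<forall>f\<in>TK. p f = \<zero>\<^bsub>KK\<^esub>"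
  obtain L where L: "\<forall>x\<in>set L. snd x \<in> PQ" "\<forall>f\<in>EC. KT.ab (p f) = lc L f" using PF_lc[OF p] by blast
  have "lc L (KS.df (\<lambda>a. iK (c a))) = 0" if "rational c" for c
  proof -
    note r = rational_rel[OF that]
    have "p (KS.df (\<lambda>a. iK (c a))) = \<zero>\<^bsub>KK\<^esub>" using z r unfolding TK_def by blast
    then show ?thesis using L(2) df_EC[OF r] by (simp add: KT_ab_zero_iff flip: L(2))
  qed
  then obtain M where M: "\<forall>x\<in>set M. snd x \<in> PQ \<and> vanQ (snd x)" "\<forall>f\<in>EC. lc L f = lc M f"
    using vanQ_lc[OF L(1)] by blast
  let ?c = "\<lambda>l. Kr (fst (M ! l))" and ?q = "\<lambda>l. snd (M ! l)"
  have q: "?q l \<in> PQ" "vanQ (?q l)" if "l < length M" for l using M(1) nth_mem[OF that] by auto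
  have "p f = (\<Oplus>\<^bsub>KK\<^esub>l\<in>{..<length M}. ?c l \<otimes>\<^bsub>KK\<^esub> ?q l f)" if f: "f \<in> module_hom KK KS.ME KS.ME" for f
  proof -
    have fE: "f \<in> EC"
      unfolding EC_def
    proof (intro CollectI ballI)
      fix g assume "g \<in> entries KK B"
      then obtain x y where g: "g = mat_entry KK B x y" "x \<in> B" "y \<in> B" unfolding entries_def by blast
      have "f (basis_vec KK B x) \<in> carrier KS.ME" using f KS.basis_vec_mem[OF g(2)] unfolding module_hom_def by blast
      then show "g f \<in> carrier KK" using KS.ME_D g by (simp add: mat_entry_def)
    qed
    have "(\<Oplus>\<^bsub>KK\<^esub>l\<in>{..<length M}. ?c l \<otimes>\<^bsub>KK\<^esub> ?q l f) = (\<Oplus>\<^bsub>KK\<^esub>l\<in>{..<length M}. Kr (fst (M ! l) * KT.ab (snd (M ! l) f)))"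
      by (rule KK.finsum_cong') (auto simp: Kr_ops KT.rep_ab[OF PF_EC[OF PQ_PF[OF q(1)] fE]]
          intro!: KK.m_closed PF_EC[OF PQ_PF[OF q(1)] fE])
    also have "\<dots> = Kr (\<Sum>l<length M. fst (M ! l) * KT.ab (snd (M ! l) f))" by (simp only: KT.rep_sum[OF finite_lessThan])
    also have "(\<Sum>l<length M. fst (M ! l) * KT.ab (snd (M ! l) f)) = lc M f"
      unfolding lc_def by (simp add: sum_list_sum_nth atLeast0LessThan)
    also have "Kr (lc M f) = p f" using L(2) M(2) fE KT.rep_ab[OF PF_EC[OF p fE]] by simp
    finally show ?thesis by (rule sym)
  qed
  then show "\<exists>(m::nat) c q. (\<forall>l<m. c l \<in> carrier KK \<and> q l \<in> PQ \<and> (\<forall>f\<in>TK. q l f = \<zero>\<^bsub>KK\<^esub>)) \<and>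
      (\<forall>f\<in>module_hom KK KS.ME KS.ME. p f = (\<Oplus>\<^bsub>KK\<^esub>l\<in>{..<m}. c l \<otimes>\<^bsub>KK\<^esub> q l f))"
    using q vanQ_TK[OF PQ_PF]
    by (intro exI[of _ "length M"] exI[of _ ?c] exI[of _ ?q] conjI allI impI ballI) simp_all
qed

lemma subtorus_TK: "subtorus kQ (Aalg n) B (n + 1) TK"
  unfolding subtorus_def Let_def ME_eq
  by (intro conjI subgroup_TK TK_subset_geom_G closed_TK TK_defined_over_base bexI[OF _ phi_iso] ballI allI impI
      phi_poly phi_inverse_poly)

text \<open>A larger torus is commutative and contains \<open>t0\<close>, so it lies in the
  centralizer of \<open>t0\<close>.\<close>

lemma TK_maximal: assumes "subtorus kQ (Aalg n) B r' T'" "TK \<subseteq> T'" shows "T' = TK"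
proof (rule equalityI[OF _ assms(2)], rule subsetI)
  fix f assume f: "f \<in> T'"
  obtain \<phi> where \<phi>: "\<phi> \<in> iso (Gm_power KK r') (HK\<lparr>carrier := T'\<rparr>)" and sub: "subgroup T' HK"
    using assms(1) unfolding subtorus_def Let_def ME_eq by blast
  have aut: "g \<in> alg_aut KK KS.ME" if "g \<in> T'" for g
    using subgroup.mem_carrier[OF sub that] by (simp add: HK_simps)
  have t0: "KS.df t0 \<in> T'" using assms(2) rel_t0 unfolding TK_def by blast
  have surj: "\<exists>t\<in>carrier (Gm_power KK r'). g = \<phi> t" if "g \<in> T'" for g
    using \<phi> that unfolding iso_def bij_betw_def by auto
  obtain t where t: "t \<in> carrier (Gm_power KK r')" "f = \<phi> t" using surj[OF f] by blast
  obtain s where s: "s \<in> carrier (Gm_power KK r')" "KS.df t0 = \<phi> s" using surj[OF t0] by blast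
  have hom: "\<phi> (x \<otimes>\<^bsub>Gm_power KK r'\<^esub> y) = \<phi> x \<otimes>\<^bsub>HK\<^esub> \<phi> y"
    if "x \<in> carrier (Gm_power KK r')" "y \<in> carrier (Gm_power KK r')" for x y
    using \<phi> that unfolding iso_def hom_def by simp
  have "t l \<otimes>\<^bsub>KK\<^esub> s l = s l \<otimes>\<^bsub>KK\<^esub> t l" if "l < r'" for l
  proof -
    have "t l \<in> Units KK" "s l \<in> Units KK" using t s that by (auto simp: Gm_power_def units_of_def)
    then show ?thesis using KK.m_comm KK.Units_closed by simp
  qed
  then have "t \<otimes>\<^bsub>Gm_power KK r'\<^esub> s = s \<otimes>\<^bsub>Gm_power KK r'\<^esub> t"
    by (auto simp: Gm_power_def product_group_def units_of_def intro!: restrict_ext)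
  then have "f \<otimes>\<^bsub>HK\<^esub> KS.df t0 = KS.df t0 \<otimes>\<^bsub>HK\<^esub> f"
    unfolding t(2) s(2) hom[OF t(1) s(1), symmetric] hom[OF s(1) t(1), symmetric] by simp
  then have e: "compose (carrier KS.ME) f (KS.df t0) = compose (carrier KS.ME) (KS.df t0) f"
    by (simp add: HK_simps(3) aut_Bij aut f t0)
  show "f \<in> TK"
  proof (rule centralizer_t0[OF aut[OF f]])
    fix v assume "v \<in> carrier KS.ME"
    then show "f (KS.df t0 v) = KS.df t0 (f v)" using fun_cong[OF e, of v] by (simp add: compose_eq)
  qed
qed

lemma rank_Aalg: "has_rank kQ (Aalg n) B (n + 1)"
  unfolding has_rank_def maximal_torus_def
  by (intro exI[of _ TK] conjI subtorus_TK allI impI TK_maximal)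

end

section \<open>The obstruction to R-equivalence\<close>

text \<open>The univariate polynomials of the algebra library are lists of coefficients, leading coefficient first.\<close>

fun RQ :: "complex list \<Rightarrow> quad poly" where
  "RQ [] = 0"
| "RQ (z # p) = monom (of_rat (ratq z)) (length p) + RQ p"

lemma kQ_pow: "x [^]\<^bsub>kQ\<^esub> (k::nat) = x ^ k"
  by (induction k) simp_all

lemma eval_kQ:
  assumes "set p \<subseteq> \<rat>"
  shows "\<exists>s. ring.eval kQ p (of_rat r) = of_rat s \<and> poly (RQ p) (of_rat r) = of_rat s"
  using assms
proof (induction p)
  case Nil
  show ?case using ring.eval.simps(1)[OF cring.axioms(1)[OF cring_kQ]] by (intro exI[of _ 0]) simp
next
  case (Cons z p)
  then obtain s where s: "ring.eval kQ p (of_rat r) = of_rat s" "poly (RQ p) (of_rat r) = of_rat s" by auto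
  obtain t where t: "z = of_rat t" using Cons.prems Rats_of_rat[of z] by auto
  show ?case
    using ring.eval.simps(2)[OF cring.axioms(1)[OF cring_kQ], of z p] s t
    by (intro exI[of _ "t * r ^ length p + s"]) (simp add: kQ_pow poly_monom of_rat_add of_rat_mult of_rat_power)
qed

lemma poly_ring_set: "p \<in> carrier (poly_ring kQ) \<Longrightarrow> set p \<subseteq> \<rat>"
  unfolding univ_poly_carrier[symmetric] polynomial_def by auto

lemma eval_KK:
  assumes "set p \<subseteq> \<rat>" "z \<in> \<rat>"
  shows "KK.eval (map toK p) (toK z) = toK (ring.eval kQ p z)"
  using ring_hom_ring.eval_hom'[OF toK_hom, of z p] assms by simp

lemma quad_poly_eq_zero:
  fixes F D :: "quad poly"
  assumes "D \<noteq> 0" "\<And>r. poly D (of_rat r) \<noteq> 0 \<Longrightarrow> poly F (of_rat r) = 0"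
  shows "F = 0"
proof -
  have "F * D = 0" by (rule poly_eqI_rat) (use assms(2) in force)
  then show ?thesis using assms(1) by simp
qed

context rat_form
begin

abbreviation GG where "GG \<equiv> geom_G kQ (Aalg n) B kQ (\<lambda>c. c)"
abbreviation GQ where "GQ \<equiv> G_points kQ (Aalg n) B kQ (\<lambda>c. c)"

definition mq :: "(((nat \<Rightarrow> complex) \<Rightarrow> complex) \<Rightarrow> ((nat \<Rightarrow> complex) \<Rightarrow> complex)) \<Rightarrow> idx \<Rightarrow> idx \<Rightarrow> quad" where
  "mq f d e = (\<Sum>x\<in>B. \<Sum>y\<in>B. cf d x * xF y e * of_rat (ratq (mat_entry kQ B x y f)))"

text \<open>The invariant that separates two points. Its first part says that the lines of the u are
  kept modulo J^2, so that the quotient of diagonal coefficients in the second part carries the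
  class in question; one u represents all four, which are conjugate.\<close>

definition trivial_class :: "(((nat \<Rightarrow> complex) \<Rightarrow> complex) \<Rightarrow> ((nat \<Rightarrow> complex) \<Rightarrow> complex)) \<Rightarrow> bool" where
  "trivial_class f \<longleftrightarrow> (\<forall>a b. \<forall>j\<in>gens n. j \<noteq> GU a b \<longrightarrow> mq f (Gen (GU a b)) (Gen j) = 0) \<and>
     mq f (Gen (GU False False)) (Gen (GU False False)) / mq f (Gen GE) (Gen GE) \<in> cob"

lemma iK_sum: "iK (sum f T) = (\<Sum>x\<in>T. iK (f x))"
  by (rule KS.i_sum)

text \<open>The matrix of the curve in the split basis has polynomial numerators over L. The lines
  of the u persist along it, the norm relation becomes an identity of polynomials, and
  \<open>ratio_in_cob\<close> compares the two ends.\<close>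

lemma trivial_class_link:
  assumes link: "R_link kQ (Aalg n) B kQ (\<lambda>c. c) f0 f1" and f0: "trivial_class f0"
  shows "trivial_class f1"
proof -
  obtain q P where q: "q \<in> carrier (poly_ring kQ)" and P: "\<forall>x\<in>B. \<forall>y\<in>B. P x y \<in> carrier (poly_ring kQ)"
    and q01: "ring.eval kQ q 0 \<noteq> 0" "ring.eval kQ q 1 \<noteq> 0"
    and val: "\<forall>u\<in>carrier KK. KK.eval (map toK q) u \<noteq> \<zero>\<^bsub>KK\<^esub> \<longrightarrow>
        (\<exists>g\<in>GG. \<forall>x\<in>B. \<forall>y\<in>B. mat_entry KK B x y g \<otimes>\<^bsub>KK\<^esub> KK.eval (map toK q) u = KK.eval (map toK (P x y)) u)"
    and ends: "\<forall>x\<in>B. \<forall>y\<in>B. mat_entry kQ B x y f0 * ring.eval kQ q 0 = ring.eval kQ (P x y) 0 \<and>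
        mat_entry kQ B x y f1 * ring.eval kQ q 1 = ring.eval kQ (P x y) 1"
    using link unfolding R_link_def Let_def kQ_simps by blast
  \<comment> \<open>In the split basis the curve is the matrix M / D over L(t).\<close>
  define D where "D = RQ q"
  define M where "M d e = (\<Sum>x\<in>B. \<Sum>y\<in>B. smult (cf d x * xF y e) (RQ (P x y)))" for d e
  have qs: "set q \<subseteq> \<rat>" and Ps: "x \<in> B \<Longrightarrow> y \<in> B \<Longrightarrow> set (P x y) \<subseteq> \<rat>" for x y
    using poly_ring_set q P by blast+
  have M: "poly (M d e) z = (\<Sum>x\<in>B. \<Sum>y\<in>B. cf d x * xF y e * poly (RQ (P x y)) z)" for d e z
    by (simp add: M_def poly_sum)
  have end_point: "mq f d e * poly D (of_rat r) = poly (M d e) (of_rat r)"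
    if eq: "\<forall>x\<in>B. \<forall>y\<in>B. mat_entry kQ B x y f * ring.eval kQ q (of_rat r) = ring.eval kQ (P x y) (of_rat r)"
      and nz: "ring.eval kQ q (of_rat r) \<noteq> 0" for f d e r
  proof -
    obtain s where s: "ring.eval kQ q (of_rat r) = of_rat s" "poly D (of_rat r) = of_rat s"
      using eval_kQ[OF qs, of r] unfolding D_def by blast
    have "of_rat (ratq (mat_entry kQ B x y f)) * poly D (of_rat r) = poly (RQ (P x y)) (of_rat r)" if xy: "x \<in> B" "y \<in> B" for x y
    proof -
      obtain t where t: "ring.eval kQ (P x y) (of_rat r) = of_rat t" "poly (RQ (P x y)) (of_rat r) = of_rat t"
        using eval_kQ[OF Ps[OF xy], of r] by blast
      have "mat_entry kQ B x y f * of_rat s = of_rat t" using eq[rule_format, OF xy] unfolding s t .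
      moreover have "s \<noteq> 0" using nz s by auto
      ultimately have "mat_entry kQ B x y f = of_rat (t / s)" by (simp add: of_rat_divide field_simps)
      then show ?thesis unfolding s t using \<open>s \<noteq> 0\<close> by (simp flip: of_rat_mult)
    qed
    then show ?thesis unfolding mq_def M sum_distrib_right by (intro sum.cong refl) (simp add: mult.assoc)
  qed
  have e0: "mq f0 d e * poly D 0 = poly (M d e) 0" for d e
    using end_point[of f0 0] ends q01(1) by simp
  have e1: "mq f1 d e * poly D 1 = poly (M d e) 1" for d e
    using end_point[of f1 1] ends q01(2) by simp
  have D01: "poly D 0 \<noteq> 0" "poly D 1 \<noteq> 0"
    using eval_kQ[OF qs, of 0] eval_kQ[OF qs, of 1] q01 unfolding D_def by auto
  then have D: "D \<noteq> 0" by auto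
  \<comment> \<open>At a rational parameter the curve gives an automorphism over the closure whose
    matrix is the image of M / D. Such parameters suffice to establish identities between
    polynomials over L.\<close>
  have fibre: "\<exists>g. autsys n g \<and> (\<forall>d e. g d e * iK (poly D (of_rat r)) = iK (poly (M d e) (of_rat r)))"
    if nz: "poly D (of_rat r) \<noteq> 0" for r
  proof -
    obtain s where s: "ring.eval kQ q (of_rat r) = of_rat s" "poly D (of_rat r) = of_rat s"
      using eval_kQ[OF qs, of r] unfolding D_def by blast
    have qv: "KK.eval (map toK q) (toK (of_rat r)) = Kr (of_rat s)"
      by (simp add: eval_KK[OF qs] s(1) Kr_of_rat)
    have "Kr (of_rat s) \<noteq> \<zero>\<^bsub>KK\<^esub>" using nz s(2) by (simp add: Kr_eq_zero_iff)
    moreover have "toK (of_rat r) \<in> carrier KK" by (simp add: toK_closed)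
    ultimately obtain g where g: "g \<in> GG" "\<forall>x\<in>B. \<forall>y\<in>B. mat_entry KK B x y g \<otimes>\<^bsub>KK\<^esub> Kr (of_rat s) = KK.eval (map toK (P x y)) (toK (of_rat r))"
      using val[rule_format, of "toK (of_rat r)"] unfolding qv by blast
    note a = geom_G_aut[OF g(1)]
    have ent: "KT.ab (mat_entry KK B x y g) * iK (poly D (of_rat r)) = iK (poly (RQ (P x y)) (of_rat r))" if xy: "x \<in> B" "y \<in> B" for x y
    proof -
      obtain t where t: "ring.eval kQ (P x y) (of_rat r) = of_rat t" "poly (RQ (P x y)) (of_rat r) = of_rat t"
        using eval_kQ[OF Ps[OF xy], of r] by blast
      have "mat_entry KK B x y \<in> entries KK B" using xy unfolding entries_def by blast
      then have c: "mat_entry KK B x y g \<in> carrier KK" by (rule entries_closed[OF a])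
      have "mat_entry KK B x y g \<otimes>\<^bsub>KK\<^esub> Kr (of_rat s) = Kr (of_rat t)"
        using g(2) xy by (simp add: eval_KK[OF Ps[OF xy]] t(1) Kr_of_rat)
      then have "KT.ab (mat_entry KK B x y g \<otimes>\<^bsub>KK\<^esub> Kr (of_rat s)) = KT.ab (Kr (of_rat t))" by simp
      then show ?thesis by (simp add: KT_ab_ops c s(2) t(2))
    qed
    have "mt g d e * iK (poly D (of_rat r)) = iK (poly (M d e) (of_rat r))" for d e
      unfolding mt_def M sum_distrib_right iK_sum iK_hom(4)[of _ "poly (RQ _) _"]
      by (intro sum.cong refl) (simp only: mult.assoc ent)
    then show ?thesis using autsys_mt[OF a] by blast
  qed
  have pz: "poly F (of_rat r) = 0" if "poly F (of_rat r) * poly H (of_rat r) = 0" "poly H (of_rat r) \<noteq> 0" for F H :: "quad poly" and r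
    using that by simp
  let ?U = "\<lambda>a b. Gen (GU a b)"
  let ?X = "M (?U False False) (?U False False)" and ?S = "M (Gen GE) (Gen GE)"
  have prod0: "M (?U a b) (Gen i) * M (?U a b) (Gen j) = 0" if ij: "i \<in> gens n" "j \<in> gens n" "i \<noteq> j" for a b i j
  proof (rule quad_poly_eq_zero[OF D])
    fix r assume nz: "poly D (of_rat r) \<noteq> 0"
    obtain g where g: "autsys n g" "\<And>d e. g d e * iK (poly D (of_rat r)) = iK (poly (M d e) (of_rat r))"
      using fibre[OF nz] by blast
    have "g (?U a b) (Gen i) * g (?U a b) (Gen j) = 0" by (rule autsys_column(3)[OF g(1) _ _ ij]) simp_all
    then have "iK (poly (M (?U a b) (Gen i)) (of_rat r)) * iK (poly (M (?U a b) (Gen j)) (of_rat r)) = 0"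
      unfolding g(2)[symmetric] by auto
    then show "poly (M (?U a b) (Gen i) * M (?U a b) (Gen j)) (of_rat r) = 0" by simp
  qed
  \<comment> \<open>The column of u is not zero at the parameter 0, and by assumption on
    \<open>f0\<close> all its generator entries off the diagonal vanish there.\<close>
  have diag0: "poly (M (?U a b) (?U a b)) 0 \<noteq> 0" for a b
  proof
    assume z: "poly (M (?U a b) (?U a b)) 0 = 0"
    have nz: "poly D (of_rat 0) \<noteq> 0" using D01 by simp
    obtain g where g: "autsys n g" "\<And>d e. g d e * iK (poly D (of_rat 0)) = iK (poly (M d e) (of_rat 0))"
      using fibre[OF nz] by blast
    obtain j where j: "j \<in> gens n" "g (?U a b) (Gen j) \<noteq> 0" using autsys_column(1)[OF g(1), of "GU a b"] by auto
    have "poly (M (?U a b) (Gen j)) 0 \<noteq> 0" using g(2)[of "?U a b" "Gen j"] j(2) D01 by auto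
    then have "mq f0 (?U a b) (Gen j) \<noteq> 0" "j \<noteq> GU a b" using e0[of "?U a b" "Gen j"] z by auto
    then show False using f0 j(1) unfolding trivial_class_def by blast
  qed
  \<comment> \<open>Two different entries of this column have product zero as polynomials. The
    diagonal one is nonzero at 0, so the other is the zero polynomial and the line of u cannot
    jump.\<close>
  have off: "M (?U a b) (Gen j) = 0" if "j \<in> gens n" "j \<noteq> GU a b" for a b j
  proof -
    have "M (?U a b) (?U a b) \<noteq> 0" using diag0[of a b] by auto
    then show ?thesis using prod0[of "GU a b" j a b] that by simp
  qed
  have norm: "poly (M (?U False False) (?U False False) * M (?U True False) (?U True False) *
      (M (?U False True) (?U False True) * M (?U True True) (?U True True))) (of_rat r) = poly (?S ^ 4) (of_rat r)"
    "poly ?X (of_rat r) \<noteq> 0" if nz: "poly D (of_rat r) \<noteq> 0" for r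
  proof -
    obtain g where g: "autsys n g" "\<And>d e. g d e * iK (poly D (of_rat r)) = iK (poly (M d e) (of_rat r))"
      using fibre[OF nz] by blast
    have Dr: "iK (poly D (of_rat r)) \<noteq> 0" using nz by simp
    have diag: "g (?U a b) (Gen j) = 0" if "j \<noteq> GU a b" for a b j
    proof (cases "j \<in> gens n")
      case True
      then show ?thesis using g(2)[of "?U a b" "Gen j"] Dr off[OF True that] by simp
    next
      case False
      then show ?thesis by (intro autsys_supp[OF g(1)]) simp_all
    qed
    note nrm = autsys_norm[OF g(1) diag]
    show "poly ?X (of_rat r) \<noteq> 0" using g(2)[of "?U False False" "?U False False"] nrm(1)[of False False] Dr by auto
    let ?d = "iK (poly D (of_rat r))" and ?g = "\<lambda>a b. g (?U a b) (?U a b)"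
    have "(?g False False * ?d) * (?g True False * ?d) * ((?g False True * ?d) * (?g True True * ?d)) = (g (Gen GE) (Gen GE) * ?d) ^ 4"
      using nrm(2) by (simp add: power_mult_distrib) (simp add: power4_eq_xxxx ac_simps)
    then have "iK (poly (M (?U False False) (?U False False) * M (?U True False) (?U True False) *
      (M (?U False True) (?U False True) * M (?U True True) (?U True True))) (of_rat r)) = iK (poly (?S ^ 4) (of_rat r))"
      unfolding g(2) by (simp add: power4_eq_xxxx)
    then show "poly (M (?U False False) (?U False False) * M (?U True False) (?U True False) *
      (M (?U False True) (?U False True) * M (?U True True) (?U True True))) (of_rat r) = poly (?S ^ 4) (of_rat r)"
      by (rule injD[OF inj_iK])
  qed
  \<comment> \<open>The polynomials P have rational coefficients, and \<open>cf\<close> and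
    \<open>xF\<close> are equivariant. So the diagonal entries at the u are conjugate to each other,
    while the entry at the fixed generator e is its own conjugate and has norm equal to its fourth
    power.\<close>
  have conj: "M (actD h d) (actD h e) = cjp h (M d e)" if "d \<in> idxs n" for h d e
  proof (rule poly_eqI_rat)
    fix r
    have "cj h (poly (RQ (P x y)) (of_rat r)) = poly (RQ (P x y)) (of_rat r)" if "x \<in> B" "y \<in> B" for x y
      using eval_kQ[OF Ps[OF that], of r] by auto
    then show "poly (M (actD h d) (actD h e)) (of_rat r) = poly (cjp h (M d e)) (of_rat r)"
      unfolding poly_cjp_rat M cj_sum
      by (intro sum.cong refl) (simp add: cf_act[OF \<open>d \<in> idxs n\<close>] formQ_equiv[OF xF_formQ])
  qed
  have "polynorm ?X = M (?U False False) (?U False False) * M (?U True False) (?U True False) *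
      (M (?U False True) (?U False True) * M (?U True True) (?U True True))"
    unfolding polynorm_def by (simp flip: conj)
  moreover have "polynorm ?S = ?S ^ 4"
    unfolding polynorm_def by (simp add: power4_eq_xxxx mult.assoc flip: conj)
  moreover have "M (?U False False) (?U False False) * M (?U True False) (?U True False) *
      (M (?U False True) (?U False True) * M (?U True True) (?U True True)) - ?S ^ 4 = 0"
    by (rule quad_poly_eq_zero[OF D]) (use norm(1) in simp)
  ultimately have pn: "polynorm ?X = polynorm ?S" by simp
  have X01: "poly ?X 0 \<noteq> 0" "poly ?X 1 \<noteq> 0" using norm(2)[of 0] norm(2)[of 1] D01 by simp_all
  \<comment> \<open>The fourth power of S is the product of the diagonal entries at the u, none of
    which vanishes at 0 or 1.\<close>
  have S01: "poly ?S 0 \<noteq> 0" "poly ?S 1 \<noteq> 0"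
  proof -
    have nz: "poly (M (?U a b) (?U a b)) (of_rat r) \<noteq> 0" if "poly D (of_rat r) \<noteq> 0" for a b r
      using norm(2)[OF that] conj[of "?U False False" "(a, b)" "?U False False"] by (simp add: poly_cjp_rat)
    show "poly ?S 0 \<noteq> 0" "poly ?S 1 \<noteq> 0"
      using norm(1)[of 0] norm(1)[of 1] nz[of 0] nz[of 1] D01 by auto
  qed
  have r0: "mq f0 (?U False False) (?U False False) / mq f0 (Gen GE) (Gen GE) = poly ?X 0 / poly ?S 0"
    unfolding e0[symmetric] using D01 by simp
  have r1: "mq f1 (?U False False) (?U False False) / mq f1 (Gen GE) (Gen GE) = poly ?X 1 / poly ?S 1"
    unfolding e1[symmetric] using D01 by simp
  \<comment> \<open>The quotient X / S at 1 is its value at 0 times the change along the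
    curve.\<close>
  have "(poly ?X 1 / poly ?X 0) / (poly ?S 1 / poly ?S 0) * (poly ?X 0 / poly ?S 0) \<in> cob"
    by (rule cob_mult[OF ratio_in_cob[OF pn X01 S01]]) (use f0 r0 in \<open>simp add: trivial_class_def\<close>)
  then have "poly ?X 1 / poly ?S 1 \<in> cob" using X01 S01 by (simp add: field_simps)
  moreover have "mq f1 (?U a b) (Gen j) = 0" if "j \<in> gens n" "j \<noteq> GU a b" for a b j
    using e1[of "?U a b" "Gen j"] off[OF that] D01 by simp
  ultimately show ?thesis unfolding trivial_class_def r1 by blast
qed

section \<open>A rational point that is not R-equivalent to the identity\<close>

lemma mq_df: assumes c: "rational c" and d: "d \<in> idxs n" shows "mq (QS.df c) d e = wt c d * dl d e"
proof -
  have "iK (mq (QS.df c) d e) = mt (KS.df (\<lambda>a. iK (c a))) d e"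
    unfolding mq_def mt_def iK_sum
  proof (intro sum.cong refl)
    fix x y assume xy: "x \<in> B" "y \<in> B"
    obtain r where r: "mat_entry kQ B x y (QS.df c) = of_rat r"
      using mat_entry_rational(1)[OF c xy] by (auto simp: Rats_def)
    show "iK (cf d x * xF y e * of_rat (ratq (mat_entry kQ B x y (QS.df c)))) =
        iK (cf d x * xF y e) * KT.ab (mat_entry KK B x y (KS.df (\<lambda>a. iK (c a))))"
      unfolding mat_entry_rational(2)[OF c xy] r by (simp flip: Kr_of_rat)
  qed
  also have "\<dots> = wt (\<lambda>a. iK (c a)) d * dl d e"
    unfolding mt_df[OF rational_rel[OF c] d] ..
  also have "wt (\<lambda>a. iK (c a)) d = iK (wt c d)" by (rule wt_hom) auto
  also have "iK (wt c d) * dl d e = iK (wt c d * dl d e)" by (simp add: dl_def)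
  finally show ?thesis by (rule injD[OF inj_iK])
qed

lemma df_GQ: assumes "rational c" shows "QS.df c \<in> GQ"
proof -
  have "QS.df c \<in> alg_aut kQ QS.ME" by (rule QS.df_aut[OF QS_diagok[OF assms]])
  moreover have "extend_map B kQ KK toK (QS.df c) \<in> GG"
    unfolding extend_map_df[OF assms] using TK_subset_geom_G rational_rel[OF assms] unfolding TK_def by blast
  ultimately show ?thesis by (simp add: G_points_def Aut_Q_eq)
qed

text \<open>The rational point of the torus with weight \<xi> at the first u and 1 at e. The other u
  get the conjugates, the weights of the y are forced, and y y' = e^2 says that \<xi> has norm
  1.\<close>

fun cxi :: "gen \<Rightarrow> quad" where
  "cxi (GU a b) = cj (a, b) xi"
| "cxi (GY a) = cj (a, False) xi * cj (a, True) xi"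
| "cxi GE = 1"
| "cxi (GP a i) = 1"

lemma rational_cxi: "rational cxi"
  unfolding rational_def
proof (intro conjI allI)
  have xi: "xi \<noteq> 0" by (auto simp: xi_def zero_quad_def)
  show "rel n cxi"
  proof (rule relI)
    show "cxi a \<noteq> 0" for a using xi by (cases a) auto
    show "cxi (GY False) * cxi (GY True) = (cxi GE)\<^sup>2"
      by (intro quad_eqI) (simp_all add: xi_def)
  qed simp_all
  show "cxi (act g a) = cj g (cxi a)" for g a
  proof (cases a)
    case (GU x y)
    have "gmul g (x, y) = (x \<noteq> fst g, y \<noteq> snd g)" by (auto simp: gmul_def)
    then show ?thesis by (simp add: GU cj_cj)
  next
    case (GY x)
    have "gmul g (x, y) = (x \<noteq> fst g, y \<noteq> snd g)" for y by (auto simp: gmul_def)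
    then show ?thesis by (cases "snd g") (simp_all add: GY cj_cj mult.commute)
  qed simp_all
qed

lemma not_R_trivial_Aalg: "\<not> R_trivial kQ (Aalg n) B"
proof
  assume R: "R_trivial kQ (Aalg n) B"
  let ?f = "QS.df (\<lambda>_. 1)" and ?g = "QS.df cxi"
  have one: "rational (\<lambda>_. 1)" by (simp add: rational_def rel_one)
  \<comment> \<open>R-triviality already fails over the base field, so the trivial extension is
    taken.\<close>
  have "(\<lambda>c. c) \<in> ring_hom kQ kQ" by (simp add: ring_hom_def)
  then have "R_equivalent kQ (Aalg n) B kQ (\<lambda>c. c) ?f ?g"
    using R field_kQ df_GQ[OF one] df_GQ[OF rational_cxi] unfolding R_trivial_def by blast
  then have "(R_link kQ (Aalg n) B kQ (\<lambda>c. c))\<^sup>*\<^sup>* ?f ?g" unfolding R_equivalent_def .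
  moreover have "trivial_class ?f"
    by (simp add: trivial_class_def mq_df[OF one] dl_def cob_one)
  ultimately have "trivial_class ?g" by (induction rule: rtranclp_induct) (auto intro: trivial_class_link)
  then have "xi \<in> cob" by (simp add: trivial_class_def mq_df[OF rational_cxi] dl_def)
  then show False using xi_notin_cob by contradiction
qed

end

theorem theorem5:
  fixes n :: nat
  assumes "n \<ge> 3"
  shows "\<exists>(k :: complex ring) (A :: (complex, nat \<Rightarrow> complex) module) E.
    field k \<and> algebra k A \<and> finite E \<and> vectorspace.basis k A E \<and>
    (let J = jacobson_radical A
     in vectorspace.dim k (quotient_module A J (J \<cdot>\<^bsub>A\<^esub> J)) \<ge> 2 * n) \<and>
    \<not> R_trivial k A E \<and>
    has_rank k A E (n + 1)"
proof -
  obtain B where B: "finite B" "vectorspace.basis kQ (Aalg n) B" using exists_basis by blast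
  interpret rat_form n B by (rule rat_form.intro[OF assms B])
  have "let J = jacobson_radical (Aalg n)
      in 2 * n \<le> vectorspace.dim kQ (quotient_module (Aalg n) J (J \<cdot>\<^bsub>Aalg n\<^esub> J))"
    unfolding Let_def jacobson_radical_Aalg by (rule dim_QQ[OF assms])
  then show ?thesis
    by (intro exI[of _ kQ] exI[of _ "Aalg n"] exI[of _ B] conjI field_kQ algebra_Aalg B
        not_R_trivial_Aalg rank_Aalg)
qed

end
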